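(* For each $n\ge 2$ let $\boldsymbol{\theta}^*=\boldsymbol{\theta}^*_n=(\alpha_1^*,\ldots,\alpha_n^*,\beta_1^*,\ldots,\beta_{n-1}^* )^\top\in\mathbb{R}^{2n-1}$ with $\beta_n^*=0$, and let $\epsilon_n>0$ be privacy parameters that are bounded above by a fixed constant. Assume that $A\sim\mathbb{P}_{\boldsymbol{\theta}^*}$, the $p_0$ model with parameter $\boldsymbol{\theta}^*$, and let $\widehat{\boldsymbol{\theta}}_{in}$ be the estimator obtained from the moment equations based on the bi-degree sequence of the edge-flipped graph $A'$ with privacy parameter $\epsilon_n$ (all defined in the context). If $$\epsilon_n^{-1}e^{18\|\boldsymbol{\theta}^*\|_\infty}=o\big(n^{1/2}(\log n)^{-1}\big),$$ then for any fixed $k\ge 1$, as $n\to\infty$, the vector consisting of the first $k$ elements of $\widehat{\boldsymbol{\theta}}_{in}-\boldsymbol{\theta}^*$ is asymptotically multivariate normal with mean $\mathbf{0}$ and covariance matrix given by the upper left $k\times k$ block $M^{(k)}$ of the $(2n-1)\times(2n-1)$ matrix $$M=\begin{pmatrix}M_{11}&M_{12}\\ M_{12}^\top&M_{22}\end{pmatrix};$$ that is, $(M^{(k)})^{-1/2}$ times this vector converges in distribution to the standard normal distribution on $\mathbb{R}^k$. Here $$M_{11}=\frac{\sigma_{2n}^2}{v_{2n,2n}^2}+\operatorname{diag}\Big(\frac{\sigma_1^2}{v_{1,1}^2},\ldots,\frac{\sigma_n^2}{v_{n,n}^2}\Big)$$ is $n\times n$, $M_{12}$ is the $n\times(n-1)$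 matrix whose elements are all equal to $-\sigma_{2n}^2/v_{2n,2n}^2$, and $$M_{22}=\frac{\sigma_{2n}^2}{v_{2n,2n}^2}+\operatorname{diag}\Big(\frac{\sigma_{n+1}^2}{v_{n+1,n+1}^2},\ldots,\frac{\sigma_{2n-1}^2}{v_{2n-1,2n-1}^2}\Big)$$ is $(n-1)\times(n-1)$; a scalar added to a matrix is added to every entry, and $v_{i,i}$ and $\sigma_i^2$ (defined in the context) are evaluated at $\boldsymbol{\theta}^*$.
   Context: **The $p_0$ model.** $A=(a_{i,j})_{1\le i,j\le n}$ is the adjacency matrix of a simple directed graph on nodes $1,\ldots,n$ (no self-loops: $a_{i,i}=0$). Under $\mathbb{P}_{\boldsymbol{\theta}}$ with $\boldsymbol{\theta}=(\alpha_1,\ldots,\alpha_n,\beta_1,\ldots,\beta_{n-1})^\top$ and the identification convention $\beta_n=0$, the entries $a_{i,j}$, $1\le i\ne j\le n$, are mutually independent Bernoulli random variables with $$\mathbb{P}(a_{i,j}=1)=\frac{e^{\alpha_i+\beta_j}}{1+e^{\alpha_i+\beta_j}}.$$ Equivalently, the graph has probability proportional to $\exp(\sum_i\alpha_i d_i^+ +\sum_j\beta_j d_j^-)$, where $d_i^+=\sum_{j\ne i}a_{i,j}$ and $d_j^-=\sum_{i\ne j}a_{i,j}$. **Edge-flipping mechanism.** Given $\epsilon_n>0$, set $p=p_n=1/(1+e^{-\epsilon_n})$. Independently over all ordered pairs $(i,j)$, $i\neq j$ (and independently of $A$), set $a'_{i,j}=a_{i,j}$ with probability $p$ and $a'_{i,j}=1-a_{i,j}$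 with probability $1-p$. The flipped bi-degrees are $d_i'^{+}=\sum_{j\ne i}a'_{i,j}$ and $d_j'^{-}=\sum_{i\ne j}a'_{i,j}$. **Estimator.** $\widehat{\boldsymbol{\theta}}_{in}=(\hat\alpha_1,\ldots,\hat\alpha_n,\hat\beta_1,\ldots,\hat\beta_{n-1})^\top\in\mathbb{R}^{2n-1}$ (with $\hat\beta_n=0$) denotes the solution $\boldsymbol{\theta}$ of the system of $2n-1$ equations $$d_i'^{+}=\sum_{j\ne i}\frac{p e^{\alpha_i+\beta_j}+(1-p)}{1+e^{\alpha_i+\beta_j}},\quad i=1,\ldots,n,$$ $$d_j'^{-}=\sum_{i\ne j}\frac{p e^{\alpha_i+\beta_j}+(1-p)}{1+e^{\alpha_i+\beta_j}},\quad j=1,\ldots,n-1,$$ with $\beta_n=0$. (On the event that no solution exists, the estimator may be assigned an arbitrary value.) **The quantities $v_{i,i}$ and $\sigma_i^2$.** With $\beta_n=0$, $$v_{i,i}=\sum_{k\ne i}\frac{(2p-1)e^{\alpha_i+\beta_k}}{(1+e^{\alpha_i+\beta_k})^2}\ (1\le i\le n),\qquad v_{i,i}=\sum_{k\ne i-n}\frac{(2p-1)e^{\alpha_k+\beta_{i-n}}}{(1+e^{\alpha_k+\beta_{i-n}})^2}\ (n+1\le i\le 2n),$$ $$\sigma_i^2=\operatorname{Var}(d_i'^{+})=\sum_{k\ne i}\frac{[pe^{\alpha_i+\beta_k}+1-p]\,[(1-p)e^{\alpha_i+\beta_k}+p]}{(1+e^{\alpha_i+\beta_k})^2}\ (1\le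 i\le n),$$ $$\sigma_i^2=\operatorname{Var}(d_{i-n}'^{-})=\sum_{k\ne i-n}\frac{[pe^{\alpha_k+\beta_{i-n}}+1-p]\,[(1-p)e^{\alpha_k+\beta_{i-n}}+p]}{(1+e^{\alpha_k+\beta_{i-n}})^2}\ (n+1\le i\le 2n),$$ where sums over $k$ range over $\{1,\ldots,n\}$ with the indicated index removed. **Norm.** $\|\cdot\|_\infty$ is the maximum absolute entry of a vector. *)

theory Defs
  imports "HOL-Probability.Probability" "HOL-Library.Landau_Symbols"
begin

section \<open>The directed \<open>p\<^sub>0\<close> model and edge flipping\<close>

text \<open>
  A parameter vector \<open>\<theta> = (\<alpha>\<^sub>1, \<dots>, \<alpha>\<^sub>n, \<beta>\<^sub>1, \<dots>, \<beta>\<^sub>n\<^sub>-\<^sub>1)\<close> of length \<open>2 n - 1\<close> is a function on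
  \<open>nat\<close> of which only the values at \<open>{1..2*n-1}\<close> are used; \<open>\<beta>\<^sub>n = 0\<close> is part of the decoding.
\<close>

definition out_par :: "(nat \<Rightarrow> real) \<Rightarrow> nat \<Rightarrow> real" where
  "out_par \<theta> i = \<theta> i"

definition in_par :: "nat \<Rightarrow> (nat \<Rightarrow> real) \<Rightarrow> nat \<Rightarrow> real" where
  "in_par n \<theta> j = (if j = n then 0 else \<theta> (n + j))"

definition edge_exp :: "nat \<Rightarrow> (nat \<Rightarrow> real) \<Rightarrow> nat \<Rightarrow> nat \<Rightarrow> real" where
  "edge_exp n \<theta> i j = exp (out_par \<theta> i + in_par n \<theta> j)"

definition par_norm :: "nat \<Rightarrow> (nat \<Rightarrow> real) \<Rightarrow> real" where
  "par_norm n \<theta> = Max ((\<lambda>i. \<bar>\<theta> i\<bar>) ` {1..2 * n - 1})"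

definition node_pairs :: "nat \<Rightarrow> (nat \<times> nat) set" where
  "node_pairs n = {(i, j). i \<in> {1..n} \<and> j \<in> {1..n} \<and> i \<noteq> j}"

text \<open>A random adjacency matrix is given by its Boolean entries \<open>a i j\<close>.\<close>

definition p0_model ::
  "'w measure \<Rightarrow> nat \<Rightarrow> (nat \<Rightarrow> real) \<Rightarrow> (nat \<Rightarrow> nat \<Rightarrow> 'w \<Rightarrow> bool) \<Rightarrow> bool" where
  "p0_model M n \<theta> a \<longleftrightarrow>
     (\<forall>i\<in>{1..n}. \<forall>\<omega>\<in>space M. \<not> a i i \<omega>) \<and>
     prob_space.indep_vars M (\<lambda>_. count_space UNIV) (\<lambda>(i, j). a i j) (node_pairs n) \<and>
     (\<forall>(i, j)\<in>node_pairs n.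
        measure M {\<omega> \<in> space M. a i j \<omega>} = edge_exp n \<theta> i j / (1 + edge_exp n \<theta> i j))"

text \<open>
  The event that the entry \<open>(i, j)\<close> is kept is \<open>a' i j = a i j\<close>.  As the entries of \<open>a\<close> are
  independent in the model, independence of the flips from each other and from \<open>a\<close> amounts to
  mutual independence of all entries of \<open>a\<close> together with all these events.
\<close>

definition edge_flip ::
  "'w measure \<Rightarrow> nat \<Rightarrow> real \<Rightarrow> (nat \<Rightarrow> nat \<Rightarrow> 'w \<Rightarrow> bool) \<Rightarrow> (nat \<Rightarrow> nat \<Rightarrow> 'w \<Rightarrow> bool) \<Rightarrow> bool" where
  "edge_flip M n p a a' \<longleftrightarrow>
     prob_space.indep_vars M (\<lambda>_. count_space UNIV)
       (\<lambda>e \<omega>. case e of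
            Inl (i, j) \<Rightarrow> a i j \<omega>
          | Inr (i, j) \<Rightarrow> (a' i j \<omega> \<longleftrightarrow> a i j \<omega>))
       (node_pairs n <+> node_pairs n) \<and>
     (\<forall>(i, j)\<in>node_pairs n. measure M {\<omega> \<in> space M. a' i j \<omega> \<longleftrightarrow> a i j \<omega>} = p)"

definition keep_prob :: "real \<Rightarrow> real" where
  "keep_prob \<epsilon> = 1 / (1 + exp (- \<epsilon>))"

definition out_degree :: "nat \<Rightarrow> (nat \<Rightarrow> nat \<Rightarrow> 'w \<Rightarrow> bool) \<Rightarrow> 'w \<Rightarrow> nat \<Rightarrow> real" where
  "out_degree n a \<omega> i = (\<Sum>j\<in>{1..n} - {i}. of_bool (a i j \<omega>))"

definition in_degree :: "nat \<Rightarrow> (nat \<Rightarrow> nat \<Rightarrow> 'w \<Rightarrow> bool) \<Rightarrow> 'w \<Rightarrow> nat \<Rightarrow> real" where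
  "in_degree n a \<omega> j = (\<Sum>i\<in>{1..n} - {j}. of_bool (a i j \<omega>))"

section \<open>The moment estimator\<close>

definition moment_equations ::
  "nat \<Rightarrow> real \<Rightarrow> (nat \<Rightarrow> real) \<Rightarrow> (nat \<Rightarrow> real) \<Rightarrow> (nat \<Rightarrow> real) \<Rightarrow> bool" where
  "moment_equations n p dout din \<theta> \<longleftrightarrow>
     (\<forall>i\<in>{1..n}. dout i =
        (\<Sum>j\<in>{1..n} - {i}. (p * edge_exp n \<theta> i j + (1 - p)) / (1 + edge_exp n \<theta> i j))) \<and>
     (\<forall>j\<in>{1..n - 1}. din j =
        (\<Sum>i\<in>{1..n} - {j}. (p * edge_exp n \<theta> i j + (1 - p)) / (1 + edge_exp n \<theta> i j)))"

text \<open>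
  A random vector that solves the moment equations at every sample point at which they are
  solvable; its value at the other sample points is unconstrained.
\<close>

definition moment_estimator ::
  "'w measure \<Rightarrow> nat \<Rightarrow> real \<Rightarrow> (nat \<Rightarrow> nat \<Rightarrow> 'w \<Rightarrow> bool) \<Rightarrow> ('w \<Rightarrow> nat \<Rightarrow> real) \<Rightarrow> bool" where
  "moment_estimator M n p a' est \<longleftrightarrow>
     (\<forall>i\<in>{1..2 * n - 1}. (\<lambda>\<omega>. est \<omega> i) \<in> borel_measurable M) \<and>
     (\<forall>\<omega>\<in>space M.
        (\<exists>\<theta>. moment_equations n p (out_degree n a' \<omega>) (in_degree n a' \<omega>) \<theta>) \<longrightarrow>
        moment_equations n p (out_degree n a' \<omega>) (in_degree n a' \<omega>) (est \<omega>))"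

section \<open>The asymptotic covariance matrix\<close>

definition v_diag :: "nat \<Rightarrow> real \<Rightarrow> (nat \<Rightarrow> real) \<Rightarrow> nat \<Rightarrow> real" where
  "v_diag n p \<theta> i =
     (if i \<le> n
      then \<Sum>k\<in>{1..n} - {i}. (2 * p - 1) * edge_exp n \<theta> i k / (1 + edge_exp n \<theta> i k)\<^sup>2
      else \<Sum>k\<in>{1..n} - {i - n}.
             (2 * p - 1) * edge_exp n \<theta> k (i - n) / (1 + edge_exp n \<theta> k (i - n))\<^sup>2)"

text \<open>The variances of the flipped out-degrees (\<open>i \<le> n\<close>) and in-degrees (\<open>i > n\<close>).\<close>

definition sigma_sq :: "nat \<Rightarrow> real \<Rightarrow> (nat \<Rightarrow> real) \<Rightarrow> nat \<Rightarrow> real" where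
  "sigma_sq n p \<theta> i =
     (if i \<le> n
      then \<Sum>k\<in>{1..n} - {i}.
             (p * edge_exp n \<theta> i k + 1 - p) * ((1 - p) * edge_exp n \<theta> i k + p)
               / (1 + edge_exp n \<theta> i k)\<^sup>2
      else \<Sum>k\<in>{1..n} - {i - n}.
             (p * edge_exp n \<theta> k (i - n) + 1 - p) * ((1 - p) * edge_exp n \<theta> k (i - n) + p)
               / (1 + edge_exp n \<theta> k (i - n))\<^sup>2)"

text \<open>
  Entry \<open>(i, j)\<close>, for \<open>i, j \<in> {1..2*n-1}\<close>, of the block matrix with diagonal blocks of sizes \<open>n\<close>
  and \<open>n - 1\<close>.
\<close>

definition asymp_cov :: "nat \<Rightarrow> real \<Rightarrow> (nat \<Rightarrow> real) \<Rightarrow> nat \<Rightarrow> nat \<Rightarrow> real" where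
  "asymp_cov n p \<theta> i j =
     (let c = sigma_sq n p \<theta> (2 * n) / (v_diag n p \<theta> (2 * n))\<^sup>2 in
      if (i \<le> n \<longleftrightarrow> j \<le> n)
      then c + (if i = j then sigma_sq n p \<theta> i / (v_diag n p \<theta> i)\<^sup>2 else 0)
      else - c)"

section \<open>Multivariate convergence in distribution\<close>

definition sym_pos_def :: "real^'k^'k \<Rightarrow> bool" where
  "sym_pos_def A \<longleftrightarrow> transpose A = A \<and> (\<forall>x. x \<noteq> 0 \<longrightarrow> x \<bullet> (A *v x) > 0)"

text \<open>For symmetric positive definite \<open>A\<close>, the principal square root of \<open>A\<^sup>-\<^sup>1\<close>.\<close>

definition matrix_inv_sqrt :: "real^'k^'k \<Rightarrow> real^'k^'k" where
  "matrix_inv_sqrt A = (THE B. sym_pos_def B \<and> B ** B = matrix_inv A)"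

definition std_normal_vec :: "(real^'k) measure" where
  "std_normal_vec = density lborel (\<lambda>x. ennreal (\<Prod>i\<in>UNIV. std_normal_density (x $ i)))"

definition weak_conv_vec :: "(nat \<Rightarrow> (real^'k) measure) \<Rightarrow> (real^'k) measure \<Rightarrow> bool" where
  "weak_conv_vec \<mu> \<nu> \<longleftrightarrow>
     (\<forall>f :: real^'k \<Rightarrow> real. continuous_on UNIV f \<and> bounded (range f) \<longrightarrow>
        (\<lambda>n. integral\<^sup>L (\<mu> n) f) \<longlonglongrightarrow> integral\<^sup>L \<nu> f)"

end

theory Submission
  imports Defs
begin

text \<open>
  Write \<open>x\<^sub>i\<^sub>j = \<alpha>\<^sub>i + \<beta>\<^sub>j\<close> for the true logits and \<open>q = 2 p - 1\<close>.  A flipped entry is Bernoulli with mean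
  \<open>(1 - p) + q logistic x\<^sub>i\<^sub>j\<close>, so for the increments \<open>u\<^sub>i\<close> of \<open>\<alpha>\<^sub>i\<close> and \<open>- v\<^sub>j\<close> of \<open>\<beta>\<^sub>j\<close> the moment
  equations say that the sums of \<open>logistic (x\<^sub>i\<^sub>j + u\<^sub>i - v\<^sub>j) - logistic x\<^sub>i\<^sub>j\<close> over \<open>j\<close>, and over \<open>i\<close>, are
  the centred degrees divided by \<open>q\<close>.  By the mean value theorem this is a weighted Laplace equation
  on the complete bipartite graph without a perfect matching: up to noise, each \<open>u\<^sub>i\<close> is a weighted
  average of the \<open>v\<^sub>j\<close>, and conversely.  Two such averages share all but two of their points, and
  their weights are at least a multiple of \<open>m \<approx> exp (- 2 \<parallel>\<theta>\<parallel>)\<close> times the uniform ones, so averaging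
  shrinks oscillation by the factor \<open>1 - 2 m\<close> (\<open>wmean_contraction\<close>).  Hence the oscillation of a
  solution is at most the noise divided by \<open>m\<close> (\<open>oscillation_bound\<close>).  This replaces all estimates
  of the inverse of the Jacobian.

  The bound is used twice.  First, minimise the convex potential of the equations over a box.  At the
  minimiser every equation holds or the coordinate is clamped at an end of the box; the oscillation
  bound survives clamping and shows that only one end can occur, and then the balance between rows and
  columns makes every gradient vanish (\<open>logistic_system_solvable\<close>).  Solutions are unique by
  monotonicity (\<open>logistic_system_unique\<close>), so the estimator is this one.  Second, after subtracting
  the candidates \<open>g\<^sub>i / W\<^sub>i\<close> and \<open>- h\<^sub>j / W'\<^sub>j\<close> the equations have the same averaging form, now with a
  much smaller right-hand side: a quadratic Taylor error, and averages of the noise over rows or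
  columns, in which independent terms cancel.  As \<open>v\<^sub>n = 0\<close> fixes the additive constant, the error in
  \<open>\<alpha>\<^sub>k\<close> is the centred out-degree of \<open>k\<close> divided by \<open>v\<^sub>k\<^sub>,\<^sub>k\<close>, plus the centred in-degree of \<open>n\<close> divided by
  \<open>v\<^sub>2\<^sub>n\<^sub>,\<^sub>2\<^sub>n\<close>, up to a remainder (\<open>logistic_system_expansion\<close>); these two terms are the source of the
  diagonal part and of the constant part of the covariance matrix.

  Hoeffding's inequality bounds all the noise terms simultaneously outside an event of probability
  at most \<open>8 / n\<close> (\<open>good_prob\<close>).  Any linear combination of the leading terms is a linear form in
  the independent flipped entries; its characteristic function is a product, compared factor by factor with a
  Gaussian one (\<open>bernoulli_sum_char\<close>).  Its variance differs from the quadratic form of the covariance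
  matrix only through the entries \<open>(k, n)\<close> counted in both degrees, which are negligible
  (\<open>lead_variance\<close>).  So the characteristic functions of the normalised error converge to
  \<open>exp (- \<parallel>t\<parallel>\<^sup>2 / 2)\<close> (\<open>estimator_char_rate\<close>), and a continuity theorem for the standard normal law on
  \<open>\<real>\<^sup>k\<close>, proved by Gaussian smoothing (\<open>weak_conv_std_normal_vecI\<close>), gives weak convergence.
\<close>

section \<open>Weighted averages contract oscillation\<close>

text \<open>
  The weights are not normalised; if they add up to \<open>0\<close>, the mean is \<open>0\<close> by the convention for division.
\<close>

definition wmean :: "('a \<Rightarrow> real) \<Rightarrow> 'a set \<Rightarrow> ('a \<Rightarrow> real) \<Rightarrow> real" where
  "wmean f S z = (\<Sum>j\<in>S. f j * z j) / (\<Sum>j\<in>S. f j)"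

text \<open>
  On \<open>J\<close> the normalised weights are at least \<open>m / (c |S|)\<close>, since the total weight is at most \<open>c |S|\<close>;
  this much of the mass pulls the average away from the upper bound \<open>B\<close>.
\<close>

lemma wmean_le_minorised:
  assumes fin: "finite S" and "S \<noteq> {}" and m: "m > 0"
    and f: "\<And>j. j \<in> S \<Longrightarrow> m \<le> f j \<and> f j \<le> c"
    and z: "\<And>j. j \<in> S \<Longrightarrow> z j \<le> B" and J: "J \<subseteq> S"
  shows "wmean f S z \<le> B - m / (c * card S) * (\<Sum>j\<in>J. B - z j)"
proof -
  define F where "F = (\<Sum>j\<in>S. f j)"
  have F: "0 < F"
    unfolding F_def using f m \<open>S \<noteq> {}\<close> fin by (intro sum_pos) (auto intro: less_le_trans)
  have F2: "F \<le> c * card S"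
    unfolding F_def using sum_bounded_above[of S f c] f by (simp add: mult.commute)
  have pos: "0 < c * card S" using F F2 by linarith
  have D: "0 \<le> (\<Sum>j\<in>J. B - z j)"
    using z J by (intro sum_nonneg) auto
  have "m * (\<Sum>j\<in>J. B - z j) = (\<Sum>j\<in>J. m * (B - z j))" by (simp add: sum_distrib_left)
  also have "\<dots> \<le> (\<Sum>j\<in>J. f j * (B - z j))"
    using f z J by (intro sum_mono mult_right_mono) (auto simp: subset_iff)
  also have "\<dots> \<le> (\<Sum>j\<in>S. f j * (B - z j))"
    using f z J m by (intro sum_mono2 fin mult_nonneg_nonneg) (auto intro: order.trans[of 0 m])
  also have "\<dots> = F * B - (\<Sum>j\<in>S. f j * z j)"
    by (simp add: F_def algebra_simps sum_subtractf sum_distrib_right sum_distrib_left)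
  finally have *: "m * (\<Sum>j\<in>J. B - z j) \<le> F * B - (\<Sum>j\<in>S. f j * z j)" .
  have "m / (c * card S) * (\<Sum>j\<in>J. B - z j) = m * (\<Sum>j\<in>J. B - z j) / (c * card S)" by simp
  also have "\<dots> \<le> m * (\<Sum>j\<in>J. B - z j) / F"
    using F F2 D m by (intro divide_left_mono) auto
  also have "\<dots> \<le> (F * B - (\<Sum>j\<in>S. f j * z j)) / F"
    using * F by (intro divide_right_mono) auto
  also have "\<dots> = B - wmean f S z"
    using F by (simp add: wmean_def F_def field_simps)
  finally show ?thesis by simp
qed

lemma wmean_uminus: "wmean f S (\<lambda>j. - z j) = - wmean f S z"
  by (simp add: wmean_def sum_negf)

lemma wmean_add: "wmean f S (\<lambda>j. z j + y j) = wmean f S z + wmean f S y"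
  by (simp add: wmean_def algebra_simps sum.distrib add_divide_distrib)

lemma wmean_le:
  assumes "finite S" "S \<noteq> {}" "\<And>j. j \<in> S \<Longrightarrow> 0 < f j" "\<And>j. j \<in> S \<Longrightarrow> z j \<le> B"
  shows "wmean f S z \<le> B"
proof -
  have F: "0 < (\<Sum>j\<in>S. f j)" using assms by (intro sum_pos) auto
  have "(\<Sum>j\<in>S. f j * z j) \<le> (\<Sum>j\<in>S. f j * B)"
    using assms by (intro sum_mono mult_left_mono) (auto simp: less_imp_le)
  also have "\<dots> = B * (\<Sum>j\<in>S. f j)" by (simp add: sum_distrib_left mult.commute)
  finally show ?thesis using F by (simp add: wmean_def divide_le_eq)
qed

lemma wmean_ge:
  assumes "finite S" "S \<noteq> {}" "\<And>j. j \<in> S \<Longrightarrow> 0 < f j" "\<And>j. j \<in> S \<Longrightarrow> b \<le> z j"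
  shows "b \<le> wmean f S z"
  using wmean_le[of S f "\<lambda>j. - z j" "-b"] assms by (simp add: wmean_uminus)

lemma off_diagonal_card:
  assumes "finite I" "card I \<ge> 3" "i \<in> I"
  shows "real (card (I - {i})) = real (card I) - 1" "I - {i} \<noteq> {}"
proof -
  show 1: "real (card (I - {i})) = real (card I) - 1" using assms by simp
  have "real (card (I - {i})) \<noteq> real (card {})" unfolding 1 using assms(2) by auto
  then show "I - {i} \<noteq> {}" by metis
qed

lemma lower_weight_le_quarter:
  fixes m :: real
  assumes "finite I" "card I \<ge> 3"
    and w: "\<And>i j. i \<in> I \<Longrightarrow> j \<in> I \<Longrightarrow> i \<noteq> j \<Longrightarrow> m \<le> w i j \<and> w i j \<le> 1/4"
  shows "m \<le> 1/4"
proof -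
  obtain i where i: "i \<in> I" using assms(2) by fastforce
  then obtain j where "j \<in> I" "i \<noteq> j" using off_diagonal_card(2)[OF assms(1,2)] by blast
  then show ?thesis using w[OF i] by force
qed

text \<open>
  A Doeblin estimate: both averages put at least the uniform mass \<open>4 m / (N - 1)\<close> on each of the \<open>N - 2\<close>
  common points of \<open>I - {i}\<close> and \<open>I - {k}\<close>, where \<open>N = |I|\<close>.  This common part cancels, and its total
  mass is at least \<open>2 m\<close> when \<open>N \<ge> 3\<close>.
\<close>

lemma wmean_contraction:
  assumes fin: "finite I" and N: "card I \<ge> 3" and ik: "i \<in> I" "k \<in> I" and m: "m > 0"
    and f: "\<And>j. j \<in> I - {i} \<Longrightarrow> m \<le> f j \<and> f j \<le> 1/4"
    and g: "\<And>j. j \<in> I - {k} \<Longrightarrow> m \<le> g j \<and> g j \<le> 1/4"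
    and z: "\<And>j. j \<in> I \<Longrightarrow> b \<le> z j \<and> z j \<le> B"
    and ne: "i \<noteq> k"
  shows "wmean f (I - {i}) z - wmean g (I - {k}) z \<le> (1 - 2 * m) * (B - b)"
proof -
  define J where "J = I - {i, k}"
  define l where "l = m / (1/4 * (real (card I) - 1))"
  note ci = off_diagonal_card(1)[OF fin N ik(1)] off_diagonal_card(1)[OF fin N ik(2)]
  note ne' = off_diagonal_card(2)[OF fin N ik(1)] off_diagonal_card(2)[OF fin N ik(2)]
  have cJ: "real (card J) = real (card I) - 2"
    unfolding J_def using ik ne fin N by (simp add: card_Diff_subset of_nat_diff)
  have 1: "wmean f (I - {i}) z \<le> B - l * (\<Sum>j\<in>J. B - z j)"
    using wmean_le_minorised[of "I - {i}" m f "1/4" z B J] fin f z ne' m unfolding l_def ci by (auto simp: J_def)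
  have 2: "wmean g (I - {k}) (\<lambda>j. - z j) \<le> (-b) - l * (\<Sum>j\<in>J. (-b) - (- z j))"
    using wmean_le_minorised[of "I - {k}" m g "1/4" "\<lambda>j. - z j" "-b" J] fin g z ne' m unfolding l_def ci by (auto simp: J_def)
  have Bb: "b \<le> B" using z ik by force
  have lJ: "2 * m \<le> l * card J"
    unfolding l_def cJ using N m by (simp add: field_simps)
  have "wmean f (I - {i}) z - wmean g (I - {k}) z \<le> (B - b) - l * ((\<Sum>j\<in>J. B - z j) + (\<Sum>j\<in>J. z j - b))"
    using 1 2 by (simp add: wmean_uminus algebra_simps)
  also have "(\<Sum>j\<in>J. B - z j) + (\<Sum>j\<in>J. z j - b) = card J * (B - b)"
    by (simp add: sum_subtractf algebra_simps)
  also have "(B - b) - l * (card J * (B - b)) \<le> (1 - 2 * m) * (B - b)"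
    using mult_right_mono[OF lJ, of "B - b"] Bb by (simp add: algebra_simps)
  finally show ?thesis .
qed

text \<open>
  If \<open>X\<close> and \<open>Y\<close> are the oscillations of \<open>u\<close> and \<open>v\<close>, contraction gives \<open>X \<le> (1 - 2 m) Y + 2 \<gamma>\<close> and
  \<open>Y \<le> (1 - 2 m) X + 2 \<gamma>\<close>.  The maximum with \<open>0\<close> in the hypotheses lets the lemma cover coordinates
  clamped to an interval, for which only one-sided comparisons with the averages are available.
\<close>

lemma oscillation_bound:
  assumes fin: "finite I" and N: "card I \<ge> 3" and m: "m > 0" and g0: "\<gamma> \<ge> 0"
    and w: "\<And>i j. i \<in> I \<Longrightarrow> j \<in> I \<Longrightarrow> i \<noteq> j \<Longrightarrow> m \<le> w i j \<and> w i j \<le> 1/4"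
    and u: "\<And>i k. i \<in> I \<Longrightarrow> k \<in> I \<Longrightarrow>
       u i - u k \<le> max 0 (wmean (w i) (I - {i}) v - wmean (w k) (I - {k}) v + 2 * \<gamma>)"
    and v: "\<And>j l. j \<in> I \<Longrightarrow> l \<in> I \<Longrightarrow>
       v j - v l \<le> max 0 (wmean (\<lambda>i. w i j) (I - {j}) u - wmean (\<lambda>i. w i l) (I - {l}) u + 2 * \<gamma>)"
    and i: "i \<in> I" and k: "k \<in> I"
  shows "u i - u k \<le> \<gamma> / m" "v i - v k \<le> \<gamma> / m"
proof -
  have ne: "I \<noteq> {}" using N by auto
  have m4: "m \<le> 1/4" by (rule lower_weight_le_quarter[OF fin N w])
  define X where "X = Max (u ` I) - Min (u ` I)"
  define Y where "Y = Max (v ` I) - Min (v ` I)"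
  have osc: "z i' - z k' \<le> Max (z ` I) - Min (z ` I)" if "i' \<in> I" "k' \<in> I" for z :: "'a \<Rightarrow> real" and i' k'
    using that fin by (intro diff_mono) auto
  have X0: "0 \<le> X" and Y0: "0 \<le> Y" using osc[OF i i, of u] osc[OF i i, of v] by (auto simp: X_def Y_def)
  have "X \<le> (1 - 2 * m) * Y + 2 * \<gamma>"
  proof -
    obtain i1 i0 where i1: "i1 \<in> I" "u i1 = Max (u ` I)" and i0: "i0 \<in> I" "u i0 = Min (u ` I)"
      using obtains_MAX[OF fin ne, of u] obtains_MIN[OF fin ne, of u] by metis
    show ?thesis
    proof (cases "i1 = i0")
      case True
      then show ?thesis using i1 i0 m4 Y0 g0 by (simp add: X_def)
    next
      case False
      have "wmean (w i1) (I - {i1}) v - wmean (w i0) (I - {i0}) v \<le> (1 - 2 * m) * Y"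
        unfolding Y_def using i1 i0 False fin N m w by (intro wmean_contraction) auto
      moreover have "0 \<le> (1 - 2 * m) * Y" using m4 Y0 by simp
      ultimately show ?thesis using u[OF i1(1) i0(1)] g0 i1 i0 unfolding X_def by linarith
    qed
  qed
  moreover have "Y \<le> (1 - 2 * m) * X + 2 * \<gamma>"
  proof -
    obtain i1 i0 where i1: "i1 \<in> I" "v i1 = Max (v ` I)" and i0: "i0 \<in> I" "v i0 = Min (v ` I)"
      using obtains_MAX[OF fin ne, of v] obtains_MIN[OF fin ne, of v] by metis
    show ?thesis
    proof (cases "i1 = i0")
      case True
      then show ?thesis using i1 i0 m4 X0 g0 by (simp add: Y_def)
    next
      case False
      have "wmean (\<lambda>i. w i i1) (I - {i1}) u - wmean (\<lambda>i. w i i0) (I - {i0}) u \<le> (1 - 2 * m) * X"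
        unfolding X_def using i1 i0 False fin N m w by (intro wmean_contraction) auto
      moreover have "0 \<le> (1 - 2 * m) * X" using m4 X0 by simp
      ultimately show ?thesis using v[OF i1(1) i0(1)] g0 i1 i0 unfolding Y_def by linarith
    qed
  qed
  moreover have "X \<le> \<gamma> / m \<and> Y \<le> \<gamma> / m" if "X \<le> (1 - 2 * m) * Y + 2 * \<gamma>" "Y \<le> (1 - 2 * m) * X + 2 * \<gamma>"
  proof -
    define Z where "Z = max X Y"
    have "X \<le> (1 - 2 * m) * Z + 2 * \<gamma>" "Y \<le> (1 - 2 * m) * Z + 2 * \<gamma>"
      using that mult_left_mono[of X Z "1 - 2 * m"] mult_left_mono[of Y Z "1 - 2 * m"] m4 unfolding Z_def by linarith+
    then have "Z \<le> (1 - 2 * m) * Z + 2 * \<gamma>" unfolding Z_def by simp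
    then have "Z \<le> \<gamma> / m" using m by (simp add: field_simps)
    then show ?thesis unfolding Z_def by simp
  qed
  ultimately have "X \<le> \<gamma> / m" "Y \<le> \<gamma> / m" by auto
  then show "u i - u k \<le> \<gamma> / m" "v i - v k \<le> \<gamma> / m"
    using osc[OF i k, of u] osc[OF i k, of v] unfolding X_def Y_def by linarith+
qed

section \<open>The logistic function\<close>

definition logistic :: "real \<Rightarrow> real" where
  "logistic t = exp t / (1 + exp t)"

definition logistic' :: "real \<Rightarrow> real" where
  "logistic' t = exp t / (1 + exp t)\<^sup>2"

lemma one_plus_exp_pos [simp]: "0 < 1 + exp (t::real)" "1 + exp (t::real) \<noteq> 0"
  using exp_gt_zero[of t] by linarith+

lemma softplus_deriv: "((\<lambda>t. ln (1 + exp t)) has_real_derivative logistic t) (at t)"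
  unfolding logistic_def by (auto intro!: derivative_eq_intros simp: field_simps)

lemma logistic_deriv: "(logistic has_real_derivative logistic' t) (at t)"
  unfolding logistic_def[abs_def] logistic'_def
  by (auto intro!: derivative_eq_intros simp: field_simps power2_eq_square)

lemma logistic'_deriv:
  "(logistic' has_real_derivative logistic' t * (1 - 2 * logistic t)) (at t)"
  unfolding logistic_def logistic'_def[abs_def]
  by (rule derivative_eq_intros refl | simp)+ (simp add: divide_simps power2_eq_square power4_eq_xxxx, simp add: algebra_simps)

lemma logistic_bounds: "0 < logistic t" "logistic t < 1"
  unfolding logistic_def by (auto simp: field_simps)

lemma logistic'_eq: "logistic' t = 1 / (2 + exp t + exp (- t))"
  unfolding logistic'_def by (simp add: exp_minus field_simps power2_eq_square)

lemma logistic'_le: "logistic' t \<le> 1 / 4"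
proof -
  have "4 * exp t \<le> (1 + exp t)\<^sup>2"
    using zero_le_power2[of "1 - exp t"] by (simp add: power2_eq_square algebra_simps)
  then show ?thesis unfolding logistic'_def by (simp add: divide_simps)
qed

lemma logistic'_pos: "0 < logistic' t"
  unfolding logistic'_def by simp

lemma logistic'_ge: assumes "\<bar>t\<bar> \<le> b" shows "exp (- b) / 4 \<le> logistic' t"
proof -
  have "2 + exp t + exp (- t) \<le> 4 * exp b"
    using assms exp_le_cancel_iff[of t b] exp_le_cancel_iff[of "-t" b] exp_ge_add_one_self[of b]
    by (smt (verit) abs_ge_minus_self abs_ge_self)
  then have "1 / (4 * exp b) \<le> 1 / (2 + exp t + exp (- t))"
    by (intro divide_left_mono) (auto intro!: mult_pos_pos add_pos_pos)
  then show ?thesis by (simp add: logistic'_eq exp_minus field_simps)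
qed

lemma logistic_mvt:
  obtains \<xi> where "\<bar>\<xi> - x\<bar> \<le> \<bar>t\<bar>" "logistic (x + t) - logistic x = logistic' \<xi> * t"
proof (cases t "0 :: real" rule: linorder_cases)
  case less
  then obtain z where "x + t < z" "z < x" "logistic x - logistic (x + t) = (x - (x + t)) * logistic' z"
    using MVT2[of "x + t" x logistic logistic'] logistic_deriv by auto
  then show ?thesis using less by (intro that[of z]) (auto simp: algebra_simps)
next
  case greater
  then obtain z where "x < z" "z < x + t" "logistic (x + t) - logistic x = (x + t - x) * logistic' z"
    using MVT2[of x "x + t" logistic logistic'] logistic_deriv by auto
  then show ?thesis using greater by (intro that[of z]) (auto simp: algebra_simps)
qed (auto intro: that[of x])

lemma logistic'_lipschitz: "\<bar>logistic' y - logistic' x\<bar> \<le> \<bar>y - x\<bar> / 4"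
proof -
  have b: "norm (logistic' t * (1 - 2 * logistic t)) \<le> 1 / 4" for t
  proof -
    have "\<bar>1 - 2 * logistic t\<bar> \<le> 1" using logistic_bounds[of t] by auto
    then have "\<bar>logistic' t\<bar> * \<bar>1 - 2 * logistic t\<bar> \<le> 1/4 * 1"
      using logistic'_le[of t] logistic'_pos[of t] by (intro mult_mono) auto
    then show ?thesis by (simp add: abs_mult)
  qed
  have "norm (logistic' y - logistic' x) \<le> 1/4 * norm (y - x)"
    by (rule field_differentiable_bound[of UNIV _ "\<lambda>t. logistic' t * (1 - 2 * logistic t)"])
       (use b logistic'_deriv in auto)
  then show ?thesis by simp
qed

text \<open>
  The second derivative is \<open>logistic' t (1 - 2 logistic t)\<close>, whose modulus is at most \<open>1 / 4\<close>.
\<close>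

lemma logistic_taylor: "\<bar>logistic (x + t) - logistic x - logistic' x * t\<bar> \<le> t\<^sup>2 / 4"
proof -
  obtain \<xi> where xi: "\<bar>\<xi> - x\<bar> \<le> \<bar>t\<bar>" "logistic (x + t) - logistic x = logistic' \<xi> * t"
    by (rule logistic_mvt)
  have "\<bar>logistic (x + t) - logistic x - logistic' x * t\<bar> = \<bar>logistic' \<xi> - logistic' x\<bar> * \<bar>t\<bar>"
    by (simp add: xi(2) flip: abs_mult left_diff_distrib)
  also have "\<dots> \<le> (\<bar>t\<bar> / 4) * \<bar>t\<bar>"
    using logistic'_lipschitz[of \<xi> x] xi(1) by (intro mult_right_mono) auto
  also have "\<dots> = t\<^sup>2 / 4" by (simp add: power2_eq_square flip: abs_mult)
  finally show ?thesis .
qed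

lemma logistic_strict_mono: "x < y \<Longrightarrow> logistic x < logistic y"
  using DERIV_pos_imp_increasing[of x y logistic] logistic_deriv logistic'_pos by blast

lemma logistic_diff_sign: "x \<noteq> y \<Longrightarrow> 0 < (logistic x - logistic y) * (x - y)"
  using logistic_strict_mono[of x y] logistic_strict_mono[of y x]
  by (cases "x < y") (auto simp: mult_neg_neg)

text \<open>
  The sign conditions of Karush, Kuhn and Tucker for one coordinate of a box.
\<close>

lemma deriv_sign_at_interval_min:
  fixes f :: "real \<Rightarrow> real"
  assumes d: "(f has_real_derivative D) (at t)" and t: "t \<in> {- r..r}"
    and min: "\<And>s. s \<in> {- r..r} \<Longrightarrow> f t \<le> f s"
  shows "t < r \<Longrightarrow> 0 \<le> D" "- r < t \<Longrightarrow> D \<le> 0"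
proof -
  show "0 \<le> D" if "t < r"
  proof (rule ccontr)
    assume "\<not> 0 \<le> D"
    then obtain d where "d > 0" "\<And>h. 0 < h \<Longrightarrow> h < d \<Longrightarrow> f (t + h) < f t"
      using DERIV_neg_dec_right[OF d] by auto
    then have "f (t + min (d / 2) (r - t)) < f t" using that by auto
    moreover have "f t \<le> f (t + min (d / 2) (r - t))"
      using t that \<open>d > 0\<close> by (intro min) auto
    ultimately show False by simp
  qed
  show "D \<le> 0" if "- r < t"
  proof (rule ccontr)
    assume "\<not> D \<le> 0"
    then obtain d where "d > 0" "\<And>h. 0 < h \<Longrightarrow> h < d \<Longrightarrow> f (t - h) < f t"
      using DERIV_pos_inc_left[OF d] by auto
    then have "f (t - min (d / 2) (t + r)) < f t" using that by auto
    moreover have "f t \<le> f (t - min (d / 2) (t + r))"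
      using t that \<open>d > 0\<close> by (intro min) auto
    ultimately show False by simp
  qed
qed

text \<open>
  Tychonoff for functions on an arbitrary index type.  Only finitely many coordinates matter later,
  but this form avoids a Euclidean space whose dimension depends on the number of nodes.
\<close>

lemma compact_function_box: "compact {u :: 'a \<Rightarrow> real. \<forall>i. u i \<in> {- r..r}}"
proof -
  have "compactin (product_topology (\<lambda>i. euclidean) UNIV) (PiE UNIV (\<lambda>_ :: 'a. {- r..r}))"
    by (subst compactin_PiE) auto
  moreover have "PiE UNIV (\<lambda>_ :: 'a. {- r..r}) = {u. \<forall>i. u i \<in> {- r..r}}"
    by (auto simp: PiE_def extensional_def)
  ultimately show ?thesis by (simp add: euclidean_product_topology)
qed

lemma sum_off_diagonal_swap:
  assumes "finite I"
  shows "(\<Sum>i\<in>I. \<Sum>j\<in>I - {i}. f i j) = (\<Sum>j\<in>I. \<Sum>i\<in>I - {j}. f i j :: real)"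
proof -
  have "(\<Sum>i\<in>I. \<Sum>j\<in>{j. j \<in> I \<and> i \<noteq> j}. f i j) = (\<Sum>j\<in>I. \<Sum>i\<in>{i. i \<in> I \<and> i \<noteq> j}. f i j)"
    by (rule sum.swap_restrict[OF assms assms])
  moreover have "{j. j \<in> I \<and> i \<noteq> j} = I - {i}" "{i'. i' \<in> I \<and> i' \<noteq> i} = I - {i}" for i by auto
  ultimately show ?thesis by simp
qed

section \<open>Existence of a nearby solution of a logistic system\<close>

lemma sum_coordinate_update:
  assumes "finite I" "i \<in> I"
  shows "(\<Sum>k\<in>I. R k ((u(i := t)) k)) = (\<Sum>k\<in>I. R k (u k)) - R i (u i) + (R i t :: real)"
proof -
  have "(\<Sum>k\<in>I - {i}. R k ((u(i := t)) k)) = (\<Sum>k\<in>I - {i}. R k (u k))"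
    by (intro sum.cong) auto
  then show ?thesis using assms by (simp add: sum.remove[of I i])
qed

text \<open>
  The functional \<open>\<Sum> f\<^sub>i\<^sub>j (u\<^sub>i - v\<^sub>j) - \<Sum> g\<^sub>i u\<^sub>i + \<Sum> h\<^sub>j v\<^sub>j\<close> attains its minimum on the box, and the sign
  conditions are read off one coordinate at a time.
\<close>

lemma box_minimiser_gradient_signs:
  fixes f f' :: "'a \<Rightarrow> 'a \<Rightarrow> real \<Rightarrow> real" and g h :: "'a \<Rightarrow> real"
  assumes fin: "finite I"
    and f: "\<And>i j s. (f i j has_real_derivative f' i j s) (at s)"
    and r: "r \<ge> 0"
  obtains u v where "\<And>i. \<bar>u i\<bar> \<le> r" "\<And>j. \<bar>v j\<bar> \<le> r"
    "\<And>i. i \<in> I \<Longrightarrow> u i < r \<Longrightarrow> g i \<le> (\<Sum>j\<in>I - {i}. f' i j (u i - v j))"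
    "\<And>i. i \<in> I \<Longrightarrow> - r < u i \<Longrightarrow> (\<Sum>j\<in>I - {i}. f' i j (u i - v j)) \<le> g i"
    "\<And>j. j \<in> I \<Longrightarrow> v j < r \<Longrightarrow> (\<Sum>i\<in>I - {j}. f' i j (u i - v j)) \<le> h j"
    "\<And>j. j \<in> I \<Longrightarrow> - r < v j \<Longrightarrow> h j \<le> (\<Sum>i\<in>I - {j}. f' i j (u i - v j))"
proof -
  define \<Psi> where "\<Psi> = (\<lambda>(u, v). (\<Sum>i\<in>I. \<Sum>j\<in>I - {i}. f i j (u i - v j))
    - (\<Sum>i\<in>I. g i * u i) + (\<Sum>j\<in>I. h j * v j))"
  define Q where "Q = {u :: 'a \<Rightarrow> real. \<forall>i. u i \<in> {- r..r}}"
  have cf: "continuous_on UNIV (f i j)" for i j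
    using f by (intro DERIV_continuous_on) (auto intro: has_field_derivative_at_within)
  have "compact (Q \<times> Q)" unfolding Q_def by (intro compact_Times compact_function_box)
  moreover have "(\<lambda>_. 0, \<lambda>_. 0) \<in> Q \<times> Q" using r by (auto simp: Q_def)
  moreover have "continuous_on (Q \<times> Q) \<Psi>"
    unfolding \<Psi>_def case_prod_beta
    by (intro continuous_intros continuous_on_compose2[OF cf]
          continuous_on_compose2[OF continuous_on_product_coordinates]) auto
  ultimately have "\<exists>p\<in>Q \<times> Q. \<forall>p'\<in>Q \<times> Q. \<Psi> p \<le> \<Psi> p'"
    by (intro continuous_attains_inf) auto
  then obtain p where p: "p \<in> Q \<times> Q" "\<And>p'. p' \<in> Q \<times> Q \<Longrightarrow> \<Psi> p \<le> \<Psi> p'"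
    by blast
  obtain u v where [simp]: "p = (u, v)" by (cases p)
  have u: "u i \<in> {- r..r}" and v: "v i \<in> {- r..r}" for i using p(1) by (auto simp: Q_def)
  define Gu where "Gu = (\<lambda>i t. (\<Sum>j\<in>I - {i}. f i j (t - v j)) - g i * t)"
  define Gv where "Gv = (\<lambda>j t. (\<Sum>i\<in>I - {j}. f i j (u i - t)) + h j * t)"
  have minu: "Gu i (u i) \<le> Gu i t" if i: "i \<in> I" and t: "t \<in> {- r..r}" for i t
  proof -
    have "(u(i := t), v) \<in> Q \<times> Q" using u v t by (simp add: Q_def)
    from p(2)[OF this] have "\<Psi> (u, v) \<le> \<Psi> (u(i := t), v)" by simp
    then show ?thesis
      using sum_coordinate_update[OF fin i, of "\<lambda>i s. \<Sum>j\<in>I - {i}. f i j (s - v j)" u t]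
        sum_coordinate_update[OF fin i, of "\<lambda>i s. g i * s" u t]
      unfolding \<Psi>_def Gu_def split_conv by linarith
  qed
  have swap: "(\<Sum>i\<in>I. \<Sum>j\<in>I - {i}. f i j (u i - v' j)) = (\<Sum>j\<in>I. \<Sum>i\<in>I - {j}. f i j (u i - v' j))" for v'
    by (rule sum_off_diagonal_swap[OF fin])
  have minv: "Gv j (v j) \<le> Gv j t" if j: "j \<in> I" and t: "t \<in> {- r..r}" for j t
  proof -
    have "(u, v(j := t)) \<in> Q \<times> Q" using u v t by (simp add: Q_def)
    from p(2)[OF this] have "\<Psi> (u, v) \<le> \<Psi> (u, v(j := t))" by simp
    then show ?thesis
      using sum_coordinate_update[OF fin j, of "\<lambda>j s. \<Sum>i\<in>I - {j}. f i j (u i - s)" v t]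
        sum_coordinate_update[OF fin j, of "\<lambda>j s. h j * s" v t]
      unfolding \<Psi>_def Gv_def split_conv swap
      by linarith
  qed
  have du: "(Gu i has_real_derivative (\<Sum>j\<in>I - {i}. f' i j (u i - v j)) - g i) (at (u i))" for i
    unfolding Gu_def[abs_def]
    by (rule derivative_eq_intros DERIV_chain2[OF f] refl)+ simp
  have dv: "(Gv j has_real_derivative h j - (\<Sum>i\<in>I - {j}. f' i j (u i - v j))) (at (v j))" for j
    unfolding Gv_def[abs_def]
    by (rule derivative_eq_intros DERIV_chain2[OF f] refl)+ (simp add: sum_negf)
  show ?thesis
  proof (rule that[of u v])
    fix i assume "i \<in> I"
    note * = deriv_sign_at_interval_min[OF du u minu[OF this]] deriv_sign_at_interval_min[OF dv v minv[OF this]]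
    show "u i < r \<Longrightarrow> g i \<le> (\<Sum>j\<in>I - {i}. f' i j (u i - v j))" using *(1) by simp
    show "- r < u i \<Longrightarrow> (\<Sum>j\<in>I - {i}. f' i j (u i - v j)) \<le> g i" using *(2) by simp
    show "v i < r \<Longrightarrow> (\<Sum>j\<in>I - {i}. f' j i (u j - v i)) \<le> h i" using *(3) by simp
    show "- r < v i \<Longrightarrow> h i \<le> (\<Sum>j\<in>I - {i}. f' j i (u j - v i))" using *(4) by simp
  qed (use u v in \<open>auto simp: abs_le_iff minus_le_iff\<close>)
qed

text \<open>
  The box has half-width \<open>r = 2 \<gamma> / m \<le> 1 / 2\<close>, so every argument \<open>u\<^sub>i - v\<^sub>j\<close> has modulus at most \<open>1\<close> and
  the mean-value weights stay above \<open>m\<close>.  The coordinates of the minimiser spread over less than \<open>r\<close>, while the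
  two ends of the box are \<open>2 r\<close> apart.  So the partial derivatives in all coordinates have one
  common sign; as they add up to \<open>0\<close>, they all vanish.
\<close>

lemma logistic_system_solvable:
  fixes x :: "'a \<Rightarrow> 'a \<Rightarrow> real" and g h :: "'a \<Rightarrow> real" and m \<gamma> :: real
  assumes fin: "finite I" and N: "card I \<ge> 3" and m: "m > 0"
    and lower: "\<And>i j t. i \<in> I \<Longrightarrow> j \<in> I \<Longrightarrow> i \<noteq> j \<Longrightarrow> \<bar>t - x i j\<bar> \<le> 1 \<Longrightarrow> m \<le> logistic' t"
    and \<gamma>: "\<gamma> > 0" "\<gamma> \<le> m / 4"
    and g: "\<And>i. i \<in> I \<Longrightarrow> \<bar>g i\<bar> \<le> \<gamma> * ((real (card I) - 1) * m)"
    and h: "\<And>j. j \<in> I \<Longrightarrow> \<bar>h j\<bar> \<le> \<gamma> * ((real (card I) - 1) * m)"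
    and gh: "sum g I = sum h I"
  obtains u v where
    "\<And>i. i \<in> I \<Longrightarrow> (\<Sum>j\<in>I - {i}. logistic (x i j + (u i - v j)) - logistic (x i j)) = g i"
    "\<And>j. j \<in> I \<Longrightarrow> (\<Sum>i\<in>I - {j}. logistic (x i j + (u i - v j)) - logistic (x i j)) = h j"
    "\<And>i j. i \<in> I \<Longrightarrow> j \<in> I \<Longrightarrow> \<bar>u i - v j\<bar> \<le> 2 * \<gamma> / m"
proof -
  define r where "r = 2 * \<gamma> / m"
  have r: "0 < r" "2 * r \<le> 1" using \<gamma> m by (auto simp: r_def field_simps)
  define d where "d = (\<lambda>i j s. logistic (x i j + s) - logistic (x i j))"
  have deriv: "((\<lambda>s. ln (1 + exp (x i j + s)) - logistic (x i j) * s) has_real_derivative d i j s) (at s)" for i j s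
    unfolding d_def by (rule derivative_eq_intros DERIV_chain2[OF softplus_deriv] refl)+ simp
  show ?thesis
  proof (rule box_minimiser_gradient_signs[where I=I and f="\<lambda>i j s. ln (1 + exp (x i j + s)) - logistic (x i j) * s" and f'=d and g=g and h=h, OF fin deriv less_imp_le[OF r(1)]])
    fix u v assume ub: "\<And>i. \<bar>u i\<bar> \<le> r" and vb: "\<And>j. \<bar>v j\<bar> \<le> r" and
    u_up: "\<And>i. i \<in> I \<Longrightarrow> u i < r \<Longrightarrow> g i \<le> (\<Sum>j\<in>I - {i}. d i j (u i - v j))" and
    u_lo: "\<And>i. i \<in> I \<Longrightarrow> - r < u i \<Longrightarrow> (\<Sum>j\<in>I - {i}. d i j (u i - v j)) \<le> g i" and
    v_up: "\<And>j. j \<in> I \<Longrightarrow> v j < r \<Longrightarrow> (\<Sum>i\<in>I - {j}. d i j (u i - v j)) \<le> h j" and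
    v_lo: "\<And>j. j \<in> I \<Longrightarrow> - r < v j \<Longrightarrow> h j \<le> (\<Sum>i\<in>I - {j}. d i j (u i - v j))"
  have "\<exists>w. m \<le> w \<and> w \<le> 1/4 \<and> d i j (u i - v j) = w * (u i - v j)" if "i \<in> I" "j \<in> I" "i \<noteq> j" for i j
  proof -
    obtain \<xi> where xi: "\<bar>\<xi> - x i j\<bar> \<le> \<bar>u i - v j\<bar>"
      "logistic (x i j + (u i - v j)) - logistic (x i j) = logistic' \<xi> * (u i - v j)"
      by (rule logistic_mvt)
    have "\<bar>u i - v j\<bar> \<le> 1" using ub[of i] vb[of j] r by linarith
    then show ?thesis using xi lower[OF that, of \<xi>] logistic'_le[of \<xi>] by (auto simp: d_def)
  qed
  then obtain w where w: "\<And>i j. i \<in> I \<Longrightarrow> j \<in> I \<Longrightarrow> i \<noteq> j \<Longrightarrow>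
      m \<le> w i j \<and> w i j \<le> 1/4 \<and> d i j (u i - v j) = w i j * (u i - v j)"
    by metis
  note card1 = off_diagonal_card(1)[OF fin N]
  note ne = off_diagonal_card(2)[OF fin N]
  have Wge: "(real (card I) - 1) * m \<le> (\<Sum>j\<in>I - {i}. w i j)" and Wge': "(real (card I) - 1) * m \<le> (\<Sum>j\<in>I - {i}. w j i)"
    if "i \<in> I" for i
    using sum_bounded_below[of "I - {i}" m "w i"] sum_bounded_below[of "I - {i}" m "\<lambda>j. w j i"]
      w card1[OF that] that by auto
  have N1: "0 < (real (card I) - 1) * m" using N m by simp
  have gW: "\<bar>g i\<bar> \<le> \<gamma> * (\<Sum>j\<in>I - {i}. w i j)" and hW: "\<bar>h i\<bar> \<le> \<gamma> * (\<Sum>j\<in>I - {i}. w j i)"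
    if "i \<in> I" for i
    using g[OF that] h[OF that] Wge[OF that] Wge'[OF that] \<gamma>(1)
    by (meson mult_left_mono less_imp_le order.trans)+
  have rowsum: "(\<Sum>j\<in>I - {i}. d i j (u i - v j)) = (\<Sum>j\<in>I - {i}. w i j) * (u i - wmean (w i) (I - {i}) v)"
    if "i \<in> I" for i
  proof -
    have "(\<Sum>j\<in>I - {i}. d i j (u i - v j)) = (\<Sum>j\<in>I - {i}. w i j * (u i - v j))"
      using w that by (intro sum.cong) auto
    also have "\<dots> = (\<Sum>j\<in>I - {i}. w i j) * (u i - wmean (w i) (I - {i}) v)"
      using Wge[OF that] N1
      by (simp add: wmean_def right_diff_distrib sum_subtractf flip: sum_distrib_right)
    finally show ?thesis .
  qed
  have colsum: "(\<Sum>i\<in>I - {j}. d i j (u i - v j)) = (\<Sum>i\<in>I - {j}. w i j) * (wmean (\<lambda>i. w i j) (I - {j}) u - v j)"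
    if "j \<in> I" for j
  proof -
    have "(\<Sum>i\<in>I - {j}. d i j (u i - v j)) = (\<Sum>i\<in>I - {j}. w i j * (u i - v j))"
      using w that by (intro sum.cong) auto
    also have "\<dots> = (\<Sum>i\<in>I - {j}. w i j) * (wmean (\<lambda>i. w i j) (I - {j}) u - v j)"
      using Wge'[OF that] N1
      by (simp add: wmean_def right_diff_distrib sum_subtractf flip: sum_distrib_right)
    finally show ?thesis .
  qed
  have cancel: "a \<le> b + \<gamma>" if "W * (a - b) \<le> e" "\<bar>e\<bar> \<le> \<gamma> * W" "0 < W" for a b e W :: real
  proof -
    have "W * (a - b) \<le> W * \<gamma>" using that(1,2) abs_ge_self[of e] mult.commute[of W \<gamma>] by linarith
    then have "a - b \<le> \<gamma>" using that(3) by (rule mult_left_le_imp_le)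
    then show ?thesis by simp
  qed
  have u1: "u i \<le> wmean (w i) (I - {i}) v + \<gamma>" if "i \<in> I" "- r < u i" for i
    using u_lo[OF that] gW[OF that(1)] Wge[OF that(1)] N1 unfolding rowsum[OF that(1)]
    by (intro cancel[where e="g i" and W="\<Sum>j\<in>I - {i}. w i j"]) linarith+
  have u2: "wmean (w i) (I - {i}) v \<le> u i + \<gamma>" if "i \<in> I" "u i < r" for i
    using u_up[OF that] gW[OF that(1)] Wge[OF that(1)] N1 unfolding rowsum[OF that(1)]
    by (intro cancel[where e="- g i" and W="\<Sum>j\<in>I - {i}. w i j"]) (linarith | simp add: right_diff_distrib)+
  have v1: "v j \<le> wmean (\<lambda>i. w i j) (I - {j}) u + \<gamma>" if "j \<in> I" "- r < v j" for j
    using v_lo[OF that] hW[OF that(1)] Wge'[OF that(1)] N1 unfolding colsum[OF that(1)]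
    by (intro cancel[where e="- h j" and W="\<Sum>i\<in>I - {j}. w i j"]) (linarith | simp add: right_diff_distrib)+
  have v2: "wmean (\<lambda>i. w i j) (I - {j}) u \<le> v j + \<gamma>" if "j \<in> I" "v j < r" for j
    using v_up[OF that] hW[OF that(1)] Wge'[OF that(1)] N1 unfolding colsum[OF that(1)]
    by (intro cancel[where e="h j" and W="\<Sum>i\<in>I - {j}. w i j"]) linarith+
  \<comment> \<open>If \<open>u k < u i\<close>, then \<open>u i\<close> is not clamped from below nor \<open>u k\<close> from above.\<close>
  have ou: "u i - u k \<le> max 0 (wmean (w i) (I - {i}) v - wmean (w k) (I - {k}) v + 2 * \<gamma>)"
    if "i \<in> I" "k \<in> I" for i k
    using u1[OF that(1)] u2[OF that(2)] ub[of i] ub[of k] by (smt (verit))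
  have ov: "v j - v l \<le> max 0 (wmean (\<lambda>i. w i j) (I - {j}) u - wmean (\<lambda>i. w i l) (I - {l}) u + 2 * \<gamma>)"
    if "j \<in> I" "l \<in> I" for j l
    using v1[OF that(1)] v2[OF that(2)] vb[of j] vb[of l] by (smt (verit))
  have osc: "u i - u k \<le> \<gamma> / m" "v i - v k \<le> \<gamma> / m" if "i \<in> I" "k \<in> I" for i k
    using oscillation_bound[OF fin N m _ _ ou ov that] w \<gamma> by auto
  have m4: "m \<le> 1/4" by (rule lower_weight_le_quarter[OF fin N, of m w]) (use w in blast)
  \<comment> \<open>This is where \<open>m \<le> 1 / 4\<close> matters: the total spread stays strictly below \<open>r\<close>.\<close>
  have small: "\<gamma> / m + \<gamma> < r" "0 < \<gamma> / m" using \<gamma> m m4 by (auto simp: r_def field_simps)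
  have uv: "u i - v j \<le> \<gamma> / m + \<gamma>" if "i \<in> I" "j \<in> I" for i j
  proof (cases "- r < u i")
    case True
    have "wmean (w i) (I - {i}) v \<le> v j + \<gamma> / m"
    proof (rule wmean_le)
      show "0 < w i k" if "k \<in> I - {i}" for k using w[of i k] that \<open>i \<in> I\<close> m by auto
      show "v k \<le> v j + \<gamma> / m" if "k \<in> I - {i}" for k using osc(2)[of k j] that \<open>j \<in> I\<close> by auto
    qed (use fin ne that in auto)
    then show ?thesis using u1[OF that(1) True] by simp
  next
    case False
    then show ?thesis using vb[of j] small \<gamma> by linarith
  qed
  have vu: "v j - u i \<le> \<gamma> / m + \<gamma>" if "i \<in> I" "j \<in> I" for i j
  proof (cases "- r < v j")
    case True
    have "wmean (\<lambda>i. w i j) (I - {j}) u \<le> u i + \<gamma> / m"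
    proof (rule wmean_le)
      show "0 < w k j" if "k \<in> I - {j}" for k using w[of k j] that \<open>j \<in> I\<close> m by auto
      show "u k \<le> u i + \<gamma> / m" if "k \<in> I - {j}" for k using osc(1)[of k i] that \<open>i \<in> I\<close> by auto
    qed (use fin ne that in auto)
    then show ?thesis using v1[OF that(2) True] by simp
  next
    case False
    then show ?thesis using ub[of i] small \<gamma> by linarith
  qed
  have bal: "(\<Sum>i\<in>I. (\<Sum>j\<in>I - {i}. d i j (u i - v j)) - g i) = (\<Sum>j\<in>I. (\<Sum>i\<in>I - {j}. d i j (u i - v j)) - h j)"
    using gh sum_off_diagonal_swap[OF fin, of "\<lambda>i j. d i j (u i - v j)"] by (simp add: sum_subtractf)
  have zero: "(\<forall>i\<in>I. A i = 0) \<and> (\<forall>i\<in>I. B i = 0)"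
    if "\<And>i. i \<in> I \<Longrightarrow> 0 \<le> A i" "\<And>i. i \<in> I \<Longrightarrow> B i \<le> 0" "sum A I = sum B I" for A B :: "'a \<Rightarrow> real"
  proof -
    have "0 \<le> sum A I" "sum B I \<le> 0" using that(1,2) by (auto intro: sum_nonneg sum_nonpos)
    then have "sum A I = 0" "(\<Sum>i\<in>I. - B i) = 0" using that(3) by (auto simp: sum_negf)
    then show ?thesis
      using sum_nonneg_eq_0_iff[of I A] sum_nonneg_eq_0_iff[of I "\<lambda>i. - B i"] fin that(1,2) by auto
  qed
  have "(\<forall>i\<in>I. (\<Sum>j\<in>I - {i}. d i j (u i - v j)) - g i = 0) \<and> (\<forall>j\<in>I. (\<Sum>i\<in>I - {j}. d i j (u i - v j)) - h j = 0)"
  proof (cases "\<exists>i\<in>I. u i = r \<or> v i = r")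
    case False
    then have "u i < r" "v i < r" if "i \<in> I" for i using ub[of i] vb[of i] that by (auto simp: abs_le_iff less_le)
    then show ?thesis using u_up v_up by (intro zero bal) auto
  next
    case True
    then obtain a where a: "a \<in> I" "u a = r \<or> v a = r" by blast
    have "- r < u i" "- r < v i" if "i \<in> I" for i
      using a(2) osc[OF a(1) that] uv[OF a(1) that] vu[OF that a(1)] small \<gamma> r by linarith+
    then have "(\<forall>i\<in>I. g i - (\<Sum>j\<in>I - {i}. d i j (u i - v j)) = 0) \<and> (\<forall>j\<in>I. h j - (\<Sum>i\<in>I - {j}. d i j (u i - v j)) = 0)"
      using u_lo v_lo bal by (intro zero) (auto simp: sum_subtractf)
    then show ?thesis by auto
  qed
  then have sol: "\<forall>i\<in>I. (\<Sum>j\<in>I - {i}. d i j (u i - v j)) = g i"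
    "\<forall>j\<in>I. (\<Sum>i\<in>I - {j}. d i j (u i - v j)) = h j" by auto
  have "\<bar>u i - v j\<bar> \<le> r" if "i \<in> I" "j \<in> I" for i j
    using uv[OF that] vu[OF that] small by linarith
  then show thesis using sol by (intro that[of u v]) (simp_all add: d_def r_def)
  qed
qed

section \<open>Uniqueness and first-order expansion of the solution\<close>

text \<open>
  Multiply the difference of the equations by the difference of the parameters and add up: the result
  is a sum of terms \<open>(logistic s - logistic t) (s - t) \<ge> 0\<close> and equals \<open>0\<close>.  The missing equation of
  column \<open>n\<close> has the multiplier \<open>b n - b' n = 0\<close>.
\<close>

lemma logistic_system_unique:
  fixes a b a' b' :: "'a \<Rightarrow> real"
  assumes fin: "finite I" and N: "card I \<ge> 3" and n: "n \<in> I" "b n = b' n"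
    and rows: "\<And>i. i \<in> I \<Longrightarrow> (\<Sum>j\<in>I - {i}. logistic (a i + b j)) = (\<Sum>j\<in>I - {i}. logistic (a' i + b' j))"
    and cols: "\<And>j. j \<in> I - {n} \<Longrightarrow> (\<Sum>i\<in>I - {j}. logistic (a i + b j)) = (\<Sum>i\<in>I - {j}. logistic (a' i + b' j))"
    and k: "k \<in> I"
  shows "a k = a' k" "b k = b' k"
proof -
  define D where "D = (\<lambda>i j. logistic (a i + b j) - logistic (a' i + b' j))"
  define T where "T = (\<lambda>i j. D i j * ((a i + b j) - (a' i + b' j)))"
  have "(\<Sum>i\<in>I. \<Sum>j\<in>I - {i}. T i j)
      = (\<Sum>i\<in>I. \<Sum>j\<in>I - {i}. D i j * (a i - a' i)) + (\<Sum>i\<in>I. \<Sum>j\<in>I - {i}. D i j * (b j - b' j))"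
    by (simp add: T_def algebra_simps sum.distrib sum_subtractf)
  also have "(\<Sum>i\<in>I. \<Sum>j\<in>I - {i}. D i j * (b j - b' j)) = (\<Sum>j\<in>I. \<Sum>i\<in>I - {j}. D i j * (b j - b' j))"
    by (rule sum_off_diagonal_swap[OF fin])
  also have "\<dots> = (\<Sum>j\<in>I. (\<Sum>i\<in>I - {j}. D i j) * (b j - b' j))"
    by (simp add: sum_distrib_right)
  also have "\<dots> = 0"
    using cols n by (intro sum.neutral) (auto simp: D_def sum_subtractf)
  also have "(\<Sum>i\<in>I. \<Sum>j\<in>I - {i}. D i j * (a i - a' i)) = (\<Sum>i\<in>I. (\<Sum>j\<in>I - {i}. D i j) * (a i - a' i))"
    by (simp add: sum_distrib_right)
  also have "\<dots> = 0"
    using rows by (intro sum.neutral) (auto simp: D_def sum_subtractf)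
  finally have sum0: "(\<Sum>i\<in>I. \<Sum>j\<in>I - {i}. T i j) = 0" by simp
  have T0: "0 \<le> T i j" for i j
    using logistic_diff_sign[of "a i + b j" "a' i + b' j"]
    by (cases "a i + b j = a' i + b' j") (auto simp: T_def D_def)
  have "(\<Sum>j\<in>I - {i}. T i j) = 0" if "i \<in> I" for i
    using sum0 T0 fin that by (subst (asm) sum_nonneg_eq_0_iff) (auto intro: sum_nonneg)
  then have "T i j = 0" if "i \<in> I" "j \<in> I" "i \<noteq> j" for i j
    using T0 fin that by (subst (asm) sum_nonneg_eq_0_iff) auto
  then have eq: "a i + b j = a' i + b' j" if "i \<in> I" "j \<in> I" "i \<noteq> j" for i j
    using that logistic_diff_sign[of "a i + b j" "a' i + b' j"] by (force simp: T_def D_def)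
  have card2: "card (I - {n, j}) > 0" for j
    using N card_Diff_subset[of "{n, j}" I] card_insert_le_m1[of 2 "{j}" n] fin
      diff_card_le_card_Diff[of "{n, j}" I] by auto
  have a1: "a i = a' i" if "i \<in> I" "i \<noteq> n" for i
    using eq[OF that(1) n(1)] that n by auto
  have b1: "b j = b' j" if j: "j \<in> I" for j
  proof (cases "j = n")
    case False
    obtain i where i: "i \<in> I - {n, j}" using card2[of j] by (metis card.empty equals0I less_irrefl)
    then show ?thesis using eq[of i j] a1[of i] j by auto
  qed (use n in auto)
  have "a n = a' n"
  proof -
    obtain j where "j \<in> I - {n, n}" using card2[of n] by (metis card.empty equals0I less_irrefl)
    then show ?thesis using eq[of n j] b1[of j] n by auto
  qed
  then show "a k = a' k" "b k = b' k" using a1[of k] b1[of k] k by auto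
qed

text \<open>
  With \<open>y\<^sub>i = u\<^sub>i - g\<^sub>i / W\<^sub>i\<close> and \<open>z\<^sub>j = v\<^sub>j + h\<^sub>j / W'\<^sub>j\<close> the linearised equations say that \<open>y\<close> and \<open>z\<close> are
  averages of each other up to \<open>s\<^sup>2 / (4 m) + \<eta>\<close>: the first part is the Taylor error and \<open>\<eta>\<close> the averaged
  noise.  So both are nearly constant, and the constant is \<open>z\<^sub>n = h\<^sub>n / W'\<^sub>n\<close>.
\<close>

lemma logistic_system_expansion:
  fixes x :: "'a \<Rightarrow> 'a \<Rightarrow> real" and u v g h :: "'a \<Rightarrow> real" and m s \<eta> :: real and I :: "'a set"
  defines "w \<equiv> \<lambda>i j. logistic' (x i j)"
  defines "W \<equiv> \<lambda>i. \<Sum>j\<in>I - {i}. w i j" and "W' \<equiv> \<lambda>j. \<Sum>i\<in>I - {j}. w i j"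
  assumes fin: "finite I" and N: "card I \<ge> 3" and m: "m > 0" and n: "n \<in> I" "v n = 0"
    and lower: "\<And>i j. i \<in> I \<Longrightarrow> j \<in> I \<Longrightarrow> i \<noteq> j \<Longrightarrow> m \<le> w i j"
    and rows: "\<And>i. i \<in> I \<Longrightarrow> (\<Sum>j\<in>I - {i}. logistic (x i j + (u i - v j)) - logistic (x i j)) = g i"
    and cols: "\<And>j. j \<in> I \<Longrightarrow> (\<Sum>i\<in>I - {j}. logistic (x i j + (u i - v j)) - logistic (x i j)) = h j"
    and s: "\<And>i j. i \<in> I \<Longrightarrow> j \<in> I \<Longrightarrow> \<bar>u i - v j\<bar> \<le> s"
    and eta1: "\<And>i. i \<in> I \<Longrightarrow> \<bar>wmean (w i) (I - {i}) (\<lambda>j. h j / W' j)\<bar> \<le> \<eta>"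
    and eta2: "\<And>j. j \<in> I \<Longrightarrow> \<bar>wmean (\<lambda>i. w i j) (I - {j}) (\<lambda>i. g i / W i)\<bar> \<le> \<eta>"
    and k: "k \<in> I"
  shows "\<bar>u k - g k / W k - h n / W' n\<bar> \<le> 2 * (s\<^sup>2 / (4 * m) + \<eta>) / m"
proof -
  have wm: "m \<le> w i j \<and> w i j \<le> 1/4" if "i \<in> I" "j \<in> I" "i \<noteq> j" for i j
    using lower[OF that] logistic'_le by (simp add: w_def)
  have m4: "m \<le> 1/4" by (rule lower_weight_le_quarter[OF fin N, of m w]) (use wm in blast)
  note card1 = off_diagonal_card(1)[OF fin N]
  note ne = off_diagonal_card(2)[OF fin N]
  have N1: "0 < real (card I) - 1" using N by simp
  have W: "(real (card I) - 1) * m \<le> W i" and W': "(real (card I) - 1) * m \<le> W' i" if "i \<in> I" for i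
    using sum_bounded_below[of "I - {i}" m "w i"] sum_bounded_below[of "I - {i}" m "\<lambda>j. w j i"]
      wm card1[OF that] that by (auto simp: W_def W'_def)
  have Wpos: "0 < W i" and W'pos: "0 < W' i" if "i \<in> I" for i
    using W[OF that] W'[OF that] mult_pos_pos[OF N1 m] by linarith+
  define t where "t = (\<lambda>i j. logistic (x i j + (u i - v j)) - logistic (x i j) - w i j * (u i - v j))"
  define R where "R = (\<lambda>i. \<Sum>j\<in>I - {i}. t i j)"
  define R' where "R' = (\<lambda>j. \<Sum>i\<in>I - {j}. t i j)"
  define e where "e = s\<^sup>2 / (4 * m)"
  have tb: "\<bar>t i j\<bar> \<le> s\<^sup>2 / 4" if "i \<in> I" "j \<in> I" for i j
  proof -
    have "\<bar>t i j\<bar> \<le> (u i - v j)\<^sup>2 / 4" unfolding t_def w_def by (rule logistic_taylor)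
    also have "\<dots> \<le> s\<^sup>2 / 4" using power_mono[OF s[OF that], of 2] by simp
    finally show ?thesis .
  qed
  have quot: "\<bar>(\<Sum>j\<in>I - {i}. c j) / V\<bar> \<le> e"
    if "i \<in> I" "\<And>j. j \<in> I \<Longrightarrow> \<bar>c j\<bar> \<le> s\<^sup>2 / 4" "(real (card I) - 1) * m \<le> V" for i c V
  proof -
    have "\<bar>\<Sum>j\<in>I - {i}. c j\<bar> \<le> (\<Sum>j\<in>I - {i}. \<bar>c j\<bar>)" by (rule sum_abs)
    also have "\<dots> \<le> (real (card I) - 1) * (s\<^sup>2 / 4)"
      using sum_bounded_above[of "I - {i}" "\<lambda>j. \<bar>c j\<bar>" "s\<^sup>2 / 4"] that(1,2) card1[OF that(1)] by auto
    also have "\<dots> = ((real (card I) - 1) * m) * e" using m by (simp add: e_def)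
    also have "\<dots> \<le> V * e" using that(3) m by (intro mult_right_mono) (auto simp: e_def)
    finally have "\<bar>\<Sum>j\<in>I - {i}. c j\<bar> \<le> V * e" .
    moreover have "0 < V" using that(3) mult_pos_pos[OF N1 m] by linarith
    ultimately show ?thesis by (simp add: abs_divide divide_le_eq mult.commute)
  qed
  have Re: "\<bar>R i / W i\<bar> \<le> e" and R'e: "\<bar>R' i / W' i\<bar> \<le> e" if "i \<in> I" for i
    unfolding R_def R'_def using quot[OF that _ W[OF that]] quot[OF that _ W'[OF that]] tb that by auto
  have urow: "u i = wmean (w i) (I - {i}) v + g i / W i - R i / W i" if "i \<in> I" for i
  proof -
    have "g i = R i + (\<Sum>j\<in>I - {i}. w i j * (u i - v j))"
      using rows[OF that] by (simp add: R_def t_def sum_subtractf)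
    also have "(\<Sum>j\<in>I - {i}. w i j * (u i - v j)) = W i * u i - (\<Sum>j\<in>I - {i}. w i j * v j)"
      by (simp add: W_def right_diff_distrib sum_subtractf sum_distrib_right)
    finally have "g i = R i + (W i * u i - (\<Sum>j\<in>I - {i}. w i j * v j))" .
    moreover have "wmean (w i) (I - {i}) v = (\<Sum>j\<in>I - {i}. w i j * v j) / W i"
      by (simp add: wmean_def W_def)
    ultimately show ?thesis using Wpos[OF that] by (simp add: field_simps)
  qed
  have vcol: "v j = wmean (\<lambda>i. w i j) (I - {j}) u - h j / W' j + R' j / W' j" if "j \<in> I" for j
  proof -
    have "h j = R' j + (\<Sum>i\<in>I - {j}. w i j * (u i - v j))"
      using cols[OF that] by (simp add: R'_def t_def sum_subtractf)
    also have "(\<Sum>i\<in>I - {j}. w i j * (u i - v j)) = (\<Sum>i\<in>I - {j}. w i j * u i) - W' j * v j"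
      by (simp add: W'_def right_diff_distrib sum_subtractf sum_distrib_right)
    finally have "h j = R' j + ((\<Sum>i\<in>I - {j}. w i j * u i) - W' j * v j)" .
    moreover have "wmean (\<lambda>i. w i j) (I - {j}) u = (\<Sum>i\<in>I - {j}. w i j * u i) / W' j"
      by (simp add: wmean_def W'_def)
    ultimately show ?thesis using W'pos[OF that] by (simp add: field_simps)
  qed
  define y where "y = (\<lambda>i. u i - g i / W i)"
  define z where "z = (\<lambda>j. v j + h j / W' j)"
  define \<gamma> where "\<gamma> = e + \<eta>"
  have vz: "wmean f S v = wmean f S z - wmean f S (\<lambda>j. h j / W' j)" for f S
    using wmean_add[of f S v "\<lambda>j. h j / W' j"] by (simp add: z_def)
  have uy: "wmean f S u = wmean f S y + wmean f S (\<lambda>i. g i / W i)" for f S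
    using wmean_add[of f S y "\<lambda>i. g i / W i"] by (simp add: y_def)
  have yb: "\<bar>y i - wmean (w i) (I - {i}) z\<bar> \<le> \<gamma>" if "i \<in> I" for i
    using urow[OF that] Re[OF that] eta1[OF that] unfolding vz y_def \<gamma>_def by linarith
  have zb: "\<bar>z j - wmean (\<lambda>i. w i j) (I - {j}) y\<bar> \<le> \<gamma>" if "j \<in> I" for j
    using vcol[OF that] R'e[OF that] eta2[OF that] unfolding uy z_def \<gamma>_def by linarith
  have g0: "0 \<le> \<gamma>" using yb[OF n(1)] by linarith
  have "z j - z l \<le> \<gamma> / m" if "j \<in> I" "l \<in> I" for j l
  proof (rule oscillation_bound(2)[OF fin N m g0 wm])
    show "y i - y k \<le> max 0 (wmean (w i) (I - {i}) z - wmean (w k) (I - {k}) z + 2 * \<gamma>)"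
      if "i \<in> I" "k \<in> I" for i k
      using yb[OF that(1)] yb[OF that(2)] by linarith
    show "z i - z k \<le> max 0 (wmean (\<lambda>j. w j i) (I - {i}) y - wmean (\<lambda>j. w j k) (I - {k}) y + 2 * \<gamma>)"
      if "i \<in> I" "k \<in> I" for i k
      using zb[OF that(1)] zb[OF that(2)] by linarith
  qed (use that in auto)
  then have zn: "z n - \<gamma> / m \<le> z j" "z j \<le> z n + \<gamma> / m" if "j \<in> I" for j
    using that n(1) by (smt (verit))+
  have pos: "0 < w k j" if "j \<in> I - {k}" for j using wm[of k j] that k m by auto
  have "wmean (w k) (I - {k}) z \<le> z n + \<gamma> / m"
    using pos zn(2) fin ne[OF k] by (intro wmean_le) auto
  moreover have "z n - \<gamma> / m \<le> wmean (w k) (I - {k}) z"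
    using pos zn(1) fin ne[OF k] by (intro wmean_ge) auto
  ultimately have "\<bar>y k - z n\<bar> \<le> \<gamma> / m + \<gamma>" using yb[OF k] by linarith
  also have "\<dots> \<le> 2 * \<gamma> / m"
  proof -
    have "\<gamma> \<le> \<gamma> / m"
      using g0 m m4 mult_right_mono[of m 1 \<gamma>] by (simp add: le_divide_eq mult.commute)
    then show ?thesis by simp
  qed
  finally show ?thesis using n(2) by (simp add: y_def z_def \<gamma>_def e_def)
qed

section \<open>Inverse square roots of positive definite matrices\<close>

lemma symmetric_matrix_iff:
  fixes A :: "real^'k^'k"
  shows "transpose A = A \<longleftrightarrow> (\<forall>x y. x \<bullet> (A *v y) = (A *v x) \<bullet> y)"
proof
  assume "transpose A = A"
  then show "\<forall>x y. x \<bullet> (A *v y) = (A *v x) \<bullet> y"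
    by (metis dot_lmul_matrix transpose_matrix_vector)
next
  assume *: "\<forall>x y. x \<bullet> (A *v y) = (A *v x) \<bullet> y"
  have "axis i 1 \<bullet> (A *v axis j 1) = A $ i $ j" for i j
    by (simp add: inner_axis' matrix_vector_mult_basis column_def)
  then have "A $ i $ j = A $ j $ i" for i j using * by (metis inner_commute)
  then show "transpose A = A" by (simp add: transpose_def vec_eq_iff)
qed

lemma sym_pos_def_coercive:
  fixes A :: "real^'k^'k"
  assumes A: "\<And>x. x \<noteq> 0 \<Longrightarrow> x \<bullet> (A *v x) > 0"
  obtains c where "c > 0" "\<And>x. c * (norm x)\<^sup>2 \<le> x \<bullet> (A *v x)"
proof -
  have "continuous_on (sphere 0 1) (\<lambda>x. x \<bullet> (A *v x))"
    by (intro continuous_intros linear_continuous_on_compose[OF continuous_on_id] matrix_vector_mul_linear)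
  moreover have "(axis undefined 1 :: real^'k) \<in> sphere 0 1" by simp
  ultimately obtain x0 where x0: "x0 \<in> sphere 0 1"
    "\<And>x. x \<in> sphere 0 1 \<Longrightarrow> x0 \<bullet> (A *v x0) \<le> x \<bullet> (A *v x)"
    using continuous_attains_inf[of "sphere 0 1" "\<lambda>x. x \<bullet> (A *v x)"] by (metis compact_sphere empty_iff)
  define c where "c = x0 \<bullet> (A *v x0)"
  have "c > 0" using A[of x0] x0(1) unfolding c_def by (metis mem_sphere_0 norm_zero zero_neq_one)
  moreover have "c * (norm x)\<^sup>2 \<le> x \<bullet> (A *v x)" for x
  proof (cases "x = 0")
    case False
    have "c \<le> (x /\<^sub>R norm x) \<bullet> (A *v (x /\<^sub>R norm x))"
      using x0(2)[of "x /\<^sub>R norm x"] False by (simp add: c_def)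
    also have "\<dots> = (x \<bullet> (A *v x)) / (norm x)\<^sup>2"
      by (simp add: matrix_vector_mult_scaleR power2_eq_square divide_inverse algebra_simps)
    finally show ?thesis using False by (simp add: le_divide_eq)
  qed simp
  ultimately show ?thesis by (rule that)
qed

text \<open>
  For \<open>X = B - C\<close> one has \<open>B X + X C = 0\<close>.  Multiplying by \<open>X\<close> and taking traces gives
  \<open>tr (X B X) + tr (X C X) = 0\<close>, and both traces are sums of values of positive definite forms.
\<close>

lemma sym_pos_def_sqrt_unique:
  fixes B C :: "real^'k^'k"
  assumes B: "sym_pos_def B" and C: "sym_pos_def C" and eq: "B ** B = C ** C"
  shows "B = C"
proof -
  define X where "X = B - C"
  have sX: "transpose X = X" using B C unfolding X_def sym_pos_def_def
    by (simp add: transpose_def vec_eq_iff)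
  have "B *v (B *v x) = C *v (C *v x)" for x by (simp add: matrix_vector_mul_assoc eq)
  then have "(B ** X + X ** C) *v x = 0 *v x" for x
    by (simp add: X_def algebra_simps flip: matrix_vector_mul_assoc)
  then have "B ** X + X ** C = 0" by (simp add: matrix_eq)
  then have "trace (X ** (B ** X + X ** C)) = 0" by (simp add: trace_def)
  moreover have "trace (X ** (B ** X + X ** C)) = trace (X ** (B ** X)) + trace (X ** (C ** X))"
    using trace_mul_sym[of X "X ** C"] by (simp add: matrix_add_ldistrib trace_add matrix_mul_assoc)
  moreover have tr: "trace (X ** (D ** X)) = (\<Sum>j\<in>UNIV. (X *v axis j 1) \<bullet> (D *v (X *v axis j 1)))" for D
  proof -
    have "(X ** (D ** X)) $ j $ j = (X *v axis j 1) \<bullet> (D *v (X *v axis j 1))" for j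
    proof -
      have "(X ** (D ** X)) $ j $ j = axis j 1 \<bullet> ((X ** (D ** X)) *v axis j 1)"
        by (simp add: inner_axis' matrix_vector_mult_basis column_def)
      also have "\<dots> = axis j 1 \<bullet> (X *v (D *v (X *v axis j 1)))"
        by (simp add: matrix_vector_mul_assoc matrix_mul_assoc)
      also have "\<dots> = (X *v axis j 1) \<bullet> (D *v (X *v axis j 1))"
        using sX unfolding symmetric_matrix_iff by blast
      finally show ?thesis .
    qed
    then show ?thesis by (simp add: trace_def)
  qed
  ultimately have "(\<Sum>j\<in>UNIV. (X *v axis j 1) \<bullet> (B *v (X *v axis j 1)) + (X *v axis j 1) \<bullet> (C *v (X *v axis j 1))) = 0"
    by (simp add: sum.distrib)
  moreover have Bn: "0 \<le> x \<bullet> (B *v x)" and Cn: "0 \<le> x \<bullet> (C *v x)" for x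
    using B C unfolding sym_pos_def_def by (cases "x = 0"; force)+
  ultimately have "(X *v axis j 1) \<bullet> (B *v (X *v axis j 1)) + (X *v axis j 1) \<bullet> (C *v (X *v axis j 1)) = 0" for j
    by (subst (asm) sum_nonneg_eq_0_iff) (auto intro: add_nonneg_nonneg)
  then have "(X *v axis j 1) \<bullet> (B *v (X *v axis j 1)) = 0" for j
    using Bn[of "X *v axis j 1"] Cn[of "X *v axis j 1"] by (smt (verit))
  then have "X *v axis j 1 = 0" for j
    using B unfolding sym_pos_def_def by (metis less_irrefl)
  then have "X $ i $ j = 0" for i j
    by (metis column_def matrix_vector_mult_basis vec_lambda_beta zero_index)
  then show ?thesis by (simp add: X_def vec_eq_iff)
qed

text \<open>
  Polarisation bounds \<open>x \<bullet> E y\<close> on unit vectors by \<open>e\<close>; positivity of the form lets the second square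
  be dropped.
\<close>

lemma selfadjoint_norm_le:
  fixes E :: "'a::real_inner \<Rightarrow>\<^sub>L 'a"
  assumes sym: "\<And>x y. x \<bullet> E y = E x \<bullet> y" and lo: "\<And>x. 0 \<le> x \<bullet> E x"
    and up: "\<And>x. x \<bullet> E x \<le> e * (norm x)\<^sup>2" and e: "0 \<le> e"
  shows "norm E \<le> e"
proof (rule norm_blinfun_bound[OF e])
  have unit: "x \<bullet> E y \<le> e" if "norm x = 1" "norm y = 1" for x y
  proof -
    have "4 * (x \<bullet> E y) = (x + y) \<bullet> E (x + y) - (x - y) \<bullet> E (x - y)"
      using sym[of y x] by (simp add: blinfun.add_right blinfun.diff_right inner_diff inner_add inner_commute)
    also have "\<dots> \<le> e * (norm (x + y))\<^sup>2" using up[of "x + y"] lo[of "x - y"] by linarith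
    also have "\<dots> \<le> e * 2\<^sup>2"
      using norm_triangle_ineq[of x y] that e by (intro mult_left_mono power_mono) auto
    finally show ?thesis by simp
  qed
  fix y
  show "norm (E y) \<le> e * norm y"
  proof (cases "E y = 0")
    case False
    then have "y \<noteq> 0" by (metis blinfun.zero_right)
    have "(E y /\<^sub>R norm (E y)) \<bullet> E (y /\<^sub>R norm y) \<le> e"
      using False \<open>y \<noteq> 0\<close> by (intro unit) auto
    also have "(E y /\<^sub>R norm (E y)) \<bullet> E (y /\<^sub>R norm y) = norm (E y) / norm y"
      using False \<open>y \<noteq> 0\<close>
      by (simp add: blinfun.scaleR_right dot_square_norm power2_eq_square field_simps)
    finally show ?thesis using \<open>y \<noteq> 0\<close> by (simp add: divide_le_eq)
  qed (use e in simp)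
qed

text \<open>
  Scale \<open>A\<close> to \<open>I - E\<close> with \<open>\<parallel>E\<parallel> \<le> e < 1\<close>.  A fixed point of \<open>Y \<mapsto> (E + Y\<^sup>2) / 2\<close> satisfies
  \<open>(I - Y)\<^sup>2 = I - E\<close>, and this map is an \<open>e\<close>-contraction of the selfadjoint operators of norm at
  most \<open>e\<close>.
\<close>

lemma selfadjoint_sqrt_exists:
  fixes A :: "'a::euclidean_space \<Rightarrow>\<^sub>L 'a"
  assumes sym: "\<And>x y. x \<bullet> A y = A x \<bullet> y" and c: "c > 0" "\<And>x. c * (norm x)\<^sup>2 \<le> x \<bullet> A x"
  obtains B where "\<And>x y. x \<bullet> blinfun_apply B y = blinfun_apply B x \<bullet> y"
    "\<And>x. x \<noteq> 0 \<Longrightarrow> 0 < x \<bullet> blinfun_apply B x" "\<And>x. B (B x) = A x"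
proof -
  define L where "L = norm A + c"
  have L: "L > 0" using c by (simp add: L_def add_nonneg_pos)
  define E where "E = id_blinfun - A /\<^sub>R L"
  define e where "e = 1 - c / L"
  have e: "0 \<le> e" "e < 1" using c L by (auto simp: e_def L_def)
  have nE: "norm E \<le> e"
  proof (rule selfadjoint_norm_le)
    show "x \<bullet> E y = E x \<bullet> y" for x y
      using sym by (simp add: E_def blinfun.diff_left blinfun.scaleR_left inner_diff)
    fix x
    have "x \<bullet> A x \<le> norm x * norm (A x)" by (rule norm_cauchy_schwarz)
    also have "\<dots> \<le> norm x * (norm A * norm x)" by (intro mult_left_mono norm_blinfun) auto
    also have "\<dots> \<le> L * (norm x)\<^sup>2" using c by (simp add: L_def power2_eq_square algebra_simps)
    finally have "(x \<bullet> A x) / L \<le> (norm x)\<^sup>2" using L by (simp add: divide_le_eq mult.commute)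
    then show "0 \<le> x \<bullet> E x"
      by (simp add: E_def blinfun.diff_left blinfun.scaleR_left inner_diff dot_square_norm divide_inverse mult.commute)
    have "c * (norm x)\<^sup>2 / L \<le> (x \<bullet> A x) / L" using c(2)[of x] L by (intro divide_right_mono) auto
    then show "x \<bullet> E x \<le> e * (norm x)\<^sup>2"
      by (simp add: E_def e_def blinfun.diff_left blinfun.scaleR_left inner_diff dot_square_norm divide_inverse algebra_simps)
  qed (use e in auto)
  have sE: "x \<bullet> E y = E x \<bullet> y" for x y
    using sym by (simp add: E_def blinfun.diff_left blinfun.scaleR_left inner_diff)
  \<comment> \<open>The fixed point is sought in this closed set to make it selfadjoint.\<close>
  define S where "S = {Y :: 'a \<Rightarrow>\<^sub>L 'a. norm Y \<le> e \<and> (\<forall>x y. x \<bullet> blinfun_apply Y y = blinfun_apply Y x \<bullet> y)}"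
  define f where "f = (\<lambda>Y :: 'a \<Rightarrow>\<^sub>L 'a. (E + (Y o\<^sub>L Y)) /\<^sub>R 2)"
  have "closed S"
    unfolding S_def Collect_conj_eq Collect_all_eq
    by (intro closed_Int closed_INT ballI closed_Collect_le closed_Collect_eq continuous_intros)
  note complete_eq_closed[THEN iffD2, OF this]
  moreover have "S \<noteq> {}" using e by (auto simp: S_def intro!: exI[of _ 0])
  moreover have "f ` S \<subseteq> S"
  proof (rule image_subsetI)
    fix Y assume Y: "Y \<in> S"
    have "norm (E + (Y o\<^sub>L Y)) \<le> e + e * e"
      using Y nE norm_blinfun_compose[of Y Y] mult_mono[of "norm Y" e "norm Y" e] e
        norm_triangle_ineq[of E "Y o\<^sub>L Y"] by (auto simp: S_def)
    also have "\<dots> \<le> e * 2" using e mult_left_mono[of e 1 e] by simp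
    finally have "norm (f Y) \<le> e" by (simp add: f_def)
    moreover have "x \<bullet> f Y y = f Y x \<bullet> y" for x y
      using Y sE by (simp add: f_def S_def blinfun.add_left blinfun.scaleR_left inner_add)
    ultimately show "f Y \<in> S" by (simp add: S_def)
  qed
  moreover have "dist (f Y) (f Z) \<le> e * dist Y Z" if Y: "Y \<in> S" and Z: "Z \<in> S" for Y Z
  proof -
    have nY: "norm Y \<le> e" and nZ: "norm Z \<le> e" using Y Z by (auto simp: S_def)
    have "f Y - f Z = ((Y o\<^sub>L (Y - Z)) + ((Y - Z) o\<^sub>L Z)) /\<^sub>R 2"
      by (rule blinfun_eqI) (simp add: f_def blinfun.add_left blinfun.diff_left blinfun.scaleR_left blinfun.diff_right algebra_simps)
    then have "norm (f Y - f Z) \<le> (norm (Y o\<^sub>L (Y - Z)) + norm ((Y - Z) o\<^sub>L Z)) / 2"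
      using norm_triangle_ineq[of "Y o\<^sub>L (Y - Z)" "(Y - Z) o\<^sub>L Z"] by simp
    also have "\<dots> \<le> (e * norm (Y - Z) + norm (Y - Z) * e) / 2"
      by (intro divide_right_mono add_mono order.trans[OF norm_blinfun_compose]
            mult_right_mono[OF nY] mult_left_mono[OF nZ]) auto
    finally show "dist (f Y) (f Z) \<le> e * dist Y Z" by (simp add: dist_norm mult.commute)
  qed
  ultimately obtain Y where Y: "Y \<in> S" "f Y = Y"
    using Banach_fix[of S e f] e by blast
  show ?thesis
  proof (rule that[of "sqrt L *\<^sub>R (id_blinfun - Y)"])
    show "x \<bullet> (sqrt L *\<^sub>R (id_blinfun - Y)) y = (sqrt L *\<^sub>R (id_blinfun - Y)) x \<bullet> y" for x y
      using Y by (simp add: S_def blinfun.scaleR_left blinfun.diff_left inner_diff)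
    show "0 < x \<bullet> (sqrt L *\<^sub>R (id_blinfun - Y)) x" if "x \<noteq> 0" for x
    proof -
      have "x \<bullet> Y x \<le> norm x * (norm Y * norm x)"
        by (intro order.trans[OF norm_cauchy_schwarz] mult_left_mono norm_blinfun) auto
      also have "\<dots> \<le> norm x * (e * norm x)"
        using Y by (intro mult_left_mono mult_right_mono) (auto simp: S_def)
      also have "\<dots> < x \<bullet> x" using that e by (simp add: dot_square_norm power2_eq_square)
      finally show ?thesis using L by (simp add: blinfun.scaleR_left blinfun.diff_left inner_diff)
    qed
    fix x
    have "Y x = (E x + Y (Y x)) /\<^sub>R 2"
      using arg_cong[OF Y(2), of "\<lambda>Z. blinfun_apply Z x"] by (simp add: f_def blinfun.add_left blinfun.scaleR_left)
    from arg_cong[OF this, of "\<lambda>z. 2 *\<^sub>R z"] have "2 *\<^sub>R Y x = E x + Y (Y x)" by simp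
    then have "x - 2 *\<^sub>R Y x + Y (Y x) = A x /\<^sub>R L"
      by (simp add: E_def blinfun.diff_left blinfun.scaleR_left)
    then have "L *\<^sub>R (x - 2 *\<^sub>R Y x + Y (Y x)) = A x" using L by simp
    then show "(sqrt L *\<^sub>R (id_blinfun - Y)) ((sqrt L *\<^sub>R (id_blinfun - Y)) x) = A x"
      using L by (simp add: blinfun.scaleR_left blinfun.scaleR_right blinfun.diff_left blinfun.diff_right scaleR_2 algebra_simps)
  qed
qed

lemma sym_pos_def_sqrt_exists:
  fixes A :: "real^'k^'k"
  assumes A: "sym_pos_def A"
  obtains B where "sym_pos_def B" "B ** B = A"
proof -
  define T where "T = Blinfun ((*v) A)"
  have T: "blinfun_apply T x = A *v x" for x
    unfolding T_def by (subst bounded_linear_Blinfun_apply) auto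
  obtain c where c: "c > 0" "\<And>x. c * (norm x)\<^sup>2 \<le> x \<bullet> (A *v x)"
    using sym_pos_def_coercive[of A] A by (auto simp: sym_pos_def_def)
  have "\<And>x y. x \<bullet> T y = T x \<bullet> y"
    using A unfolding T sym_pos_def_def symmetric_matrix_iff by auto
  then obtain R where R: "\<And>x y. x \<bullet> blinfun_apply R y = blinfun_apply R x \<bullet> y"
    "\<And>x. x \<noteq> 0 \<Longrightarrow> 0 < x \<bullet> blinfun_apply R x" "\<And>x. R (R x) = T x"
    using selfadjoint_sqrt_exists[of T c] c T by metis
  define B where "B = matrix (blinfun_apply R)"
  have B: "B *v x = R x" for x
    unfolding B_def by (rule matrix_works) (simp add: blinfun.bounded_linear_right bounded_linear.linear linear_matrix_vector_mul_eq)
  have "(B ** B) *v x = A *v x" for x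
    by (simp add: B R(3) T flip: matrix_vector_mul_assoc)
  then have "B ** B = A" by (simp add: matrix_eq)
  moreover have "sym_pos_def B"
    unfolding sym_pos_def_def symmetric_matrix_iff using R by (simp add: B)
  ultimately show ?thesis by (intro that)
qed

text \<open>
  The second identity says that \<open>A\<^sup>-\<^sup>1\<^sup>/\<^sup>2\<close> is an isometry from the Euclidean norm to the norm of \<open>A\<close>.
\<close>

lemma matrix_inv_sqrt:
  fixes A :: "real^'k^'k"
  assumes A: "sym_pos_def A"
  shows "transpose (matrix_inv_sqrt A) = matrix_inv_sqrt A"
    and "(matrix_inv_sqrt A *v t) \<bullet> (A *v (matrix_inv_sqrt A *v t)) = t \<bullet> t"
proof -
  have "\<And>x. A *v x = 0 \<Longrightarrow> x = 0" using A unfolding sym_pos_def_def by (metis inner_zero_right less_irrefl)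
  then have "invertible A"
    using matrix_left_invertible_ker[of A] invertible_left_inverse[of A] by blast
  then have inv: "A ** matrix_inv A = mat 1" "matrix_inv A ** A = mat 1"
    using someI_ex[of "\<lambda>A'. A ** A' = mat 1 \<and> A' ** A = mat 1"]
    unfolding invertible_def matrix_inv_def by auto
  have sA: "x \<bullet> (A *v y) = (A *v x) \<bullet> y" for x y using A unfolding sym_pos_def_def symmetric_matrix_iff by blast
  have AI: "A *v (matrix_inv A *v x) = x" for x by (simp add: matrix_vector_mul_assoc inv)
  have "sym_pos_def (matrix_inv A)"
    unfolding sym_pos_def_def symmetric_matrix_iff
  proof (intro conjI allI impI)
    show "x \<bullet> (matrix_inv A *v y) = (matrix_inv A *v x) \<bullet> y" for x y
      using sA[of "matrix_inv A *v x" "matrix_inv A *v y"] by (simp add: AI)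
    show "0 < x \<bullet> (matrix_inv A *v x)" if "x \<noteq> 0" for x
    proof -
      have "matrix_inv A *v x \<noteq> 0" using AI[of x] that by (metis matrix_vector_mult_0_right)
      then have "0 < (matrix_inv A *v x) \<bullet> (A *v (matrix_inv A *v x))"
        using A unfolding sym_pos_def_def by blast
      then show ?thesis by (simp add: AI inner_commute)
    qed
  qed
  then obtain B where B: "sym_pos_def B" "B ** B = matrix_inv A" by (rule sym_pos_def_sqrt_exists)
  have "matrix_inv_sqrt A = B"
    unfolding matrix_inv_sqrt_def using B by (intro the_equality) (auto intro: sym_pos_def_sqrt_unique)
  moreover have sB: "transpose B = B" using B by (simp add: sym_pos_def_def)
  moreover have "(B *v t) \<bullet> (A *v (B *v t)) = t \<bullet> t"
  proof -
    have "B ** (B ** A) = mat 1" using B inv by (simp add: matrix_mul_assoc)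
    then have "(B ** A) ** B = mat 1" using matrix_left_right_inverse by blast
    then have "B *v (A *v (B *v t)) = t"
      by (metis matrix_vector_mul_assoc matrix_vector_mul_lid)
    then show ?thesis using sB unfolding symmetric_matrix_iff by metis
  qed
  ultimately show "transpose (matrix_inv_sqrt A) = matrix_inv_sqrt A"
    "(matrix_inv_sqrt A *v t) \<bullet> (A *v (matrix_inv_sqrt A *v t)) = t \<bullet> t" by auto
qed

section \<open>The standard normal law on a Euclidean space\<close>

lemma Basis_real_cart: "(Basis :: (real^'k) set) = (\<lambda>i. axis i 1) ` UNIV"
  by (auto simp: Basis_vec_def)

lemma prod_Basis_real_cart: "(\<Prod>b\<in>(Basis :: (real^'k) set). f b) = (\<Prod>i\<in>UNIV. f (axis i 1))"
  unfolding Basis_real_cart by (subst prod.reindex) (auto simp: inj_on_def axis_eq_axis)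

lemma integral_lborel_prod_cart:
  fixes g :: "'k::finite \<Rightarrow> real \<Rightarrow> complex"
  assumes g: "\<And>i. integrable lborel (g i)"
  shows "(LINT x|(lborel :: (real^'k) measure). (\<Prod>i\<in>UNIV. g i (x $ i))) = (\<Prod>i\<in>UNIV. (LINT y|lborel. g i y))"
proof -
  interpret product_sigma_finite "\<lambda>_ :: real^'k. lborel :: real measure"
    by (unfold_locales)
  define ix where "ix = (\<lambda>b :: real^'k. SOME i. b = axis i 1)"
  have ix: "ix (axis i 1) = i" for i
    unfolding ix_def by (rule some_equality) (auto simp: axis_eq_axis)
  have gm [measurable]: "g i \<in> borel_measurable borel" for i
    using borel_measurable_integrable[OF g[of i]] by simp
  have "(LINT x|(lborel :: (real^'k) measure). (\<Prod>i\<in>UNIV. g i (x $ i)))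
      = (LINT f|(\<Pi>\<^sub>M b\<in>(Basis :: (real^'k) set). lborel). (\<Prod>i\<in>UNIV. g i ((\<Sum>b\<in>Basis. f b *\<^sub>R b) $ i)))"
    by (subst lborel_eq, subst integral_distr) auto
  also have "\<dots> = (LINT f|(\<Pi>\<^sub>M b\<in>(Basis :: (real^'k) set). lborel). (\<Prod>b\<in>Basis. g (ix b) (f b)))"
  proof (intro Bochner_Integration.integral_cong refl)
    fix f :: "real^'k \<Rightarrow> real"
    have "(\<Sum>b\<in>Basis. f b *\<^sub>R b) $ i = f (axis i 1)" for i
    proof -
      have "(\<Sum>b\<in>Basis. f b *\<^sub>R b) $ i = (\<Sum>b\<in>Basis. f b *\<^sub>R b) \<bullet> axis i 1"
        by (simp add: inner_axis)
      also have "\<dots> = f (axis i 1)"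
        by (subst inner_sum_left_Basis) (auto simp: axis_in_Basis_iff)
      finally show ?thesis .
    qed
    then show "(\<Prod>i\<in>UNIV. g i ((\<Sum>b\<in>Basis. f b *\<^sub>R b) $ i)) = (\<Prod>b\<in>Basis. g (ix b) (f b))"
      by (simp add: prod_Basis_real_cart ix)
  qed
  also have "\<dots> = (\<Prod>b\<in>(Basis :: (real^'k) set). (LINT y|lborel. g (ix b) y))"
    by (rule product_integral_prod) (auto intro: g)
  also have "\<dots> = (\<Prod>i\<in>UNIV. (LINT y|lborel. g i y))"
    by (simp add: prod_Basis_real_cart ix)
  finally show ?thesis .
qed

lemma std_normal_vec_density_measurable [measurable]:
  "(\<lambda>x::real^'k. \<Prod>i\<in>UNIV. std_normal_density (x $ i)) \<in> borel_measurable borel"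
  by measurable

lemma sets_std_normal_vec [measurable_cong, simp]: "sets std_normal_vec = sets borel"
  and space_std_normal_vec [simp]: "space std_normal_vec = UNIV"
  by (auto simp: std_normal_vec_def)

lemma std_normal_vec_prob_space: "prob_space (std_normal_vec :: (real^'k) measure)"
proof
  have "emeasure std_normal_vec (space (std_normal_vec :: (real^'k) measure))
      = (\<integral>\<^sup>+x. ennreal (\<Prod>i\<in>UNIV. std_normal_density (x $ i)) \<partial>(lborel :: (real^'k) measure))"
    by (simp add: std_normal_vec_def emeasure_density)
  also have "\<dots> = (\<integral>\<^sup>+x. (\<Prod>b\<in>Basis. ennreal (std_normal_density (x \<bullet> b))) \<partial>(lborel :: (real^'k) measure))"
    by (intro nn_integral_cong) (simp add: prod_Basis_real_cart inner_axis prod_ennreal)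
  also have "\<dots> = (\<Prod>b\<in>(Basis :: (real^'k) set). (\<integral>\<^sup>+y. ennreal (std_normal_density y) \<partial>lborel))"
    by (rule nn_integral_lborel_prod) auto
  also have "\<dots> = 1"
    using prob_space.emeasure_space_1[OF prob_space_normal_density[of 1 0]]
    by (simp add: emeasure_density)
  finally show "emeasure std_normal_vec (space (std_normal_vec :: (real^'k) measure)) = 1" .
qed

lemma char_std_normal_vec:
  "(CLINT x|(std_normal_vec :: (real^'k) measure). iexp (t \<bullet> x)) = exp (- (norm t)\<^sup>2 / 2)"
proof -
  have int: "integrable lborel (\<lambda>y. complex_of_real (std_normal_density y) * iexp (s * y))" for s
    by (rule Bochner_Integration.integrable_bound[where f=std_normal_density])
       (auto intro: integrable_normal_moment[where k=0 and \<mu>=0 and \<sigma>=1, simplified] simp: norm_mult)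
  have one: "(LINT y|lborel. complex_of_real (std_normal_density y) * iexp (s * y)) = exp (- s\<^sup>2 / 2)" for s
  proof -
    have "char std_normal_distribution s = (LINT y|lborel. std_normal_density y *\<^sub>R iexp (s * y))"
      unfolding char_def by (subst integral_density) (auto simp: mult.commute)
    then show ?thesis by (simp add: char_std_normal_distribution scaleR_conv_of_real)
  qed
  have "(CLINT x|(std_normal_vec :: (real^'k) measure). iexp (t \<bullet> x))
      = (LINT x|(lborel :: (real^'k) measure). (\<Prod>i\<in>UNIV. std_normal_density (x $ i)) *\<^sub>R iexp (t \<bullet> x))"
    unfolding std_normal_vec_def by (subst integral_density) (auto intro!: prod_nonneg)
  also have "\<dots> = (LINT x|(lborel :: (real^'k) measure). (\<Prod>i\<in>UNIV. complex_of_real (std_normal_density (x $ i)) * iexp (t $ i * x $ i)))"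
    by (intro Bochner_Integration.integral_cong refl)
       (simp add: scaleR_conv_of_real prod.distrib inner_vec_def exp_sum sum_distrib_left)
  also have "\<dots> = (\<Prod>i\<in>UNIV. complex_of_real (exp (- (t $ i)\<^sup>2 / 2)))"
    by (simp only: integral_lborel_prod_cart[OF int] one)
  also have "\<dots> = exp (- (norm t)\<^sup>2 / 2)"
    by (simp add: norm_vec_def L2_set_def real_sqrt_pow2 sum_nonneg exp_sum sum_divide_distrib flip: of_real_prod sum_negf)
  finally show ?thesis .
qed

section \<open>Convergence to the normal law from characteristic functions\<close>

text \<open>
  The Gaussian kernel is itself the characteristic function of a normal vector, so its expectation is a
  Gaussian average of the characteristic function of \<open>\<mu>\<close>.
\<close>

lemma gaussian_kernel_expectation:
  fixes \<mu> :: "(real^'k) measure" and y :: "real^'k" and c :: real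
  assumes p: "prob_space \<mu>" and S [measurable_cong, simp]: "sets \<mu> = sets borel"
  shows "complex_of_real (LINT x|\<mu>. exp (- (c\<^sup>2 * (norm (x - y))\<^sup>2) / 2))
    = (CLINT s|std_normal_vec. iexp (- c * (s \<bullet> y)) * (CLINT x|\<mu>. iexp ((c *\<^sub>R s) \<bullet> x)))"
proof -
  interpret \<mu>: prob_space \<mu> by (rule p)
  interpret N: prob_space "std_normal_vec :: (real^'k) measure" by (rule std_normal_vec_prob_space)
  interpret P: pair_prob_space \<mu> "std_normal_vec :: (real^'k) measure" ..
  have "complex_of_real (LINT x|\<mu>. exp (- (c\<^sup>2 * (norm (x - y))\<^sup>2) / 2))
      = (CLINT x|\<mu>. (CLINT s|std_normal_vec. iexp ((c *\<^sub>R (x - y)) \<bullet> s)))"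
    unfolding char_std_normal_vec
    by (simp add: power_mult_distrib flip: integral_complex_of_real)
  also have "\<dots> = (CLINT s|std_normal_vec. (CLINT x|\<mu>. iexp ((c *\<^sub>R (x - y)) \<bullet> s)))"
  proof (rule P.Fubini_integral[symmetric])
    have [measurable]: "(\<lambda>z::(real^'k) \<times> (real^'k). (c *\<^sub>R (fst z - y)) \<bullet> snd z) \<in> borel_measurable (borel \<Otimes>\<^sub>M borel)"
      by (intro borel_measurable_inner borel_measurable_scaleR borel_measurable_diff) auto
    have sets: "sets (\<mu> \<Otimes>\<^sub>M std_normal_vec) = sets (borel \<Otimes>\<^sub>M borel)"
      by (intro sets_pair_measure_cong) auto
    have "(\<lambda>(x, s). iexp ((c *\<^sub>R (x - y)) \<bullet> s)) \<in> borel_measurable (\<mu> \<Otimes>\<^sub>M std_normal_vec)"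
      unfolding measurable_cong_sets[OF sets refl] case_prod_beta by measurable
    then show "integrable (\<mu> \<Otimes>\<^sub>M std_normal_vec) (\<lambda>(x, s). iexp ((c *\<^sub>R (x - y)) \<bullet> s))"
      by (intro P.integrable_const_bound[where B=1]) auto
  qed
  also have "\<dots> = (CLINT s|std_normal_vec. iexp (- c * (s \<bullet> y)) * (CLINT x|\<mu>. iexp ((c *\<^sub>R s) \<bullet> x)))"
  proof (intro Bochner_Integration.integral_cong refl)
    fix s :: "real^'k"
    have "iexp ((c *\<^sub>R (x - y)) \<bullet> s) = iexp (- c * (s \<bullet> y)) * iexp ((c *\<^sub>R s) \<bullet> x)" for x
    proof -
      have e: "(c *\<^sub>R (x - y)) \<bullet> s = (- c * (s \<bullet> y)) + ((c *\<^sub>R s) \<bullet> x)"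
        by (simp add: inner_commute inner_diff algebra_simps)
      show ?thesis unfolding e of_real_add distrib_left exp_add ..
    qed
    then show "(CLINT x|\<mu>. iexp ((c *\<^sub>R (x - y)) \<bullet> s)) = iexp (- c * (s \<bullet> y)) * (CLINT x|\<mu>. iexp ((c *\<^sub>R s) \<bullet> x))"
      by simp
  qed
  finally show ?thesis .
qed

lemma gaussian_kernel_convergence:
  fixes \<mu> :: "nat \<Rightarrow> (real^'k) measure" and y :: "real^'k" and c :: real
  assumes p: "\<And>n. prob_space (\<mu> n)" and S [simp]: "\<And>n. sets (\<mu> n) = sets borel"
    and char: "\<And>t. (\<lambda>n. CLINT x|\<mu> n. iexp (t \<bullet> x)) \<longlonglongrightarrow> exp (- (norm t)\<^sup>2 / 2)"
  shows "(\<lambda>n. LINT x|\<mu> n. exp (- (c\<^sup>2 * (norm (x - y))\<^sup>2) / 2))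
    \<longlonglongrightarrow> (LINT x|std_normal_vec. exp (- (c\<^sup>2 * (norm (x - y))\<^sup>2) / 2))"
proof -
  interpret N: prob_space "std_normal_vec :: (real^'k) measure" by (rule std_normal_vec_prob_space)
  have "(\<lambda>n. complex_of_real (LINT x|\<mu> n. exp (- (c\<^sup>2 * (norm (x - y))\<^sup>2) / 2)))
    \<longlonglongrightarrow> complex_of_real (LINT x|std_normal_vec. exp (- (c\<^sup>2 * (norm (x - y))\<^sup>2) / 2))"
    unfolding gaussian_kernel_expectation[OF p S]
      gaussian_kernel_expectation[OF std_normal_vec_prob_space sets_std_normal_vec] char_std_normal_vec
  proof (rule integral_dominated_convergence[where w="\<lambda>_. 1"])
    have meas: "(\<lambda>s. CLINT x|\<mu> n. iexp ((c *\<^sub>R s) \<bullet> x)) \<in> borel_measurable borel" for n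
    proof -
      interpret \<mu>: prob_space "\<mu> n" by (rule p)
      have [measurable]: "(\<lambda>z::(real^'k) \<times> (real^'k). (c *\<^sub>R fst z) \<bullet> snd z) \<in> borel_measurable (borel \<Otimes>\<^sub>M borel)"
        by (intro borel_measurable_inner borel_measurable_scaleR) auto
      have sets: "sets (borel \<Otimes>\<^sub>M \<mu> n) = sets (borel \<Otimes>\<^sub>M borel)"
        by (intro sets_pair_measure_cong) auto
      have "(\<lambda>(s, x). iexp ((c *\<^sub>R s) \<bullet> x)) \<in> borel_measurable (borel \<Otimes>\<^sub>M \<mu> n)"
        unfolding measurable_cong_sets[OF sets refl] case_prod_beta by measurable
      then show ?thesis by (rule \<mu>.borel_measurable_lebesgue_integral)
    qed
    show "(\<lambda>s. iexp (- c * (s \<bullet> y)) * (CLINT x|\<mu> n. iexp ((c *\<^sub>R s) \<bullet> x))) \<in> borel_measurable std_normal_vec" for n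
      unfolding measurable_cong_sets[OF sets_std_normal_vec refl] using meas[of n] by auto
    show "(\<lambda>s. iexp (- c * (s \<bullet> y)) * complex_of_real (exp (- (norm (c *\<^sub>R s))\<^sup>2 / 2))) \<in> borel_measurable std_normal_vec"
      unfolding measurable_cong_sets[OF sets_std_normal_vec refl] by auto
    show "AE s in std_normal_vec. (\<lambda>n. iexp (- c * (s \<bullet> y)) * (CLINT x|\<mu> n. iexp ((c *\<^sub>R s) \<bullet> x)))
        \<longlonglongrightarrow> iexp (- c * (s \<bullet> y)) * complex_of_real (exp (- (norm (c *\<^sub>R s))\<^sup>2 / 2))"
      by (intro AE_I2 tendsto_mult tendsto_const char)
    show "AE s in std_normal_vec. norm (iexp (- c * (s \<bullet> y)) * (CLINT x|\<mu> n. iexp ((c *\<^sub>R s) \<bullet> x))) \<le> 1" for n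
    proof (rule AE_I2)
      fix s :: "real^'k"
      interpret \<mu>: prob_space "\<mu> n" by (rule p)
      have "norm (CLINT x|\<mu> n. iexp ((c *\<^sub>R s) \<bullet> x)) \<le> (LINT x|\<mu> n. norm (iexp ((c *\<^sub>R s) \<bullet> x)))"
        by (rule integral_norm_bound)
      also have "\<dots> = 1" using \<mu>.prob_space by simp
      finally show "norm (iexp (- c * (s \<bullet> y)) * (CLINT x|\<mu> n. iexp ((c *\<^sub>R s) \<bullet> x))) \<le> 1"
        by (simp add: norm_mult)
    qed
  qed auto
  then show ?thesis by (simp only: tendsto_of_real_iff)
qed

text \<open>
  The noise added to \<open>x\<close> has standard deviation \<open>1 / c\<close>.
\<close>

definition gaussian_smoothing :: "real \<Rightarrow> (real^'k \<Rightarrow> real) \<Rightarrow> real^'k \<Rightarrow> real" where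
  "gaussian_smoothing c f x = (LINT z|std_normal_vec. f (x + z /\<^sub>R c))"

lemma gaussian_smoothing_eq_convolution:
  fixes f :: "real^'k \<Rightarrow> real"
  assumes f [measurable]: "f \<in> borel_measurable borel" and c: "c > 0"
  shows "gaussian_smoothing c f x
    = (LINT y|lborel. (c / sqrt (2 * pi)) ^ CARD('k) * (f y * exp (- (c\<^sup>2 * (norm (x - y))\<^sup>2) / 2)))"
proof -
  let ?G = "\<lambda>z :: real^'k. (\<Prod>i\<in>UNIV. std_normal_density (z $ i)) * f (x + z /\<^sub>R c)"
  have dens: "(\<Prod>i\<in>UNIV. std_normal_density (z $ i)) = (1 / sqrt (2 * pi)) ^ CARD('k) * exp (- (norm z)\<^sup>2 / 2)"
    for z :: "real^'k"
    by (simp add: std_normal_density_def prod.distrib norm_vec_def L2_set_def real_sqrt_pow2 sum_nonneg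
          exp_sum sum_divide_distrib prod_dividef power_one_over flip: sum_negf)
  have "gaussian_smoothing c f x = (LINT z|lborel. ?G z)"
    unfolding gaussian_smoothing_def std_normal_vec_def
    by (subst integral_density) (auto intro!: prod_nonneg)
  also have "\<dots> = (LINT z|density (distr lborel borel (\<lambda>y. (- c *\<^sub>R x) + c *\<^sub>R y)) (\<lambda>_. \<bar>c\<bar> ^ CARD('k)). ?G z)"
    by (subst lborel_affine[of c "- c *\<^sub>R x"]) (use c in auto)
  also have "\<dots> = (LINT z|distr lborel borel (\<lambda>y. (- c *\<^sub>R x) + c *\<^sub>R y). \<bar>c\<bar> ^ CARD('k) * ?G z)"
    by (subst integral_density) auto
  also have "\<dots> = (LINT y|lborel. \<bar>c\<bar> ^ CARD('k) * ?G ((- c *\<^sub>R x) + c *\<^sub>R y))"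
    by (subst integral_distr) auto
  also have "\<dots> = (LINT y|lborel. (c / sqrt (2 * pi)) ^ CARD('k) * (f y * exp (- (c\<^sup>2 * (norm (x - y))\<^sup>2) / 2)))"
  proof (intro Bochner_Integration.integral_cong refl)
    fix y :: "real^'k"
    have e: "(- c *\<^sub>R x) + c *\<^sub>R y = - (c *\<^sub>R (x - y))" by (simp add: algebra_simps)
    have 1: "(norm (- (c *\<^sub>R (x - y))))\<^sup>2 = c\<^sup>2 * (norm (x - y))\<^sup>2" by (simp add: power_mult_distrib)
    have 2: "x + (- (c *\<^sub>R (x - y))) /\<^sub>R c = y" using c by (simp add: algebra_simps)
    show "\<bar>c\<bar> ^ CARD('k) * ?G ((- c *\<^sub>R x) + c *\<^sub>R y) = (c / sqrt (2 * pi)) ^ CARD('k) * (f y * exp (- (c\<^sup>2 * (norm (x - y))\<^sup>2) / 2))"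
      unfolding e 2 dens 1 using c by (simp add: power_divide power_one_over)
  qed
  finally show ?thesis .
qed

text \<open>
  Written as a convolution, the smoothed function is a superposition of Gaussian kernels, whose
  expectations converge; integrability of \<open>f\<close> dominates.
\<close>

lemma gaussian_smoothing_convergence:
  fixes \<mu> :: "nat \<Rightarrow> (real^'k) measure" and f :: "real^'k \<Rightarrow> real" and c :: real
  assumes p: "\<And>n. prob_space (\<mu> n)" and S [simp]: "\<And>n. sets (\<mu> n) = sets borel"
    and char: "\<And>t. (\<lambda>n. CLINT x|\<mu> n. iexp (t \<bullet> x)) \<longlonglongrightarrow> exp (- (norm t)\<^sup>2 / 2)"
    and f: "integrable lborel f" and c: "c > 0"
  shows "(\<lambda>n. LINT x|\<mu> n. gaussian_smoothing c f x) \<longlonglongrightarrow> (LINT x|std_normal_vec. gaussian_smoothing c f x)"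
proof -
  have fm [measurable]: "f \<in> borel_measurable borel" using borel_measurable_integrable[OF f] by simp
  define K where "K = (c / sqrt (2 * pi)) ^ CARD('k)"
  define E where "E = (\<lambda>(x :: real^'k) y. exp (- (c\<^sup>2 * (norm (x - y))\<^sup>2) / 2))"
  have Em: "(\<lambda>z. E (fst z) (snd z)) \<in> borel_measurable (borel \<Otimes>\<^sub>M borel)"
    unfolding E_def by measurable
  have Eb: "0 < E x y" "E x y \<le> 1" for x y by (auto simp: E_def)
  have Ea [simp]: "\<bar>E x y\<bar> = E x y" for x y using Eb(1)[of x y] by simp
  have fub: "(LINT x|\<nu>. gaussian_smoothing c f x) = (LINT y|lborel. K * (f y * (LINT x|\<nu>. E x y)))"
    and meas: "(\<lambda>y. LINT x|\<nu>. E x y) \<in> borel_measurable borel"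
    if "prob_space \<nu>" and \<nu>S [simp]: "sets \<nu> = sets borel" for \<nu> :: "(real^'k) measure"
  proof -
    interpret \<nu>: prob_space \<nu> by fact
    interpret pair_sigma_finite lborel \<nu> ..
    have sets: "sets (lborel \<Otimes>\<^sub>M \<nu>) = sets (borel \<Otimes>\<^sub>M borel)"
      by (intro sets_pair_measure_cong) auto
    have Ey: "integrable \<nu> (\<lambda>x. E x y)" for y
    proof (rule \<nu>.integrable_const_bound[where B=1])
      show "(\<lambda>x. E x y) \<in> borel_measurable \<nu>"
        unfolding measurable_cong_sets[OF \<nu>S refl] E_def by measurable
    qed (use Eb in \<open>auto simp: less_imp_le\<close>)
    have Em': "(\<lambda>z. E (snd z) (fst z)) \<in> borel_measurable (lborel \<Otimes>\<^sub>M \<nu>)"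
      unfolding measurable_cong_sets[OF sets refl] E_def by measurable
    show "(\<lambda>y. LINT x|\<nu>. E x y) \<in> borel_measurable borel"
      using \<nu>.borel_measurable_lebesgue_integral[of "\<lambda>y x. E x y" lborel] Em' by (simp add: case_prod_beta)
    have "(\<lambda>z. f (fst z)) \<in> borel_measurable (lborel \<Otimes>\<^sub>M \<nu>)"
      unfolding measurable_cong_sets[OF sets refl] by measurable
    then have m: "(\<lambda>z. K * (f (fst z) * E (snd z) (fst z))) \<in> borel_measurable (lborel \<Otimes>\<^sub>M \<nu>)"
      using Em' by measurable
    have "integrable (lborel \<Otimes>\<^sub>M \<nu>) (\<lambda>z. K * (f (fst z) * E (snd z) (fst z)))"
    proof (rule Fubini_integrable[OF m])
      have "integrable lborel (\<lambda>y. \<bar>K * f y\<bar>)" using f by simp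
      moreover have "(\<lambda>y. LINT x|\<nu>. norm (K * (f y * E x y))) \<in> borel_measurable lborel"
        using \<nu>.borel_measurable_lebesgue_integral[of "\<lambda>y x. norm (K * (f y * E x y))" lborel] m
        by (simp add: case_prod_beta)
      moreover have "(LINT x|\<nu>. norm (K * (f y * E x y))) \<le> \<bar>K * f y\<bar>" for y
      proof -
        have "(LINT x|\<nu>. norm (K * (f y * E x y))) \<le> (LINT x|\<nu>. \<bar>K * f y\<bar>)"
          using Ey[of y] Eb by (intro integral_mono) (auto simp: abs_mult mult.assoc[symmetric] intro!: mult_left_le)
        then show ?thesis by (simp add: \<nu>.prob_space)
      qed
      ultimately show "integrable lborel (\<lambda>y. LINT x|\<nu>. norm (K * (f (fst (y, x)) * E (snd (y, x)) (fst (y, x)))))"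
        by (elim Bochner_Integration.integrable_bound) (auto simp: abs_of_nonneg)
      show "AE y in lborel. integrable \<nu> (\<lambda>x. K * (f (fst (y, x)) * E (snd (y, x)) (fst (y, x))))"
        using Ey by auto
    qed
    then have "(LINT x|\<nu>. (LINT y|lborel. K * (f y * E x y))) = (LINT y|lborel. (LINT x|\<nu>. K * (f y * E x y)))"
      by (intro Fubini_integral) (simp only: case_prod_beta')
    then show "(LINT x|\<nu>. gaussian_smoothing c f x) = (LINT y|lborel. K * (f y * (LINT x|\<nu>. E x y)))"
      unfolding gaussian_smoothing_eq_convolution[OF fm c] by (simp add: K_def E_def)
  qed
  show ?thesis
    unfolding fub[OF p S] fub[OF std_normal_vec_prob_space sets_std_normal_vec]
  proof (rule integral_dominated_convergence[where w="\<lambda>y. \<bar>K * f y\<bar>"])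
    show "AE y in lborel. (\<lambda>n. K * (f y * (LINT x|\<mu> n. E x y))) \<longlonglongrightarrow> K * (f y * (LINT x|std_normal_vec. E x y))"
      unfolding E_def by (intro AE_I2 tendsto_mult tendsto_const gaussian_kernel_convergence[OF p S char])
    show "AE y in lborel. norm (K * (f y * (LINT x|\<mu> n. E x y))) \<le> \<bar>K * f y\<bar>" for n
    proof (rule AE_I2)
      fix y
      interpret \<mu>: prob_space "\<mu> n" by (rule p)
      have "(LINT x|\<mu> n. E x y) \<le> (LINT x|\<mu> n. 1)"
        using Eb by (intro integral_mono' ) (auto simp: less_imp_le)
      moreover have "0 \<le> (LINT x|\<mu> n. E x y)" using Eb by (intro integral_nonneg_AE) (auto simp: less_imp_le)
      ultimately show "norm (K * (f y * (LINT x|\<mu> n. E x y))) \<le> \<bar>K * f y\<bar>"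
        by (auto simp: abs_mult \<mu>.prob_space mult.assoc[symmetric] intro!: mult_left_le)
    qed
  qed (use meas[OF p S] meas[OF std_normal_vec_prob_space sets_std_normal_vec] f in auto)
qed

lemma uniformly_continuous_compact_support:
  fixes f :: "'a::euclidean_space \<Rightarrow> real"
  assumes f: "continuous_on UNIV f" and supp: "\<And>x. norm x > R \<Longrightarrow> f x = 0" and e: "e > 0"
  obtains d where "d > 0" "\<And>x y. norm (y - x) < d \<Longrightarrow> \<bar>f y - f x\<bar> < e"
proof -
  have "uniformly_continuous_on (cball 0 (R + 1)) f"
    using f by (intro compact_uniformly_continuous) (auto intro: continuous_on_subset)
  then obtain d where d: "d > 0"
    "\<And>x y. x \<in> cball 0 (R + 1) \<Longrightarrow> y \<in> cball 0 (R + 1) \<Longrightarrow> dist y x < d \<Longrightarrow> dist (f y) (f x) < e"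
    using e unfolding uniformly_continuous_on_def by metis
  show ?thesis
  proof (rule that[of "min d 1"])
    fix x y :: 'a assume xy: "norm (y - x) < min d 1"
    have n: "norm x \<le> norm y + norm (y - x)" "norm y \<le> norm x + norm (y - x)"
      using norm_triangle_ineq2[of y x] norm_triangle_ineq2[of x y] by (auto simp: norm_minus_commute)
    show "\<bar>f y - f x\<bar> < e"
    proof (cases "norm x \<le> R + 1 \<and> norm y \<le> R + 1")
      case True
      then show ?thesis using d(2)[of x y] xy by (auto simp: dist_norm)
    next
      case False
      then have "norm x > R" "norm y > R" using n xy by auto
      then show ?thesis using supp e by simp
    qed
  qed (use d in auto)
qed

lemma std_normal_vec_ball_tendsto_1:
  "(\<lambda>n. measure (std_normal_vec :: (real^'k) measure) (cball 0 (real n))) \<longlonglongrightarrow> 1"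
proof -
  interpret N: prob_space "std_normal_vec :: (real^'k) measure" by (rule std_normal_vec_prob_space)
  have "(\<lambda>n. N.prob (cball 0 (real n))) \<longlonglongrightarrow> N.prob (\<Union>n. cball 0 (real n))"
    by (rule N.finite_Lim_measure_incseq) (auto simp: incseq_def)
  moreover have "(\<Union>n. cball (0::real^'k) (real n)) = space std_normal_vec"
    using real_arch_simple by auto
  ultimately show ?thesis using N.prob_space by simp
qed

text \<open>
  The error is uniform in \<open>x\<close>, so it can be integrated against all the measures of a sequence at once:
  uniform continuity handles small displacements, boundedness the tail of the normal law.
\<close>

lemma gaussian_smoothing_approximates:
  fixes f :: "real^'k \<Rightarrow> real"
  assumes f: "continuous_on UNIV f" and supp: "\<And>x. norm x > R \<Longrightarrow> f x = 0" and e: "e > 0"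
    and B: "\<And>x. \<bar>f x\<bar> \<le> B"
  obtains c where "c > 0" "\<And>x. \<bar>gaussian_smoothing c f x - f x\<bar> \<le> e"
proof -
  interpret N: prob_space "std_normal_vec :: (real^'k) measure" by (rule std_normal_vec_prob_space)
  have B0: "0 \<le> B" using B[of 0] by simp
  obtain d where d: "d > 0" "\<And>x y. norm (y - x) < d \<Longrightarrow> \<bar>f y - f x\<bar> < e / 2"
    using uniformly_continuous_compact_support[OF f supp half_gt_zero[OF e]] by blast
  define q where "q = e / (4 * (B + 1))"
  have q: "q > 0" using e B0 by (simp add: q_def)
  have "\<forall>\<^sub>F n in sequentially. 1 - q < N.prob (cball 0 (real n))"
    using std_normal_vec_ball_tendsto_1 q by (intro order_tendstoD(1)) auto
  then obtain n where n: "1 - q < N.prob (cball 0 (real n))" by (auto simp: eventually_sequentially)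
  \<comment> \<open>On the ball of radius \<open>n\<close> the displacement \<open>z / c\<close> is then shorter than \<open>d\<close>.\<close>
  define c where "c = (real n + 1) / d"
  have c: "c > 0" using d by (simp add: c_def)
  have fm: "f \<in> borel_measurable borel" using f by (rule borel_measurable_continuous_onI)
  have int: "integrable std_normal_vec (\<lambda>z. f (x + z /\<^sub>R c))" for x
    by (rule N.integrable_const_bound[where B=B])
       (use fm B in \<open>auto simp: measurable_cong_sets[OF sets_std_normal_vec refl]\<close>)
  let ?out = "UNIV - cball (0::real^'k) (real n)"
  have out: "N.prob ?out < q"
    using N.prob_compl[of "cball 0 (real n)"] n by simp
  have "\<bar>gaussian_smoothing c f x - f x\<bar> \<le> e" for x
  proof -
    have "gaussian_smoothing c f x - f x = (LINT z|std_normal_vec. f (x + z /\<^sub>R c) - f x)"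
      unfolding gaussian_smoothing_def
      by (subst Bochner_Integration.integral_diff[OF int]) (simp_all add: N.prob_space[simplified])
    also have "\<bar>\<dots>\<bar> \<le> (LINT z|std_normal_vec. \<bar>f (x + z /\<^sub>R c) - f x\<bar>)"
      using integral_norm_bound[of std_normal_vec "\<lambda>z. f (x + z /\<^sub>R c) - f x"] by simp
    also have "\<dots> \<le> (LINT z|std_normal_vec. e / 2 + 2 * B * indicator ?out z)"
    proof (rule integral_mono)
      fix z :: "real^'k"
      show "\<bar>f (x + z /\<^sub>R c) - f x\<bar> \<le> e / 2 + 2 * B * indicator ?out z"
      proof (cases "z \<in> ?out")
        case True
        then show ?thesis using B[of x] B[of "x + z /\<^sub>R c"] e by (auto simp: indicator_def)
      next
        case False
        then have "norm z \<le> real n" by simp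
        then have "norm ((x + z /\<^sub>R c) - x) < d"
          using c d(1) mult_strict_left_mono[of "norm z" "real n + 1" d] by (simp add: c_def field_simps)
        then show ?thesis using d(2)[of "x + z /\<^sub>R c" x] False by simp
      qed
    qed (use int in \<open>auto intro!: integrable_real_mult_indicator simp: N.emeasure_eq_measure\<close>)
    also have "\<dots> = e / 2 + 2 * B * N.prob ?out"
      by (subst Bochner_Integration.integral_add) (simp_all add: N.prob_space[simplified] N.emeasure_eq_measure)
    also have "\<dots> \<le> e / 2 + 2 * B * q" using out B0 by (intro add_left_mono mult_left_mono) auto
    also have "\<dots> \<le> e" using e B0 by (simp add: q_def field_simps)
    finally show ?thesis .
  qed
  then show ?thesis using c by (rule that[rotated])
qed

lemma compact_support_expectation_convergence:
  fixes \<mu> :: "nat \<Rightarrow> (real^'k) measure" and f :: "real^'k \<Rightarrow> real"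
  assumes p: "\<And>n. prob_space (\<mu> n)" and S [simp]: "\<And>n. sets (\<mu> n) = sets borel"
    and char: "\<And>t. (\<lambda>n. CLINT x|\<mu> n. iexp (t \<bullet> x)) \<longlonglongrightarrow> exp (- (norm t)\<^sup>2 / 2)"
    and f: "continuous_on UNIV f" and supp: "\<And>x. norm x > R \<Longrightarrow> f x = 0"
    and B: "\<And>x. \<bar>f x\<bar> \<le> B"
  shows "(\<lambda>n. LINT x|\<mu> n. f x) \<longlonglongrightarrow> (LINT x|std_normal_vec. f x)"
proof (rule LIMSEQ_I)
  fix e :: real assume "e > 0"
  then have e4: "e / 4 > 0" by simp
  obtain c where c: "c > 0" "\<And>x. \<bar>gaussian_smoothing c f x - f x\<bar> \<le> e / 4"
    using gaussian_smoothing_approximates[OF f supp e4 B] by blast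
  have fm [measurable]: "f \<in> borel_measurable borel" using f by (rule borel_measurable_continuous_onI)
  have "integrable lborel (\<lambda>x. indicator (cball 0 R) x *\<^sub>R f x)"
    by (rule borel_integrable_compact) (auto intro: continuous_on_subset[OF f])
  moreover have "(\<lambda>x. indicator (cball 0 R) x *\<^sub>R f x) = f"
    using supp by (auto simp: indicator_def not_le fun_eq_iff)
  ultimately have fi: "integrable lborel f" by simp
  have gm: "gaussian_smoothing c f \<in> borel_measurable borel"
  proof -
    interpret N: prob_space "std_normal_vec :: (real^'k) measure" by (rule std_normal_vec_prob_space)
    have sets: "sets (borel \<Otimes>\<^sub>M (std_normal_vec :: (real^'k) measure)) = sets (borel \<Otimes>\<^sub>M borel)"
      by (intro sets_pair_measure_cong) auto
    have "(\<lambda>(x, z). f (x + z /\<^sub>R c)) \<in> borel_measurable (borel \<Otimes>\<^sub>M std_normal_vec)"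
      unfolding measurable_cong_sets[OF sets refl] case_prod_beta' by measurable
    then show ?thesis unfolding gaussian_smoothing_def[abs_def] by (rule N.borel_measurable_lebesgue_integral)
  qed
  have close: "\<bar>(LINT x|\<nu>. gaussian_smoothing c f x) - (LINT x|\<nu>. f x)\<bar> \<le> e / 4"
    if "prob_space \<nu>" and \<nu>S: "sets \<nu> = sets borel" for \<nu> :: "(real^'k) measure"
  proof -
    interpret \<nu>: prob_space \<nu> by fact
    have i1: "integrable \<nu> f"
      by (rule \<nu>.integrable_const_bound[where B=B]) (use B in \<open>auto simp: measurable_cong_sets[OF \<nu>S refl]\<close>)
    have "\<bar>gaussian_smoothing c f x\<bar> \<le> B + e / 4" for x using c(2)[of x] B[of x] by linarith
    then have i2: "integrable \<nu> (gaussian_smoothing c f)"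
      by (intro \<nu>.integrable_const_bound[where B="B + e/4"])
         (use gm in \<open>auto simp: measurable_cong_sets[OF \<nu>S refl]\<close>)
    have "\<bar>LINT x|\<nu>. gaussian_smoothing c f x - f x\<bar> \<le> (LINT x|\<nu>. \<bar>gaussian_smoothing c f x - f x\<bar>)"
      using integral_norm_bound[of \<nu> "\<lambda>x. gaussian_smoothing c f x - f x"] by simp
    also have "\<dots> \<le> (LINT x|\<nu>. e / 4)"
      using i1 i2 c(2) by (intro integral_mono) auto
    finally show ?thesis by (simp add: Bochner_Integration.integral_diff[OF i2 i1] \<nu>.prob_space)
  qed
  obtain n0 where n0: "\<And>n. n \<ge> n0 \<Longrightarrow>
      norm ((LINT x|\<mu> n. gaussian_smoothing c f x) - (LINT x|std_normal_vec. gaussian_smoothing c f x)) < e / 4"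
    using LIMSEQ_D[OF gaussian_smoothing_convergence[OF p S char fi c(1)], of "e / 4"] \<open>e > 0\<close> by auto
  have "norm ((LINT x|\<mu> n. f x) - (LINT x|std_normal_vec. f x)) < e" if "n \<ge> n0" for n
    using n0[OF that] close[OF p S, of n] close[OF std_normal_vec_prob_space sets_std_normal_vec] \<open>e > 0\<close>
    unfolding real_norm_def by linarith
  then show "\<exists>n0. \<forall>n\<ge>n0. norm ((LINT x|\<mu> n. f x) - (LINT x|std_normal_vec. f x)) < e" by blast
qed

text \<open>
  Levy's continuity theorem for the standard normal limit.  Convergence for compactly
  supported functions, applied to a cutoff that is almost \<open>1\<close> under the normal law, shows that no mass
  escapes to infinity; the same cutoff then extends the convergence to bounded functions.
\<close>

theorem weak_conv_std_normal_vecI: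
  fixes \<mu> :: "nat \<Rightarrow> (real^'k) measure"
  assumes p: "\<And>n. prob_space (\<mu> n)" and S [simp]: "\<And>n. sets (\<mu> n) = sets borel"
    and char: "\<And>t. (\<lambda>n. CLINT x|\<mu> n. iexp (t \<bullet> x)) \<longlonglongrightarrow> exp (- (norm t)\<^sup>2 / 2)"
  shows "weak_conv_vec \<mu> std_normal_vec"
  unfolding weak_conv_vec_def
proof (intro allI impI, elim conjE)
  fix f :: "real^'k \<Rightarrow> real" assume f: "continuous_on UNIV f" and "bounded (range f)"
  then obtain B where B: "B > 0" "\<And>x. \<bar>f x\<bar> \<le> B"
    by (auto simp: bounded_pos)
  interpret N: prob_space "std_normal_vec :: (real^'k) measure" by (rule std_normal_vec_prob_space)
  show "(\<lambda>n. LINT x|\<mu> n. f x) \<longlonglongrightarrow> (LINT x|std_normal_vec. f x)"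
  proof (rule LIMSEQ_I)
    fix e :: real assume e: "e > 0"
    define q where "q = e / (4 * B)"
    have q: "q > 0" using e B by (simp add: q_def)
    have "\<forall>\<^sub>F n in sequentially. 1 - q < N.prob (cball 0 (real n))"
      using std_normal_vec_ball_tendsto_1 q by (intro order_tendstoD(1)) auto
    then obtain R where R: "1 - q < N.prob (cball 0 (real R))" by (auto simp: eventually_sequentially)
    define w where "w = (\<lambda>x :: real^'k. max 0 (min 1 (real R + 1 - norm x)))"
    have wc: "continuous_on UNIV w" unfolding w_def by (intro continuous_intros)
    have wb: "0 \<le> w x" "w x \<le> 1" for x by (auto simp: w_def)
    have w0: "norm x > real R + 1 \<Longrightarrow> w x = 0" for x by (auto simp: w_def)
    have fwc: "continuous_on UNIV (\<lambda>x. f x * w x)" using f wc by (intro continuous_intros)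
    have lim1: "(\<lambda>n. LINT x|\<mu> n. w x) \<longlonglongrightarrow> (LINT x|std_normal_vec. w x)"
      by (rule compact_support_expectation_convergence[OF p S char wc w0, where B=1]) (use wb in auto)
    have fB: "\<bar>f x * w x\<bar> \<le> B" for x
      using mult_mono[OF B(2)[of x] wb(2)[of x]] wb(1)[of x] B(1) by (simp add: abs_mult)
    have lim2: "(\<lambda>n. LINT x|\<mu> n. f x * w x) \<longlonglongrightarrow> (LINT x|std_normal_vec. f x * w x)"
      by (rule compact_support_expectation_convergence[OF p S char fwc _ fB]) (use w0 in auto)
    have fm: "f \<in> borel_measurable borel" and wm: "w \<in> borel_measurable borel"
      using f wc by (auto intro: borel_measurable_continuous_onI)
    have cut: "\<bar>(LINT x|\<nu>. f x) - (LINT x|\<nu>. f x * w x)\<bar> \<le> B * (1 - (LINT x|\<nu>. w x))"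
      and intw: "integrable \<nu> w"
      if "prob_space \<nu>" and \<nu>S: "sets \<nu> = sets borel" for \<nu> :: "(real^'k) measure"
    proof -
      interpret \<nu>: prob_space \<nu> by fact
      note m = measurable_cong_sets[OF \<nu>S refl]
      have i1: "integrable \<nu> f"
        by (rule \<nu>.integrable_const_bound[where B=B]) (use B fm in \<open>auto simp: m\<close>)
      show i2: "integrable \<nu> w"
        by (rule \<nu>.integrable_const_bound[where B=1]) (use wb wm in \<open>auto simp: m\<close>)
      have i3: "integrable \<nu> (\<lambda>x. f x * w x)"
        by (rule \<nu>.integrable_const_bound[where B=B]) (use fB wm fm in \<open>auto simp: m\<close>)
      have "\<bar>LINT x|\<nu>. f x - f x * w x\<bar> \<le> (LINT x|\<nu>. \<bar>f x - f x * w x\<bar>)"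
        using integral_norm_bound[of \<nu> "\<lambda>x. f x - f x * w x"] by simp
      also have "\<dots> \<le> (LINT x|\<nu>. B * (1 - w x))"
      proof (intro integral_mono)
        fix x
        have "\<bar>f x - f x * w x\<bar> = \<bar>f x\<bar> * (1 - w x)"
          using wb(2)[of x] abs_mult[of "f x" "1 - w x"] by (simp add: right_diff_distrib)
        also have "\<dots> \<le> B * (1 - w x)" using B wb(2)[of x] by (intro mult_right_mono) auto
        finally show "\<bar>f x - f x * w x\<bar> \<le> B * (1 - w x)" .
      qed (use i1 i2 i3 in auto)
      also have "\<dots> = B * (1 - (LINT x|\<nu>. w x))"
        using i2 by (simp add: \<nu>.prob_space)
      finally show "\<bar>(LINT x|\<nu>. f x) - (LINT x|\<nu>. f x * w x)\<bar> \<le> B * (1 - (LINT x|\<nu>. w x))"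
        using i1 i3 by simp
    qed
    have "N.prob (cball 0 (real R)) = (LINT x|std_normal_vec. indicator (cball (0::real^'k) (real R)) x)"
      by simp
    also have "\<dots> \<le> (LINT x|std_normal_vec. w x)"
      using intw[OF std_normal_vec_prob_space sets_std_normal_vec]
      by (intro integral_mono integrable_real_indicator) (auto simp: w_def indicator_def N.emeasure_eq_measure)
    finally have Nw: "1 - q < (LINT x|std_normal_vec. w x)" using R by linarith
    have "\<forall>\<^sub>F n in sequentially. 1 - q < (LINT x|\<mu> n. w x)"
      using lim1 Nw by (rule order_tendstoD(1))
    moreover have "\<forall>\<^sub>F n in sequentially. dist (LINT x|\<mu> n. f x * w x) (LINT x|std_normal_vec. f x * w x) < e / 4"
      using lim2 e by (intro tendstoD) auto
    ultimately have "\<forall>\<^sub>F n in sequentially. norm ((LINT x|\<mu> n. f x) - (LINT x|std_normal_vec. f x)) < e"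
    proof eventually_elim
      case (elim n)
      have Bq: "B * q = e / 4" using B by (simp add: q_def)
      have "\<bar>(LINT x|\<mu> n. f x) - (LINT x|\<mu> n. f x * w x)\<bar> \<le> B * q"
        using elim(1) B by (intro order.trans[OF cut[OF p S]] mult_left_mono) auto
      moreover have "\<bar>(LINT x|std_normal_vec. f x) - (LINT x|std_normal_vec. f x * w x)\<bar> \<le> B * q"
        using Nw B by (intro order.trans[OF cut[OF std_normal_vec_prob_space sets_std_normal_vec]] mult_left_mono) auto
      ultimately show ?case using elim(2) e unfolding Bq dist_real_def real_norm_def by linarith
    qed
    then show "\<exists>n0. \<forall>n\<ge>n0. norm ((LINT x|\<mu> n. f x) - (LINT x|std_normal_vec. f x)) < e"
      by (simp add: eventually_sequentially)
  qed
qed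

section \<open>Weighted sums of independent Bernoulli variables\<close>

text \<open>
  The first-order terms cancel because the variable is centred, and the second-order term is the
  variance.
\<close>

lemma bernoulli_char_taylor:
  fixes c m :: real
  assumes m: "0 \<le> m" "m \<le> 1"
  shows "cmod (m * iexp (c * (1 - m)) + (1 - m) * iexp (- (c * m)) - (1 - c\<^sup>2 * (m * (1 - m)) / 2)) \<le> \<bar>c\<bar> ^ 3 / 6"
proof -
  have ap: "cmod (iexp x - (1 + \<i> * x - x\<^sup>2 / 2)) \<le> \<bar>x\<bar> ^ 3 / 6" for x :: real
    using iexp_approx1[of x 2] by (simp add: atMost_nat_numeral eval_nat_numeral power2_eq_square algebra_simps)
  have small: "\<bar>x\<bar> ^ 3 / 6 \<le> \<bar>c\<bar> ^ 3 / 6" if "\<bar>x\<bar> \<le> \<bar>c\<bar>" for x :: real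
    using power_mono[OF that, of 3] by simp
  define r1 where "r1 = iexp (c * (1 - m)) - (1 + \<i> * (c * (1 - m)) - (c * (1 - m))\<^sup>2 / 2)"
  define r2 where "r2 = iexp (- (c * m)) - (1 + \<i> * (- (c * m)) - (- (c * m))\<^sup>2 / 2)"
  have r1: "cmod r1 \<le> \<bar>c\<bar> ^ 3 / 6"
    unfolding r1_def
  proof (rule order.trans[OF ap small])
    show "\<bar>c * (1 - m)\<bar> \<le> \<bar>c\<bar>" using m by (simp add: abs_mult mult_left_le)
  qed
  have r2: "cmod r2 \<le> \<bar>c\<bar> ^ 3 / 6"
    unfolding r2_def
  proof (rule order.trans[OF ap small])
    show "\<bar>- (c * m)\<bar> \<le> \<bar>c\<bar>" using m by (simp add: abs_mult mult_left_le)
  qed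
  have "m * iexp (c * (1 - m)) + (1 - m) * iexp (- (c * m)) - (1 - c\<^sup>2 * (m * (1 - m)) / 2)
      = m * r1 + (1 - m) * r2"
    unfolding r1_def r2_def by (simp add: algebra_simps power2_eq_square add_divide_distrib diff_divide_distrib)
  also have "cmod \<dots> \<le> m * cmod r1 + (1 - m) * cmod r2"
  proof -
    have "cmod (1 - complex_of_real m) = 1 - m"
      using m norm_of_real[of "1 - m", where 'a=complex] by simp
    then show ?thesis
      using m norm_triangle_ineq[of "m * r1" "(1 - m) * r2"] by (simp add: norm_mult)
  qed
  also have "\<dots> \<le> m * (\<bar>c\<bar> ^ 3 / 6) + (1 - m) * (\<bar>c\<bar> ^ 3 / 6)"
    using r1 r2 m by (intro add_mono mult_left_mono) auto
  also have "m * x + (1 - m) * x = x" for x by (simp add: left_diff_distrib)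
  finally show ?thesis .
qed

lemma exp_minus_quadratic: assumes "(0::real) \<le> s" shows "\<bar>exp (- s) - (1 - s)\<bar> \<le> s\<^sup>2 / 2"
proof -
  have "1 - s \<le> exp (- s)" using exp_ge_add_one_self[of "- s"] by simp
  moreover have "exp (- s) \<le> 1 - s + s\<^sup>2 / 2"
  proof -
    have "exp (- s) \<le> 1 / (1 + s + s\<^sup>2 / 2)"
    proof -
      have "0 < 1 + s + s\<^sup>2 / 2" using assms by (simp add: add_pos_nonneg)
      then have "1 / exp s \<le> 1 / (1 + s + s\<^sup>2 / 2)"
        using exp_lower_Taylor_quadratic[OF assms] by (intro divide_left_mono) (auto simp: mult_pos_pos)
      then show ?thesis by (simp add: exp_minus inverse_eq_divide)
    qed
    also have "\<dots> \<le> 1 - s + s\<^sup>2 / 2"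
    proof -
      have "1 \<le> (1 - s + s\<^sup>2 / 2) * (1 + s + s\<^sup>2 / 2)"
        using assms by (simp add: algebra_simps power2_eq_square)
      then show ?thesis using assms by (simp add: divide_le_eq add_pos_nonneg)
    qed
    finally show ?thesis .
  qed
  ultimately show ?thesis by simp
qed

lemma (in prob_space) expectation_bool_fun:
  fixes g :: "bool \<Rightarrow> 'c::{banach, second_countable_topology}"
  assumes [measurable]: "B \<in> measurable M (count_space UNIV)"
  shows "expectation (\<lambda>\<omega>. g (B \<omega>)) = prob {\<omega>\<in>space M. B \<omega>} *\<^sub>R g True + (1 - prob {\<omega>\<in>space M. B \<omega>}) *\<^sub>R g False"
    and "integrable M (\<lambda>\<omega>. g (B \<omega>))"
proof -
  let ?T = "{\<omega>\<in>space M. B \<omega>}"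
  have eq: "g (B \<omega>) = indicator ?T \<omega> *\<^sub>R g True + indicator (space M - ?T) \<omega> *\<^sub>R g False" if "\<omega> \<in> space M" for \<omega>
    using that by (cases "B \<omega>") auto
  have "integrable M (\<lambda>\<omega>. g (B \<omega>)) \<longleftrightarrow> integrable M (\<lambda>\<omega>. indicator ?T \<omega> *\<^sub>R g True + indicator (space M - ?T) \<omega> *\<^sub>R g False)"
    by (intro Bochner_Integration.integrable_cong refl eq)
  then show "integrable M (\<lambda>\<omega>. g (B \<omega>))" by (simp add: emeasure_eq_measure)
  have "expectation (\<lambda>\<omega>. g (B \<omega>)) = (LINT \<omega>|M. indicator ?T \<omega> *\<^sub>R g True + indicator (space M - ?T) \<omega> *\<^sub>R g False)"
    by (intro Bochner_Integration.integral_cong refl eq)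
  also have "\<dots> = prob ?T *\<^sub>R g True + prob (space M - ?T) *\<^sub>R g False"
    by (subst Bochner_Integration.integral_add) (auto simp: emeasure_eq_measure)
  finally show "expectation (\<lambda>\<omega>. g (B \<omega>)) = prob ?T *\<^sub>R g True + (1 - prob ?T) *\<^sub>R g False"
    by (simp add: prob_compl)
qed

text \<open>
  Each factor of the characteristic function agrees with the Gaussian factor of the same variance up to
  \<open>|c\<^sub>e|\<^sup>3\<close>, and a difference of products of numbers in the unit disc is at most the sum of the differences.
\<close>

lemma (in prob_space) bernoulli_sum_char:
  fixes B :: "'e \<Rightarrow> 'a \<Rightarrow> bool" and c m :: "'e \<Rightarrow> real"
  assumes fin: "finite E" and ind: "indep_vars (\<lambda>_. count_space UNIV) B E"
    and m: "\<And>e. e \<in> E \<Longrightarrow> prob {\<omega>\<in>space M. B e \<omega>} = m e" and c: "\<And>e. e \<in> E \<Longrightarrow> \<bar>c e\<bar> \<le> 1"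
  shows "cmod ((CLINT \<omega>|M. iexp (\<Sum>e\<in>E. c e * (of_bool (B e \<omega>) - m e)))
      - exp (- (\<Sum>e\<in>E. (c e)\<^sup>2 * (m e * (1 - m e))) / 2)) \<le> (\<Sum>e\<in>E. \<bar>c e\<bar> ^ 3)"
proof -
  have Bm: "B e \<in> measurable M (count_space UNIV)" if "e \<in> E" for e
    using ind that by (auto simp: indep_vars_def)
  define Z where "Z = (\<lambda>e \<omega>. iexp (c e * (of_bool (B e \<omega>) - m e)))"
  define z where "z = (\<lambda>e. CLINT \<omega>|M. Z e \<omega>)"
  define w where "w = (\<lambda>e. complex_of_real (exp (- ((c e)\<^sup>2 * (m e * (1 - m e)) / 2))))"
  have Zint: "integrable M (Z e)" if "e \<in> E" for e
    unfolding Z_def using expectation_bool_fun(2)[OF Bm[OF that]] .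
  have m01: "0 \<le> m e" "m e \<le> 1" if "e \<in> E" for e using m[OF that, symmetric] by auto
  have ze: "z e = m e * iexp (c e * (1 - m e)) + (1 - m e) * iexp (- (c e * m e))" if "e \<in> E" for e
    unfolding z_def Z_def
    using expectation_bool_fun(1)[OF Bm[OF that], of "\<lambda>b. iexp (c e * (of_bool b - m e))"] m[OF that]
    by (simp add: scaleR_conv_of_real)
  have "(CLINT \<omega>|M. iexp (\<Sum>e\<in>E. c e * (of_bool (B e \<omega>) - m e))) = (CLINT \<omega>|M. (\<Prod>e\<in>E. Z e \<omega>))"
    unfolding Z_def using fin by (simp add: sum_distrib_left exp_sum)
  also have "\<dots> = (\<Prod>e\<in>E. z e)"
    unfolding z_def
  proof (rule indep_vars_lebesgue_integral[OF fin _ Zint])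
    show "indep_vars (\<lambda>_. borel) Z E"
      unfolding Z_def by (rule indep_vars_compose2[OF ind]) simp
  qed
  finally have 1: "(CLINT \<omega>|M. iexp (\<Sum>e\<in>E. c e * (of_bool (B e \<omega>) - m e))) = (\<Prod>e\<in>E. z e)" .
  have 2: "complex_of_real (exp (- (\<Sum>e\<in>E. (c e)\<^sup>2 * (m e * (1 - m e))) / 2)) = (\<Prod>e\<in>E. w e)"
    unfolding w_def using fin by (simp add: exp_sum sum_divide_distrib flip: of_real_prod sum_negf)
  have "cmod ((\<Prod>e\<in>E. z e) - (\<Prod>e\<in>E. w e)) \<le> (\<Sum>e\<in>E. cmod (z e - w e))"
  proof (rule norm_prod_diff)
    fix e assume e: "e \<in> E"
    have "cmod (z e) \<le> (LINT \<omega>|M. cmod (Z e \<omega>))" unfolding z_def by (rule integral_norm_bound)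
    then show "cmod (z e) \<le> 1" by (simp add: Z_def prob_space)
    show "cmod (w e) \<le> 1" using m01[OF e] by (simp add: w_def)
  qed
  also have "\<dots> \<le> (\<Sum>e\<in>E. \<bar>c e\<bar> ^ 3)"
  proof (rule sum_mono)
    fix e assume e: "e \<in> E"
    define s where "s = (c e)\<^sup>2 * (m e * (1 - m e)) / 2"
    have mm: "0 \<le> m e * (1 - m e)" "m e * (1 - m e) \<le> 1 / 4"
      using m01[OF e] zero_le_power2[of "m e - 1/2"]
      by (simp, simp add: power2_eq_square algebra_simps)
    have s: "0 \<le> s" "s \<le> (c e)\<^sup>2 / 8"
      unfolding s_def using mult_nonneg_nonneg[OF zero_le_power2 mm(1), of "c e"]
        mult_left_mono[OF mm(2) zero_le_power2, of "c e"] by linarith+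
    have "cmod (z e - complex_of_real (1 - s)) \<le> \<bar>c e\<bar> ^ 3 / 6"
      using bernoulli_char_taylor[OF m01[OF e], of "c e"] unfolding ze[OF e] s_def by simp
    moreover have "cmod (complex_of_real (1 - s) - w e) \<le> \<bar>c e\<bar> ^ 3 / 128"
    proof -
      have "cmod (complex_of_real (1 - s) - w e) = \<bar>(1 - s) - exp (- s)\<bar>"
        unfolding w_def s_def[symmetric] of_real_diff[symmetric] norm_of_real ..
      also have "\<dots> \<le> s\<^sup>2 / 2" using exp_minus_quadratic[OF s(1)] by (simp add: abs_minus_commute)
      also have "\<dots> \<le> ((c e)\<^sup>2 / 8)\<^sup>2 / 2" using s by (intro divide_right_mono power_mono) auto
      also have "\<dots> = \<bar>c e\<bar> ^ 3 * \<bar>c e\<bar> / 128"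
      proof -
        have "(a\<^sup>2 / 8)\<^sup>2 / 2 = a ^ 3 * a / 128" for a :: real
          by (simp add: power2_eq_square power3_eq_cube)
        from this[of "\<bar>c e\<bar>"] show ?thesis by simp
      qed
      also have "\<dots> \<le> \<bar>c e\<bar> ^ 3 * 1 / 128"
        using c[OF e] by (intro divide_right_mono mult_left_mono) auto
      finally show ?thesis by simp
    qed
    ultimately have "cmod (z e - w e) \<le> \<bar>c e\<bar> ^ 3 / 6 + \<bar>c e\<bar> ^ 3 / 128"
      using norm_triangle_ineq[of "z e - complex_of_real (1 - s)" "complex_of_real (1 - s) - w e"] by simp
    also have "\<dots> \<le> \<bar>c e\<bar> ^ 3" using zero_le_power[of "\<bar>c e\<bar>" 3] by simp
    finally show "cmod (z e - w e) \<le> \<bar>c e\<bar> ^ 3" .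
  qed
  finally show ?thesis unfolding 1 2 .
qed

lemma (in prob_space) bernoulli_sum_hoeffding:
  fixes B :: "'e \<Rightarrow> 'a \<Rightarrow> bool" and c m :: "'e \<Rightarrow> real"
  assumes fin: "finite E" and ind: "indep_vars (\<lambda>_. count_space UNIV) B E"
    and m: "\<And>e. e \<in> E \<Longrightarrow> prob {\<omega>\<in>space M. B e \<omega>} = m e"
    and t: "t > 0" and V: "(\<Sum>e\<in>E. (c e)\<^sup>2) \<le> V"
  shows "prob {\<omega>\<in>space M. t \<le> \<bar>\<Sum>e\<in>E. c e * (of_bool (B e \<omega>) - m e)\<bar>} \<le> 2 * exp (- 2 * t\<^sup>2 / V)"
proof (cases "(\<Sum>e\<in>E. (c e)\<^sup>2) > 0")
  case False
  then have "(\<Sum>e\<in>E. (c e)\<^sup>2) = 0" using sum_nonneg[of E "\<lambda>e. (c e)\<^sup>2"] by simp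
  then have "c e = 0" if "e \<in> E" for e using fin that by (subst (asm) sum_nonneg_eq_0_iff) auto
  then have *: "{\<omega>\<in>space M. t \<le> \<bar>\<Sum>e\<in>E. c e * (of_bool (B e \<omega>) - m e)\<bar>} = {}"
    using t by (simp add: sum.neutral)
  show ?thesis unfolding * by simp
next
  case True
  have Bm: "B e \<in> measurable M (count_space UNIV)" if "e \<in> E" for e
    using ind that by (auto simp: indep_vars_def)
  define X where "X = (\<lambda>e \<omega>. c e * of_bool (B e \<omega>))"
  interpret Hoeffding_ineq M E X "\<lambda>e. min 0 (c e)" "\<lambda>e. max 0 (c e)" "\<Sum>e\<in>E. expectation (X e)"
  proof unfold_locales
    show "indep_vars (\<lambda>_. borel) X E"
      unfolding X_def by (rule indep_vars_compose2[OF ind]) simp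
  qed (auto simp: fin X_def intro!: AE_I2)
  have EX: "expectation (X e) = c e * m e" if "e \<in> E" for e
    unfolding X_def using expectation_bool_fun(1)[OF Bm[OF that], of "\<lambda>b. c e * of_bool b"] m[OF that] by simp
  have EXs: "(\<Sum>e\<in>E. expectation (X e)) = (\<Sum>e\<in>E. c e * m e)" by (intro sum.cong refl EX)
  have sq: "(max 0 x - min 0 x)\<^sup>2 = x\<^sup>2" for x :: real by (simp add: max_def min_def)
  have "prob {\<omega>\<in>space M. t \<le> \<bar>\<Sum>e\<in>E. c e * (of_bool (B e \<omega>) - m e)\<bar>}
      = prob {\<omega>\<in>space M. \<bar>(\<Sum>e\<in>E. X e \<omega>) - (\<Sum>e\<in>E. expectation (X e))\<bar> \<ge> t}"
    unfolding EXs by (simp add: X_def right_diff_distrib sum_subtractf)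
  also have "\<dots> \<le> 2 * exp (- 2 * t\<^sup>2 / (\<Sum>e\<in>E. (c e)\<^sup>2))"
    using Hoeffding_ineq_abs_ge[of t] t True by (simp add: sq)
  also have "\<dots> \<le> 2 * exp (- 2 * t\<^sup>2 / V)"
  proof -
    have "2 * t\<^sup>2 / V \<le> 2 * t\<^sup>2 / (\<Sum>e\<in>E. (c e)\<^sup>2)"
      using True V by (intro divide_left_mono mult_pos_pos) auto
    then show ?thesis by simp
  qed
  finally show ?thesis .
qed

section \<open>Entries of the flipped graph\<close>

text \<open>
  An entry of the flipped matrix is a function of the original entry and of the event that it is kept,
  and these pairs occupy disjoint blocks of the independent family.
\<close>

lemma flipped_entries_indep:
  assumes M: "prob_space M" and flip: "edge_flip M n p a a'"
  shows "prob_space.indep_vars M (\<lambda>_. count_space UNIV) (\<lambda>(i, j). a' i j) (node_pairs n)"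
proof -
  interpret prob_space M by fact
  let ?X = "\<lambda>e \<omega>. case e of Inl (i, j) \<Rightarrow> a i j \<omega> | Inr (i, j) \<Rightarrow> (a' i j \<omega> \<longleftrightarrow> a i j \<omega>)"
  let ?K = "\<lambda>e. {Inl e, Inr e} :: ((nat \<times> nat) + (nat \<times> nat)) set"
  have "indep_vars (\<lambda>_. count_space UNIV) ?X (node_pairs n <+> node_pairs n)"
    using flip by (simp add: edge_flip_def)
  then have "indep_vars (\<lambda>e. PiM (?K e) (\<lambda>_. count_space UNIV)) (\<lambda>e \<omega>. restrict (\<lambda>i. ?X i \<omega>) (?K e)) (node_pairs n)"
    by (rule indep_vars_restrict) (auto simp: disjoint_family_on_def)
  then have "indep_vars (\<lambda>_. count_space UNIV)
      (\<lambda>e \<omega>. (\<lambda>f. f (Inl e) \<longleftrightarrow> f (Inr e)) (restrict (\<lambda>i. ?X i \<omega>) (?K e))) (node_pairs n)"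
    by (rule indep_vars_compose2) measurable
  moreover have "(\<lambda>e \<omega>. (\<lambda>f. f (Inl e) \<longleftrightarrow> f (Inr e)) (restrict (\<lambda>i. ?X i \<omega>) (?K e))) = (\<lambda>(i, j). a' i j)"
    by (auto simp: fun_eq_iff)
  ultimately show ?thesis by simp
qed

lemma flipped_entry_prob:
  assumes M: "prob_space M" and model: "p0_model M n \<theta> a" and flip: "edge_flip M n p a a'"
    and ij: "(i, j) \<in> node_pairs n"
  shows "measure M {\<omega>\<in>space M. a' i j \<omega>} = (p * edge_exp n \<theta> i j + (1 - p)) / (1 + edge_exp n \<theta> i j)"
proof -
  interpret prob_space M by fact
  define l where "l = edge_exp n \<theta> i j / (1 + edge_exp n \<theta> i j)"
  let ?X = "\<lambda>e \<omega>. case e of Inl (i, j) \<Rightarrow> a i j \<omega> | Inr (i, j) \<Rightarrow> (a' i j \<omega> \<longleftrightarrow> a i j \<omega>)"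
  let ?J = "{Inl (i, j), Inr (i, j)} :: ((nat \<times> nat) + (nat \<times> nat)) set"
  have ind: "indep_vars (\<lambda>_. count_space UNIV) ?X (node_pairs n <+> node_pairs n)"
    using flip by (simp add: edge_flip_def)
  have prod: "prob {\<omega>\<in>space M. a i j \<omega> = b \<and> (a' i j \<omega> \<longleftrightarrow> a i j \<omega>) = c}
      = prob {\<omega>\<in>space M. a i j \<omega> = b} * prob {\<omega>\<in>space M. (a' i j \<omega> \<longleftrightarrow> a i j \<omega>) = c}" for b c
  proof -
    have "prob (\<Inter>e\<in>?J. ?X e -` (case e of Inl _ \<Rightarrow> {b} | Inr _ \<Rightarrow> {c}) \<inter> space M)
        = (\<Prod>e\<in>?J. prob (?X e -` (case e of Inl _ \<Rightarrow> {b} | Inr _ \<Rightarrow> {c}) \<inter> space M))"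
      using ij by (intro indep_varsD[OF ind]) auto
    moreover have "(\<Inter>e\<in>?J. ?X e -` (case e of Inl _ \<Rightarrow> {b} | Inr _ \<Rightarrow> {c}) \<inter> space M)
        = {\<omega>\<in>space M. a i j \<omega> = b \<and> (a' i j \<omega> \<longleftrightarrow> a i j \<omega>) = c}" by auto
    moreover have "?X (Inl (i, j)) -` {b} \<inter> space M = {\<omega>\<in>space M. a i j \<omega> = b}"
      "?X (Inr (i, j)) -` {c} \<inter> space M = {\<omega>\<in>space M. (a' i j \<omega> \<longleftrightarrow> a i j \<omega>) = c}" by auto
    ultimately show ?thesis by simp
  qed
  have meas: "?X e \<in> measurable M (count_space UNIV)" if "e \<in> node_pairs n <+> node_pairs n" for e
    using ind that unfolding indep_vars_def by blast
  have [measurable]: "a i j \<in> measurable M (count_space UNIV)" using meas[of "Inl (i, j)"] ij by auto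
  have k [measurable]: "(\<lambda>\<omega>. a' i j \<omega> \<longleftrightarrow> a i j \<omega>) \<in> measurable M (count_space UNIV)"
    using meas[of "Inr (i, j)"] ij by auto
  have "(\<lambda>\<omega>. (a' i j \<omega> \<longleftrightarrow> a i j \<omega>) \<longleftrightarrow> a i j \<omega>) \<in> measurable M (count_space UNIV)" by measurable
  moreover have "(\<lambda>\<omega>. (a' i j \<omega> \<longleftrightarrow> a i j \<omega>) \<longleftrightarrow> a i j \<omega>) = a' i j" by (auto simp: fun_eq_iff)
  ultimately have [measurable]: "a' i j \<in> measurable M (count_space UNIV)" by (simp only:)
  have l: "prob {\<omega>\<in>space M. a i j \<omega>} = l" using model ij by (auto simp: p0_model_def l_def)
  have p: "prob {\<omega>\<in>space M. a' i j \<omega> \<longleftrightarrow> a i j \<omega>} = p" using flip ij by (auto simp: edge_flip_def)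
  have l': "prob {\<omega>\<in>space M. \<not> a i j \<omega>} = 1 - l" using l by (subst prob_neg) auto
  have p': "prob {\<omega>\<in>space M. \<not> (a' i j \<omega> \<longleftrightarrow> a i j \<omega>)} = 1 - p" using p by (subst prob_neg) auto
  have "{\<omega>\<in>space M. a' i j \<omega>} = {\<omega>\<in>space M. a i j \<omega> = True \<and> (a' i j \<omega> \<longleftrightarrow> a i j \<omega>) = True}
      \<union> {\<omega>\<in>space M. a i j \<omega> = False \<and> (a' i j \<omega> \<longleftrightarrow> a i j \<omega>) = False}" by auto
  then have "prob {\<omega>\<in>space M. a' i j \<omega>} = prob {\<omega>\<in>space M. a i j \<omega> = True \<and> (a' i j \<omega> \<longleftrightarrow> a i j \<omega>) = True}
      + prob {\<omega>\<in>space M. a i j \<omega> = False \<and> (a' i j \<omega> \<longleftrightarrow> a i j \<omega>) = False}"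
    by (simp only:) (rule finite_measure_Union; auto)
  also have "\<dots> = l * p + (1 - l) * (1 - p)"
    unfolding prod using l p l' p' by simp
  also have "\<dots> = (p * edge_exp n \<theta> i j + (1 - p)) / (1 + edge_exp n \<theta> i j)"
  proof -
    have "1 + edge_exp n \<theta> i j > 0" by (simp add: edge_exp_def add_pos_pos)
    then have "1 - l = 1 / (1 + edge_exp n \<theta> i j)" by (simp add: l_def field_simps)
    then show ?thesis by (simp add: l_def add_divide_distrib mult.commute)
  qed
  finally show ?thesis .
qed

section \<open>The moment equations as a logistic system\<close>

definition logit :: "nat \<Rightarrow> (nat \<Rightarrow> real) \<Rightarrow> nat \<Rightarrow> nat \<Rightarrow> real" where
  "logit n \<theta> i j = out_par \<theta> i + in_par n \<theta> j"

definition edge_mean :: "nat \<Rightarrow> real \<Rightarrow> (nat \<Rightarrow> real) \<Rightarrow> nat \<Rightarrow> nat \<Rightarrow> real" where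
  "edge_mean n p \<theta> i j = (p * edge_exp n \<theta> i j + (1 - p)) / (1 + edge_exp n \<theta> i j)"

lemma edge_exp_logit: "edge_exp n \<theta> i j = exp (logit n \<theta> i j)"
  by (simp add: edge_exp_def logit_def)

lemma edge_mean_logistic: "edge_mean n p \<theta> i j = (1 - p) + (2 * p - 1) * logistic (logit n \<theta> i j)"
  by (simp add: edge_mean_def edge_exp_logit logistic_def divide_simps) (simp add: algebra_simps)

lemma v_diag_out: "i \<le> n \<Longrightarrow> v_diag n p \<theta> i = (2 * p - 1) * (\<Sum>j\<in>{1..n} - {i}. logistic' (logit n \<theta> i j))"
  by (simp add: v_diag_def edge_exp_logit logistic'_def sum_distrib_left)

lemma v_diag_in: "j \<ge> 1 \<Longrightarrow> v_diag n p \<theta> (n + j) = (2 * p - 1) * (\<Sum>i\<in>{1..n} - {j}. logistic' (logit n \<theta> i j))"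
  by (simp add: v_diag_def edge_exp_logit logistic'_def sum_distrib_left)

lemma edge_variance:
  "(p * edge_exp n \<theta> i j + 1 - p) * ((1 - p) * edge_exp n \<theta> i j + p) / (1 + edge_exp n \<theta> i j)\<^sup>2
    = edge_mean n p \<theta> i j * (1 - edge_mean n p \<theta> i j)"
proof -
  have "1 + edge_exp n \<theta> i j \<noteq> 0" by (simp add: edge_exp_logit)
  then have "1 - edge_mean n p \<theta> i j = ((1 - p) * edge_exp n \<theta> i j + p) / (1 + edge_exp n \<theta> i j)"
    by (simp add: edge_mean_def field_simps)
  then show ?thesis by (simp add: edge_mean_def power2_eq_square add_diff_eq)
qed

lemma sigma_sq_out: "i \<le> n \<Longrightarrow> sigma_sq n p \<theta> i = (\<Sum>j\<in>{1..n} - {i}. edge_mean n p \<theta> i j * (1 - edge_mean n p \<theta> i j))"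
  by (simp add: sigma_sq_def edge_variance)

lemma sigma_sq_in: "j \<ge> 1 \<Longrightarrow> sigma_sq n p \<theta> (n + j) = (\<Sum>i\<in>{1..n} - {j}. edge_mean n p \<theta> i j * (1 - edge_mean n p \<theta> i j))"
  by (simp add: sigma_sq_def edge_variance)

text \<open>
  The difference is \<open>q\<^sup>2\<close> times the variance of the entry before flipping: flipping alone already
  contributes \<open>p (1 - p)\<close>.
\<close>

lemma edge_variance_ge: assumes "0 \<le> p" "p \<le> 1"
  shows "p * (1 - p) \<le> edge_mean n p \<theta> i j * (1 - edge_mean n p \<theta> i j)"
proof -
  define l where "l = logistic (logit n \<theta> i j)"
  have "edge_mean n p \<theta> i j * (1 - edge_mean n p \<theta> i j) - p * (1 - p) = (l * (1 - l)) * (2 * p - 1)\<^sup>2"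
    by (simp add: edge_mean_logistic l_def power2_eq_square algebra_simps)
  also have "\<dots> \<ge> 0" using logistic_bounds[of "logit n \<theta> i j"] by (simp add: l_def less_imp_le)
  finally show ?thesis by simp
qed

lemma edge_variance_le: "edge_mean n p \<theta> i j * (1 - edge_mean n p \<theta> i j) \<le> 1 / 4"
  using zero_le_power2[of "edge_mean n p \<theta> i j - 1/2"] by (simp add: power2_eq_square algebra_simps)

lemma abs_par_le_norm: "i \<in> {1..2 * n - 1} \<Longrightarrow> \<bar>\<theta> i\<bar> \<le> par_norm n \<theta>"
  unfolding par_norm_def by (intro Max_ge) auto

lemma abs_logit_le:
  assumes "i \<in> {1..n}" "j \<in> {1..n}"
  shows "\<bar>logit n \<theta> i j\<bar> \<le> 2 * par_norm n \<theta>"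
proof -
  have 1: "\<bar>\<theta> i\<bar> \<le> par_norm n \<theta>" using assms by (intro abs_par_le_norm) auto
  have "\<bar>in_par n \<theta> j\<bar> \<le> par_norm n \<theta>"
  proof (cases "j = n")
    case False
    then show ?thesis using assms by (auto simp: in_par_def intro!: abs_par_le_norm)
  qed (use 1 in \<open>auto simp: in_par_def\<close>)
  then show ?thesis using 1 by (simp add: logit_def out_par_def)
qed

text \<open>
  The constant \<open>12\<close> stands for \<open>4 e\<close>, the factor \<open>e\<close> being the price of moving the argument by \<open>1\<close>.
\<close>

lemma logistic'_ge_near:
  assumes "\<bar>x\<bar> \<le> 2 * L" "\<bar>t - x\<bar> \<le> 1"
  shows "exp (- (2 * L)) / 12 \<le> logistic' t"
proof -
  have "exp (- (2 * L)) / 12 \<le> exp (- (2 * L + 1)) / 4"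
    using exp_le by (simp add: exp_diff exp_minus field_simps exp_add)
  also have "\<dots> \<le> logistic' t" using assms by (intro logistic'_ge) auto
  finally show ?thesis .
qed

text \<open>
  A deterministic statement about one sample \<open>A\<close>.  A solution of the logistic system is shifted so that
  the last in-parameter stays \<open>0\<close>, and then solves the moment equations; so \<open>\<xi>\<close> solves them too, and
  uniqueness identifies the two.
\<close>

lemma moment_estimator_expansion:
  fixes \<theta> \<xi> G H :: "nat \<Rightarrow> real" and A :: "nat \<Rightarrow> nat \<Rightarrow> real" and p \<tau> \<eta> m :: real and n k :: nat
  defines "I \<equiv> {1..n}" and "q \<equiv> 2 * p - 1" and "w \<equiv> \<lambda>i j. logistic' (logit n \<theta> i j)"
  defines "G \<equiv> \<lambda>i. \<Sum>j\<in>I - {i}. A i j - edge_mean n p \<theta> i j"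
    and "H \<equiv> \<lambda>j. \<Sum>i\<in>I - {j}. A i j - edge_mean n p \<theta> i j"
  defines "W \<equiv> \<lambda>i. \<Sum>j\<in>I - {i}. w i j" and "W' \<equiv> \<lambda>j. \<Sum>i\<in>I - {j}. w i j"
  defines "dout \<equiv> \<lambda>i. \<Sum>j\<in>I - {i}. A i j" and "din \<equiv> \<lambda>j. \<Sum>i\<in>I - {j}. A i j"
  assumes n: "n \<ge> 3" and q: "q > 0" and m: "m = exp (- (2 * par_norm n \<theta>)) / 12"
    and G: "\<And>i. i \<in> I \<Longrightarrow> \<bar>G i\<bar> \<le> \<tau>" and H: "\<And>j. j \<in> I \<Longrightarrow> \<bar>H j\<bar> \<le> \<tau>" and \<tau>: "\<tau> > 0"
    and small: "\<tau> / (q * ((real n - 1) * m)) \<le> m / 4"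
    and eta1: "\<And>i. i \<in> I \<Longrightarrow> \<bar>wmean (w i) (I - {i}) (\<lambda>j. H j / W' j)\<bar> \<le> q * \<eta>"
    and eta2: "\<And>j. j \<in> I \<Longrightarrow> \<bar>wmean (\<lambda>i. w i j) (I - {j}) (\<lambda>i. G i / W i)\<bar> \<le> q * \<eta>"
    and est: "(\<exists>\<zeta>. moment_equations n p dout din \<zeta>) \<Longrightarrow> moment_equations n p dout din \<xi>"
    and k: "k \<in> I"
  shows "\<bar>\<xi> k - \<theta> k - G k / v_diag n p \<theta> k - H n / v_diag n p \<theta> (2 * n)\<bar>
    \<le> 2 * ((2 * (\<tau> / (q * ((real n - 1) * m))) / m)\<^sup>2 / (4 * m) + \<eta>) / m"
proof -
  define \<gamma> where "\<gamma> = \<tau> / (q * ((real n - 1) * m))"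
  have fin: "finite I" and N: "card I \<ge> 3" and cI: "card I = n" and nI: "n \<in> I"
    using n by (auto simp: I_def)
  have m0: "m > 0" by (simp add: m)
  have \<gamma>: "\<gamma> > 0" "\<gamma> \<le> m / 4"
    using \<tau> q m0 n small by (auto simp: \<gamma>_def)
  have tau: "\<tau> / q = \<gamma> * ((real (card I) - 1) * m)"
    using q m0 n by (simp add: \<gamma>_def cI)
  have lower: "m \<le> logistic' t" if "i \<in> I" "j \<in> I" "i \<noteq> j" "\<bar>t - logit n \<theta> i j\<bar> \<le> 1" for i j t
    unfolding m using that by (intro logistic'_ge_near[OF abs_logit_le]) (auto simp: I_def)
  have gq: "\<bar>G i / q\<bar> \<le> \<gamma> * ((real (card I) - 1) * m)" and hq: "\<bar>H i / q\<bar> \<le> \<gamma> * ((real (card I) - 1) * m)"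
    if "i \<in> I" for i
    unfolding tau[symmetric] using G[OF that] H[OF that] q by (auto simp: divide_right_mono)
  have GH: "(\<Sum>i\<in>I. G i / q) = (\<Sum>j\<in>I. H j / q)"
  proof -
    have "(\<Sum>i\<in>I. G i) = (\<Sum>j\<in>I. H j)"
      unfolding G_def H_def by (rule sum_off_diagonal_swap[OF fin])
    then show ?thesis by (simp only: sum_divide_distrib[symmetric])
  qed
  obtain u v where
    rows: "\<And>i. i \<in> I \<Longrightarrow> (\<Sum>j\<in>I - {i}. logistic (logit n \<theta> i j + (u i - v j)) - logistic (logit n \<theta> i j)) = G i / q"
    and cols: "\<And>j. j \<in> I \<Longrightarrow> (\<Sum>i\<in>I - {j}. logistic (logit n \<theta> i j + (u i - v j)) - logistic (logit n \<theta> i j)) = H j / q"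
    and uv: "\<And>i j. i \<in> I \<Longrightarrow> j \<in> I \<Longrightarrow> \<bar>u i - v j\<bar> \<le> 2 * \<gamma> / m"
  proof (rule logistic_system_solvable[where I=I and g="\<lambda>i. G i / q" and h="\<lambda>j. H j / q"
        and x="logit n \<theta>" and m=m and \<gamma>=\<gamma>])
    show "m \<le> logistic' t" if "i \<in> I" "j \<in> I" "i \<noteq> j" "\<bar>t - logit n \<theta> i j\<bar> \<le> 1" for i j t
      using that by (rule lower)
  qed (rule fin N m0 \<gamma> GH | erule gq | erule hq | blast)+
  \<comment> \<open>The system sees only differences, so the normalisation at node \<open>n\<close> is free.\<close>
  define u' where "u' = (\<lambda>i. u i - v n)"
  define v' where "v' = (\<lambda>j. v j - v n)"
  have diff: "u' i - v' j = u i - v j" for i j by (simp add: u'_def v'_def)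
  define \<zeta> where "\<zeta> = (\<lambda>k. if k \<le> n then \<theta> k + u' k else \<theta> k - v' (k - n))"
  have \<zeta>: "logit n \<zeta> i j = logit n \<theta> i j + (u i - v j)" if "i \<in> I" "j \<in> I" for i j
    using that by (auto simp: logit_def out_par_def in_par_def \<zeta>_def I_def u'_def v'_def)
  have "moment_equations n p dout din \<zeta>"
    unfolding moment_equations_def edge_mean_def[symmetric]
  proof (intro conjI ballI)
    fix i assume "i \<in> {1..n}"
    then have i: "i \<in> I" by (simp add: I_def)
    have "(\<Sum>j\<in>I - {i}. edge_mean n p \<zeta> i j) - (\<Sum>j\<in>I - {i}. edge_mean n p \<theta> i j)
        = (\<Sum>j\<in>I - {i}. q * (logistic (logit n \<theta> i j + (u i - v j)) - logistic (logit n \<theta> i j)))"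
      unfolding sum_subtractf[symmetric] using i
      by (intro sum.cong) (auto simp: edge_mean_logistic \<zeta> q_def algebra_simps)
    also have "\<dots> = G i" using rows[OF i] q by (simp flip: sum_distrib_left)
    also have "\<dots> = dout i - (\<Sum>j\<in>I - {i}. edge_mean n p \<theta> i j)" by (simp add: G_def dout_def sum_subtractf)
    finally show "dout i = (\<Sum>j\<in>{1..n} - {i}. edge_mean n p \<zeta> i j)" by (simp add: I_def)
  next
    fix j assume "j \<in> {1..n - 1}"
    then have j: "j \<in> I" by (auto simp: I_def)
    have "(\<Sum>i\<in>I - {j}. edge_mean n p \<zeta> i j) - (\<Sum>i\<in>I - {j}. edge_mean n p \<theta> i j)
        = (\<Sum>i\<in>I - {j}. q * (logistic (logit n \<theta> i j + (u i - v j)) - logistic (logit n \<theta> i j)))"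
      unfolding sum_subtractf[symmetric] using j
      by (intro sum.cong) (auto simp: edge_mean_logistic \<zeta> q_def algebra_simps)
    also have "\<dots> = H j" using cols[OF j] q by (simp flip: sum_distrib_left)
    also have "\<dots> = din j - (\<Sum>i\<in>I - {j}. edge_mean n p \<theta> i j)" by (simp add: H_def din_def sum_subtractf)
    finally show "din j = (\<Sum>i\<in>{1..n} - {j}. edge_mean n p \<zeta> i j)" by (simp add: I_def)
  qed
  then have sol: "moment_equations n p dout din \<zeta>" "moment_equations n p dout din \<xi>"
    using est by blast+
  have cancel: "(\<Sum>x\<in>S. logistic (f x)) = (\<Sum>x\<in>S. logistic (g x))"
    if "(\<Sum>x\<in>S. (1 - p) + q * logistic (f x)) = (\<Sum>x\<in>S. (1 - p) + q * logistic (g x))" for S :: "nat set" and f g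
    using that q by (simp add: sum.distrib flip: sum_distrib_left)
  have "\<xi> k = \<zeta> k"
  proof -
    have "out_par \<xi> k = out_par \<zeta> k"
    proof (rule logistic_system_unique(1)[OF fin N nI, where b="in_par n \<xi>" and b'="in_par n \<zeta>"])
      show "in_par n \<xi> n = in_par n \<zeta> n" by (simp add: in_par_def)
      show "(\<Sum>j\<in>I - {i}. logistic (out_par \<xi> i + in_par n \<xi> j)) = (\<Sum>j\<in>I - {i}. logistic (out_par \<zeta> i + in_par n \<zeta> j))"
        if "i \<in> I" for i
        using sol that unfolding logit_def[symmetric]
        by (intro cancel) (auto simp: moment_equations_def I_def q_def edge_mean_logistic simp flip: edge_mean_def)
      show "(\<Sum>i\<in>I - {j}. logistic (out_par \<xi> i + in_par n \<xi> j)) = (\<Sum>i\<in>I - {j}. logistic (out_par \<zeta> i + in_par n \<zeta> j))"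
        if "j \<in> I - {n}" for j
      proof -
        have "j \<in> {1..n - 1}" using that by (auto simp: I_def)
        then show ?thesis using sol unfolding logit_def[symmetric]
          by (intro cancel) (auto simp: moment_equations_def I_def q_def edge_mean_logistic simp flip: edge_mean_def)
      qed
    qed (fact k)
    then show ?thesis by (simp add: out_par_def)
  qed
  then have \<xi>: "\<xi> k - \<theta> k = u' k" using k by (simp add: \<zeta>_def I_def)
  have wm: "wmean f S (\<lambda>j. (z j / q) / Z j) = wmean f S (\<lambda>j. z j / Z j) / q" for f z Z and S :: "nat set"
    by (simp add: wmean_def sum_divide_distrib mult_ac)
  have "\<bar>u' k - (G k / q) / W k - (H n / q) / W' n\<bar> \<le> 2 * ((2 * \<gamma> / m)\<^sup>2 / (4 * m) + \<eta>) / m"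
    unfolding W_def W'_def w_def
  proof (rule logistic_system_expansion[where v=v' and h="\<lambda>j. H j / q" and g="\<lambda>i. G i / q"])
    show "v' n = 0" by (simp add: v'_def)
    show "\<bar>wmean (\<lambda>j. logistic' (logit n \<theta> i j)) (I - {i}) (\<lambda>j. H j / q / (\<Sum>i\<in>I - {j}. logistic' (logit n \<theta> i j)))\<bar> \<le> \<eta>" if "i \<in> I" for i
      unfolding wm using eta1[OF that] q by (simp add: w_def W'_def divide_le_eq mult.commute)
    show "\<bar>wmean (\<lambda>i. logistic' (logit n \<theta> i j)) (I - {j}) (\<lambda>i. G i / q / (\<Sum>j\<in>I - {i}. logistic' (logit n \<theta> i j)))\<bar> \<le> \<eta>" if "j \<in> I" for j
      unfolding wm using eta2[OF that] q by (simp add: w_def W_def divide_le_eq mult.commute)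
    show "\<bar>u' i - v' j\<bar> \<le> 2 * \<gamma> / m" if "i \<in> I" "j \<in> I" for i j using uv[OF that] by (simp add: diff)
  qed (use fin N m0 nI k lower rows cols in \<open>auto simp: diff\<close>)
  moreover have "v_diag n p \<theta> k = q * W k" using k by (simp add: v_diag_out I_def q_def W_def w_def)
  moreover have "v_diag n p \<theta> (2 * n) = q * W' n"
    unfolding mult_2[of n] q_def W'_def w_def I_def using n by (intro v_diag_in) auto
  ultimately show ?thesis by (simp add: \<xi> \<gamma>_def)
qed

section \<open>Simultaneous control of the noise\<close>

lemma node_pairs_Sigma: "node_pairs n = Sigma {1..n} (\<lambda>i. {1..n} - {i})"
  by (auto simp: node_pairs_def)

lemma finite_node_pairs [simp]: "finite (node_pairs n)"
  by (simp add: node_pairs_Sigma)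

lemma card_node_pairs: "card (node_pairs n) = n * (n - 1)"
  by (simp add: node_pairs_Sigma)

lemma sum_node_pairs: "(\<Sum>(i, j)\<in>node_pairs n. f i j) = (\<Sum>i\<in>{1..n}. \<Sum>j\<in>{1..n} - {i}. f i j)"
  unfolding node_pairs_Sigma by (subst sum.Sigma) auto

lemma sum_node_pairs': "(\<Sum>(i, j)\<in>node_pairs n. f i j) = (\<Sum>j\<in>{1..n}. \<Sum>i\<in>{1..n} - {j}. f i j :: real)"
  unfolding sum_node_pairs by (rule sum_off_diagonal_swap) simp

locale flipped_graph = prob_space M for M :: "'w measure" +
  fixes n :: nat and p :: real and \<theta> :: "nat \<Rightarrow> real" and a a' :: "nat \<Rightarrow> nat \<Rightarrow> 'w \<Rightarrow> bool"
  assumes model: "p0_model M n \<theta> a" and flip: "edge_flip M n p a a'"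
    and n3: "n \<ge> 3" and p: "1 / 2 < p" "p < 1"
begin

definition noise :: "nat \<Rightarrow> nat \<Rightarrow> 'w \<Rightarrow> real" where
  "noise i j \<omega> = of_bool (a' i j \<omega>) - edge_mean n p \<theta> i j"

text \<open>
  All the noise terms below, from the degrees to their weighted averages, are linear forms of this kind,
  so that one tail bound and one characteristic function serve for all of them.
\<close>

definition noise_form :: "(nat \<Rightarrow> nat \<Rightarrow> real) \<Rightarrow> 'w \<Rightarrow> real" where
  "noise_form c \<omega> = (\<Sum>(i, j)\<in>node_pairs n. c i j * noise i j \<omega>)"

definition out_noise :: "nat \<Rightarrow> 'w \<Rightarrow> real" where
  "out_noise i \<omega> = (\<Sum>j\<in>{1..n} - {i}. noise i j \<omega>)"

definition in_noise :: "nat \<Rightarrow> 'w \<Rightarrow> real" where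
  "in_noise j \<omega> = (\<Sum>i\<in>{1..n} - {j}. noise i j \<omega>)"

definition wt :: "nat \<Rightarrow> nat \<Rightarrow> real" where
  "wt i j = logistic' (logit n \<theta> i j)"

definition out_wt :: "nat \<Rightarrow> real" where
  "out_wt i = (\<Sum>j\<in>{1..n} - {i}. wt i j)"

definition in_wt :: "nat \<Rightarrow> real" where
  "in_wt j = (\<Sum>i\<in>{1..n} - {j}. wt i j)"

text \<open>
  A lower bound for the derivative of the logistic function not only at the true logits but up to
  distance \<open>1\<close> from them.
\<close>

definition min_wt :: real where
  "min_wt = exp (- (2 * par_norm n \<theta>)) / 12"

definition min_sum :: real where
  "min_sum = (real n - 1) * min_wt"

abbreviation q :: real where "q \<equiv> 2 * p - 1"

lemma q_pos: "0 < q" using p by simp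

lemma min_wt_pos: "0 < min_wt" by (simp add: min_wt_def)

lemma min_sum_pos: "0 < min_sum" using n3 by (simp add: min_sum_def min_wt_pos)

lemma indep: "indep_vars (\<lambda>_. count_space UNIV) (\<lambda>(i, j). a' i j) (node_pairs n)"
  by (rule flipped_entries_indep[OF prob_space_axioms flip])

lemma entry_measurable: "(i, j) \<in> node_pairs n \<Longrightarrow> a' i j \<in> measurable M (count_space UNIV)"
  using indep unfolding indep_vars_def by auto

lemma entry_prob: "e \<in> node_pairs n \<Longrightarrow> prob {\<omega>\<in>space M. (case e of (i, j) \<Rightarrow> a' i j) \<omega>} = (case e of (i, j) \<Rightarrow> edge_mean n p \<theta> i j)"
  using flipped_entry_prob[OF prob_space_axioms model flip] by (cases e) (auto simp: edge_mean_def)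

lemma noise_measurable: "(i, j) \<in> node_pairs n \<Longrightarrow> noise i j \<in> borel_measurable M"
  unfolding noise_def[abs_def]
  by (intro borel_measurable_diff borel_measurable_const measurable_compose[OF entry_measurable, of i j of_bool borel])
     simp_all

lemma noise_form_measurable [measurable]: "noise_form c \<in> borel_measurable M"
  unfolding noise_form_def[abs_def] case_prod_beta
  by (intro borel_measurable_sum borel_measurable_times borel_measurable_const noise_measurable) auto

lemma noise_form_eq: "noise_form c \<omega> = (\<Sum>e\<in>node_pairs n. (case e of (i, j) \<Rightarrow> c i j) *
    (of_bool ((case e of (i, j) \<Rightarrow> a' i j) \<omega>) - (case e of (i, j) \<Rightarrow> edge_mean n p \<theta> i j)))"
  unfolding noise_form_def noise_def by (intro sum.cong) auto

text \<open>
  The threshold is chosen to give probability \<open>2 / n\<^sup>2\<close>, which leaves room for a union over \<open>4 n\<close> events.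
\<close>

lemma noise_form_tail:
  assumes V: "(\<Sum>(i, j)\<in>node_pairs n. (c i j)\<^sup>2) \<le> V" "V > 0"
  shows "prob {\<omega>\<in>space M. sqrt (V * ln n) \<le> \<bar>noise_form c \<omega>\<bar>} \<le> 2 / (real n)\<^sup>2"
proof -
  have ln: "0 < ln (real n)" using n3 by simp
  have "(\<Sum>e\<in>node_pairs n. (case e of (i, j) \<Rightarrow> c i j)\<^sup>2) \<le> V" using V(1) by (simp add: case_prod_beta)
  then have "prob {\<omega>\<in>space M. sqrt (V * ln n) \<le> \<bar>noise_form c \<omega>\<bar>} \<le> 2 * exp (- 2 * (sqrt (V * ln n))\<^sup>2 / V)"
    unfolding noise_form_eq using ln V(2)
    by (intro bernoulli_sum_hoeffding[OF finite_node_pairs indep entry_prob]) auto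
  also have "- 2 * (sqrt (V * ln n))\<^sup>2 / V = - (2 * ln n)" using ln V(2) by simp
  also have "exp (- (2 * ln n)) = 1 / (real n)\<^sup>2"
    using n3 by (simp add: exp_minus exp_double inverse_eq_divide)
  finally show ?thesis by simp
qed

lemma noise_form_char:
  assumes "\<And>i j. (i, j) \<in> node_pairs n \<Longrightarrow> \<bar>c i j\<bar> \<le> 1"
  shows "cmod ((CLINT \<omega>|M. iexp (noise_form c \<omega>))
      - exp (- (\<Sum>(i, j)\<in>node_pairs n. (c i j)\<^sup>2 * (edge_mean n p \<theta> i j * (1 - edge_mean n p \<theta> i j))) / 2))
    \<le> (\<Sum>(i, j)\<in>node_pairs n. \<bar>c i j\<bar> ^ 3)"
  using bernoulli_sum_char[OF finite_node_pairs indep entry_prob, of "\<lambda>(i, j). c i j"] assms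
  unfolding noise_form_eq by (auto simp: case_prod_beta)

lemma out_noise_form: assumes "i \<in> {1..n}" shows "noise_form (\<lambda>k j. of_bool (k = i)) \<omega> = out_noise i \<omega>"
proof -
  have "noise_form (\<lambda>k j. of_bool (k = i)) \<omega> = (\<Sum>k\<in>{1..n}. if k = i then out_noise k \<omega> else 0)"
    unfolding noise_form_def sum_node_pairs out_noise_def by (intro sum.cong) auto
  then show ?thesis using assms by simp
qed

lemma in_noise_form: assumes "j \<in> {1..n}" shows "noise_form (\<lambda>i l. of_bool (l = j)) \<omega> = in_noise j \<omega>"
proof -
  have "noise_form (\<lambda>i l. of_bool (l = j)) \<omega> = (\<Sum>l\<in>{1..n}. if l = j then in_noise l \<omega> else 0)"
    unfolding noise_form_def sum_node_pairs' in_noise_def by (intro sum.cong) auto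
  then show ?thesis using assms by simp
qed

lemma wt_bounds: assumes "i \<in> {1..n}" "j \<in> {1..n}" shows "min_wt \<le> wt i j" "wt i j \<le> 1 / 4"
  unfolding min_wt_def wt_def using logistic'_ge_near[OF abs_logit_le[OF assms], of "logit n \<theta> i j"] logistic'_le by auto

lemma out_wt_ge: assumes "i \<in> {1..n}" shows "min_sum \<le> out_wt i"
proof -
  have "real (card ({1..n} - {i})) * min_wt \<le> out_wt i"
    unfolding out_wt_def using wt_bounds assms by (intro sum_bounded_below) auto
  then show ?thesis using assms n3 by (simp add: min_sum_def of_nat_diff)
qed

lemma in_wt_ge: assumes "j \<in> {1..n}" shows "min_sum \<le> in_wt j"
proof -
  have "real (card ({1..n} - {j})) * min_wt \<le> in_wt j"
    unfolding in_wt_def using wt_bounds assms by (intro sum_bounded_below) auto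
  then show ?thesis using assms n3 by (simp add: min_sum_def of_nat_diff)
qed

lemma averaged_in_noise_form:
  assumes "i \<in> {1..n}"
  shows "wmean (wt i) ({1..n} - {i}) (\<lambda>j. in_noise j \<omega> / in_wt j)
    = noise_form (\<lambda>k j. if j = i then 0 else wt i j / (out_wt i * in_wt j)) \<omega>"
proof -
  have "noise_form (\<lambda>k j. if j = i then 0 else wt i j / (out_wt i * in_wt j)) \<omega>
      = (\<Sum>j\<in>{1..n}. if j = i then 0 else wt i j / (out_wt i * in_wt j) * in_noise j \<omega>)"
    unfolding noise_form_def sum_node_pairs' in_noise_def by (intro sum.cong) (auto simp: sum_distrib_left)
  also have "\<dots> = (\<Sum>j\<in>{1..n} - {i}. wt i j / (out_wt i * in_wt j) * in_noise j \<omega>)"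
    by (intro sum.mono_neutral_cong_right) auto
  also have "\<dots> = wmean (wt i) ({1..n} - {i}) (\<lambda>j. in_noise j \<omega> / in_wt j)"
    unfolding wmean_def out_wt_def[symmetric] sum_divide_distrib by (intro sum.cong) (auto simp: mult_ac)
  finally show ?thesis ..
qed

lemma averaged_out_noise_form:
  assumes "j \<in> {1..n}"
  shows "wmean (\<lambda>i. wt i j) ({1..n} - {j}) (\<lambda>i. out_noise i \<omega> / out_wt i)
    = noise_form (\<lambda>i k. if i = j then 0 else wt i j / (in_wt j * out_wt i)) \<omega>"
proof -
  have "noise_form (\<lambda>i k. if i = j then 0 else wt i j / (in_wt j * out_wt i)) \<omega>
      = (\<Sum>i\<in>{1..n}. if i = j then 0 else wt i j / (in_wt j * out_wt i) * out_noise i \<omega>)"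
    unfolding noise_form_def sum_node_pairs out_noise_def by (intro sum.cong) (auto simp: sum_distrib_left)
  also have "\<dots> = (\<Sum>i\<in>{1..n} - {j}. wt i j / (in_wt j * out_wt i) * out_noise i \<omega>)"
    by (intro sum.mono_neutral_cong_right) auto
  also have "\<dots> = wmean (\<lambda>i. wt i j) ({1..n} - {j}) (\<lambda>i. out_noise i \<omega> / out_wt i)"
    unfolding wmean_def in_wt_def[symmetric] sum_divide_distrib by (intro sum.cong) (auto simp: mult_ac)
  finally show ?thesis ..
qed

definition noise_bound :: real where "noise_bound = sqrt (real n * ln n)"

text \<open>
  A coefficient of an averaged noise term is at most \<open>1 / (4 min_sum\<^sup>2)\<close>, and there are fewer than \<open>n\<^sup>2\<close>
  of them.  Averaging gains a factor of order \<open>\<surd>n\<close> over a single degree divided by its weight.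
\<close>

definition averaged_noise_bound :: real where
  "averaged_noise_bound = sqrt ((real n)\<^sup>2 / (16 * min_sum ^ 4) * ln n)"

definition good :: "'w set" where
  "good = {\<omega>\<in>space M. \<forall>i\<in>{1..n}. \<bar>out_noise i \<omega>\<bar> \<le> noise_bound \<and> \<bar>in_noise i \<omega>\<bar> \<le> noise_bound \<and>
     \<bar>wmean (wt i) ({1..n} - {i}) (\<lambda>j. in_noise j \<omega> / in_wt j)\<bar> \<le> averaged_noise_bound \<and>
     \<bar>wmean (\<lambda>k. wt k i) ({1..n} - {i}) (\<lambda>k. out_noise k \<omega> / out_wt k)\<bar> \<le> averaged_noise_bound}"

text \<open>
  Four linear forms for each node, each of them too large with probability at most \<open>2 / n\<^sup>2\<close>.
\<close>

lemma good_prob: "good \<in> sets M" "prob (space M - good) \<le> 8 / n"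
proof -
  let ?c1 = "\<lambda>i k j. of_bool (k = i) :: real" and ?c2 = "\<lambda>j i l. of_bool (l = j) :: real"
  let ?c3 = "\<lambda>i k j. if j = i then 0 else wt i j / (out_wt i * in_wt j)"
  let ?c4 = "\<lambda>j i k. if i = j then 0 else wt i j / (in_wt j * out_wt i)"
  let ?V = "(real n)\<^sup>2 / (16 * min_sum ^ 4)"
  have good: "good = {\<omega>\<in>space M. \<forall>i\<in>{1..n}. \<bar>noise_form (?c1 i) \<omega>\<bar> \<le> noise_bound \<and> \<bar>noise_form (?c2 i) \<omega>\<bar> \<le> noise_bound \<and>
     \<bar>noise_form (?c3 i) \<omega>\<bar> \<le> averaged_noise_bound \<and> \<bar>noise_form (?c4 i) \<omega>\<bar> \<le> averaged_noise_bound}"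
    unfolding good_def
    by (intro Collect_cong conj_cong ball_cong refl)
       (simp_all only: out_noise_form in_noise_form averaged_in_noise_form averaged_out_noise_form)
  show "good \<in> sets M" unfolding good by measurable
  define T where "T = (\<lambda>c V. {\<omega>\<in>space M. sqrt (V * ln n) \<le> \<bar>noise_form c \<omega>\<bar>})"
  have T [measurable]: "T c V \<in> sets M" for c V unfolding T_def by measurable
  define S where "S = (\<lambda>i. T (?c1 i) n \<union> T (?c2 i) n \<union> T (?c3 i) ?V \<union> T (?c4 i) ?V)"
  have Sm: "S i \<in> sets M" for i unfolding S_def by measurable
  have n1: "real (n - 1) = real n - 1" using n3 by (simp add: of_nat_diff)
  have b12: "prob (T (?c1 i) n) \<le> 2 / (real n)\<^sup>2" "prob (T (?c2 i) n) \<le> 2 / (real n)\<^sup>2" if "i \<in> {1..n}" for i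
  proof -
    have "(\<Sum>(k, j)\<in>node_pairs n. (of_bool (k = i))\<^sup>2 :: real) = (\<Sum>k\<in>{1..n}. if k = i then real n - 1 else 0)"
      unfolding sum_node_pairs by (intro sum.cong) (use n1 in auto)
    then show "prob (T (?c1 i) n) \<le> 2 / (real n)\<^sup>2"
      unfolding T_def using that n3 by (intro noise_form_tail) auto
    have "(\<Sum>(k, j)\<in>node_pairs n. (of_bool (j = i))\<^sup>2 :: real) = (\<Sum>j\<in>{1..n}. if j = i then real n - 1 else 0)"
      unfolding sum_node_pairs' by (intro sum.cong) (use n1 in auto)
    then show "prob (T (?c2 i) n) \<le> 2 / (real n)\<^sup>2"
      unfolding T_def using that n3 by (intro noise_form_tail) auto
  qed
  have cb: "(wt i j / (x * y))\<^sup>2 \<le> 1 / (16 * min_sum ^ 4)"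
    if "i \<in> {1..n}" "j \<in> {1..n}" "min_sum \<le> x" "min_sum \<le> y" for i j x y
  proof -
    have "wt i j / (x * y) \<le> (1 / 4) / (min_sum * min_sum)"
      using that wt_bounds[OF that(1,2)] min_sum_pos
      by (intro frac_le mult_mono) (auto intro: mult_pos_pos)
    moreover have "0 \<le> wt i j / (x * y)"
      using that wt_bounds[OF that(1,2)] min_sum_pos min_wt_pos by (intro divide_nonneg_nonneg mult_nonneg_nonneg) auto
    ultimately have "(wt i j / (x * y))\<^sup>2 \<le> ((1 / 4) / (min_sum * min_sum))\<^sup>2" by (rule power_mono)
    then show ?thesis by (simp add: power2_eq_square power4_eq_xxxx mult_ac)
  qed
  have V: "?V > 0" using n3 min_sum_pos by simp
  have bV: "prob (T c ?V) \<le> 2 / (real n)\<^sup>2" if "\<And>i j. (i, j) \<in> node_pairs n \<Longrightarrow> (c i j)\<^sup>2 \<le> 1 / (16 * min_sum ^ 4)" for c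
  proof -
    have "(\<Sum>(i, j)\<in>node_pairs n. (c i j)\<^sup>2) \<le> real (card (node_pairs n)) * (1 / (16 * min_sum ^ 4))"
      using that by (intro sum_bounded_above) auto
    also have "\<dots> \<le> (real n)\<^sup>2 * (1 / (16 * min_sum ^ 4))"
      using min_sum_pos by (intro mult_right_mono) (auto simp: card_node_pairs power2_eq_square intro!: mult_left_mono)
    finally show ?thesis unfolding T_def using V by (intro noise_form_tail) auto
  qed
  have b3: "prob (T (?c3 i) ?V) \<le> 2 / (real n)\<^sup>2" if "i \<in> {1..n}" for i
    by (rule bV) (use that cb out_wt_ge in_wt_ge min_sum_pos in \<open>auto simp: node_pairs_def\<close>)
  have b4: "prob (T (?c4 i) ?V) \<le> 2 / (real n)\<^sup>2" if "i \<in> {1..n}" for i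
    by (rule bV) (use that cb out_wt_ge in_wt_ge min_sum_pos in \<open>auto simp: node_pairs_def\<close>)
  have "space M - good \<subseteq> (\<Union>i\<in>{1..n}. S i)"
    unfolding good S_def T_def noise_bound_def averaged_noise_bound_def by (auto simp: not_le less_imp_le)
  then have "prob (space M - good) \<le> prob (\<Union>i\<in>{1..n}. S i)"
    using Sm by (intro finite_measure_mono) auto
  also have "\<dots> \<le> (\<Sum>i\<in>{1..n}. prob (S i))"
    using Sm by (intro finite_measure_subadditive_finite) auto
  also have "\<dots> \<le> (\<Sum>i\<in>{1..n}. 8 / (real n)\<^sup>2)"
  proof (rule sum_mono)
    fix i assume i: "i \<in> {1..n}"
    have "prob (S i) \<le> prob (T (?c1 i) n) + prob (T (?c2 i) n) + prob (T (?c3 i) ?V) + prob (T (?c4 i) ?V)"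
      unfolding S_def using T by (intro order.trans[OF measure_Un_le] add_mono order.refl sets.Un) auto
    then show "prob (S i) \<le> 8 / (real n)\<^sup>2" using b12[OF i] b3[OF i] b4[OF i] by linarith
  qed
  also have "\<dots> = 8 / n" using n3 by (simp add: power2_eq_square)
  finally show "prob (space M - good) \<le> 8 / n" .
qed

end

section \<open>The leading term of the estimation error\<close>

lemma iexp_lipschitz: "cmod (iexp a - iexp b) \<le> \<bar>a - b\<bar>"
proof -
  have "iexp a - iexp b = iexp b * (iexp (a - b) - 1)"
    by (simp add: right_diff_distrib flip: exp_add distrib_left)
  then have "cmod (iexp a - iexp b) = cmod (iexp (a - b) - 1)" by (simp add: norm_mult)
  also have "\<dots> \<le> \<bar>a - b\<bar>" using iexp_approx1[of "a - b" 0] by simp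
  finally show ?thesis .
qed

context flipped_graph
begin

definition edge_var :: "nat \<Rightarrow> nat \<Rightarrow> real" where
  "edge_var i j = edge_mean n p \<theta> i j * (1 - edge_mean n p \<theta> i j)"

definition lead :: "nat \<Rightarrow> 'w \<Rightarrow> real" where
  "lead k \<omega> = out_noise k \<omega> / v_diag n p \<theta> k + in_noise n \<omega> / v_diag n p \<theta> (2 * n)"

text \<open>
  The value of \<open>\<gamma>\<close> with which \<open>logistic_system_solvable\<close> applies on the good event, so that the increments
  \<open>u\<^sub>i - v\<^sub>j\<close> of the estimated logits have modulus at most \<open>2 rel_noise / min_wt\<close>.
\<close>

definition rel_noise :: real where
  "rel_noise = noise_bound / (q * min_sum)"

definition remainder_bound :: real where
  "remainder_bound = 2 * ((2 * rel_noise / min_wt)\<^sup>2 / (4 * min_wt) + averaged_noise_bound / q) / min_wt"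

lemma noise_bound_pos: "0 < noise_bound"
  using n3 by (simp add: noise_bound_def)

lemma remainder_bound_nonneg: "0 \<le> remainder_bound"
  using q_pos min_wt_pos n3 by (simp add: remainder_bound_def averaged_noise_bound_def)

lemma estimator_close_to_lead:
  assumes est: "moment_estimator M n p a' est" and small: "rel_noise \<le> min_wt / 4"
    and \<omega>: "\<omega> \<in> good" and k: "k \<in> {1..n}"
  shows "\<bar>est \<omega> k - \<theta> k - lead k \<omega>\<bar> \<le> remainder_bound"
proof -
  have w: "\<omega> \<in> space M" using \<omega> by (simp add: good_def)
  have E: "(\<exists>\<zeta>. moment_equations n p (\<lambda>i. \<Sum>j\<in>{1..n} - {i}. of_bool (a' i j \<omega>)) (\<lambda>j. \<Sum>i\<in>{1..n} - {j}. of_bool (a' i j \<omega>)) \<zeta>)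
    \<Longrightarrow> moment_equations n p (\<lambda>i. \<Sum>j\<in>{1..n} - {i}. of_bool (a' i j \<omega>)) (\<lambda>j. \<Sum>i\<in>{1..n} - {j}. of_bool (a' i j \<omega>)) (est \<omega>)"
    using est w unfolding moment_estimator_def out_degree_def[abs_def] in_degree_def[abs_def] by blast
  have "\<bar>est \<omega> k - \<theta> k - (\<Sum>j\<in>{1..n} - {k}. of_bool (a' k j \<omega>) - edge_mean n p \<theta> k j) / v_diag n p \<theta> k
      - (\<Sum>i\<in>{1..n} - {n}. of_bool (a' i n \<omega>) - edge_mean n p \<theta> i n) / v_diag n p \<theta> (2 * n)\<bar>
    \<le> 2 * ((2 * (noise_bound / (q * ((real n - 1) * min_wt))) / min_wt)\<^sup>2 / (4 * min_wt) + averaged_noise_bound / q) / min_wt"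
  proof (rule moment_estimator_expansion[OF n3 q_pos min_wt_def _ _ noise_bound_pos _ _ _ E k])
    have qa: "q * (averaged_noise_bound / q) = averaged_noise_bound" using q_pos by simp
    fix i assume i: "i \<in> {1..n}"
    show "\<bar>\<Sum>j\<in>{1..n} - {i}. of_bool (a' i j \<omega>) - edge_mean n p \<theta> i j\<bar> \<le> noise_bound"
      "\<bar>\<Sum>j\<in>{1..n} - {i}. of_bool (a' j i \<omega>) - edge_mean n p \<theta> j i\<bar> \<le> noise_bound"
      using \<omega> i unfolding good_def out_noise_def in_noise_def noise_def by blast+
    show "\<bar>wmean (\<lambda>j. logistic' (logit n \<theta> i j)) ({1..n} - {i}) (\<lambda>j. (\<Sum>i\<in>{1..n} - {j}. of_bool (a' i j \<omega>) - edge_mean n p \<theta> i j) /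
        (\<Sum>i\<in>{1..n} - {j}. logistic' (logit n \<theta> i j)))\<bar> \<le> q * (averaged_noise_bound / q)"
      "\<bar>wmean (\<lambda>k. logistic' (logit n \<theta> k i)) ({1..n} - {i}) (\<lambda>i. (\<Sum>j\<in>{1..n} - {i}. of_bool (a' i j \<omega>) - edge_mean n p \<theta> i j) /
        (\<Sum>j\<in>{1..n} - {i}. logistic' (logit n \<theta> i j)))\<bar> \<le> q * (averaged_noise_bound / q)"
      unfolding qa using \<omega> i
      unfolding good_def out_noise_def in_noise_def noise_def out_wt_def in_wt_def wt_def[abs_def] by blast+
  next
    show "noise_bound / (q * ((real n - 1) * min_wt)) \<le> min_wt / 4"
      using small by (simp add: rel_noise_def min_sum_def)
  qed
  then show ?thesis
    unfolding lead_def remainder_bound_def rel_noise_def min_sum_def out_noise_def in_noise_def noise_def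
    by (simp add: diff_diff_eq)
qed

lemma v_out: "i \<in> {1..n} \<Longrightarrow> v_diag n p \<theta> i = q * out_wt i"
  by (simp add: v_diag_out out_wt_def wt_def)

lemma v_last: "v_diag n p \<theta> (2 * n) = q * in_wt n"
  unfolding mult_2[of n] in_wt_def wt_def using n3 by (intro v_diag_in) auto

lemma sigma_out: "i \<in> {1..n} \<Longrightarrow> sigma_sq n p \<theta> i = (\<Sum>j\<in>{1..n} - {i}. edge_var i j)"
  by (simp add: sigma_sq_out edge_var_def)

lemma sigma_last: "sigma_sq n p \<theta> (2 * n) = (\<Sum>i\<in>{1..n} - {n}. edge_var i n)"
  unfolding mult_2[of n] edge_var_def using n3 by (intro sigma_sq_in) auto

lemma edge_var_bounds: "p * (1 - p) \<le> edge_var i j" "edge_var i j \<le> 1 / 4" "0 < edge_var i j" "0 < p * (1 - p)"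
proof -
  show 0: "0 < p * (1 - p)" using p by simp
  show 1: "p * (1 - p) \<le> edge_var i j" unfolding edge_var_def using p by (intro edge_variance_ge) auto
  show "edge_var i j \<le> 1 / 4" unfolding edge_var_def by (rule edge_variance_le)
  show "0 < edge_var i j" using 0 1 by linarith
qed

lemma v_out_ge: "i \<in> {1..n} \<Longrightarrow> q * min_sum \<le> v_diag n p \<theta> i"
  using v_out out_wt_ge q_pos by simp

lemma v_last_ge: "q * min_sum \<le> v_diag n p \<theta> (2 * n)"
  using v_last in_wt_ge[of n] q_pos n3 by simp

lemma v_out_le: assumes "i \<in> {1..n}" shows "v_diag n p \<theta> i \<le> q * ((real n - 1) / 4)"
proof -
  have "out_wt i \<le> real (card ({1..n} - {i})) * (1 / 4)"
    unfolding out_wt_def using wt_bounds assms by (intro sum_bounded_above) auto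
  then have "out_wt i \<le> (real n - 1) / 4" using assms n3 by (simp add: of_nat_diff)
  then show ?thesis using v_out[OF assms] q_pos by simp
qed

definition out_scale :: "nat \<Rightarrow> real" where
  "out_scale i = sigma_sq n p \<theta> i / (v_diag n p \<theta> i)\<^sup>2"

definition last_scale :: real where
  "last_scale = sigma_sq n p \<theta> (2 * n) / (v_diag n p \<theta> (2 * n))\<^sup>2"

lemma last_scale_nonneg: "0 \<le> last_scale"
  unfolding last_scale_def sigma_last using edge_var_bounds(3) by (simp add: sum_nonneg less_imp_le)

text \<open>
  Compares the noise variance, at least \<open>(n - 1) p (1 - p)\<close>, with the largest possible \<open>v\<^sub>i\<^sub>,\<^sub>i\<close>, which is
  \<open>q (n - 1) / 4\<close>.
\<close>

lemma out_scale_ge: assumes i: "i \<in> {1..n}" shows "16 * (p * (1 - p)) / (q\<^sup>2 * n) \<le> out_scale i"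
proof -
  have N: "0 < real n - 1" using n3 by simp
  have v: "0 < v_diag n p \<theta> i" using v_out_ge[OF i] mult_pos_pos[OF q_pos min_sum_pos] by linarith
  have "real (card ({1..n} - {i})) * (p * (1 - p)) \<le> sigma_sq n p \<theta> i"
    unfolding sigma_out[OF i] using edge_var_bounds(1) by (intro sum_bounded_below) auto
  then have s: "(real n - 1) * (p * (1 - p)) \<le> sigma_sq n p \<theta> i" using i n3 by (simp add: of_nat_diff)
  have "16 * (p * (1 - p)) / (q\<^sup>2 * n) \<le> 16 * (p * (1 - p)) / (q\<^sup>2 * (real n - 1))"
    using N q_pos edge_var_bounds(4) by (intro divide_left_mono mult_left_mono) auto
  also have "\<dots> = ((real n - 1) * (p * (1 - p))) / (q * ((real n - 1) / 4))\<^sup>2"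
    using N q_pos by (simp add: power2_eq_square divide_simps)
  also have "\<dots> \<le> sigma_sq n p \<theta> i / (v_diag n p \<theta> i)\<^sup>2"
    using s v v_out_le[OF i] N edge_var_bounds(4) by (intro frac_le power_mono) (auto intro: order.trans[OF _ s])
  finally show ?thesis by (simp add: out_scale_def)
qed

lemma out_scale_pos: "i \<in> {1..n} \<Longrightarrow> 0 < out_scale i"
proof -
  assume i: "i \<in> {1..n}"
  have "0 < 16 * (p * (1 - p)) / (q\<^sup>2 * n)" using n3 q_pos edge_var_bounds(4) by simp
  then show ?thesis using out_scale_ge[OF i] by linarith
qed

end

locale flipped_graph_coords = flipped_graph M n p \<theta> a a'
  for M :: "'w measure" and n p \<theta> a a' +
  fixes idx :: "'k::finite \<Rightarrow> nat"
  assumes idx: "bij_betw idx UNIV {1..CARD('k)}" and n_large: "CARD('k) < n"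
begin

definition cov :: "real^'k^'k" where
  "cov = (\<chi> r s. asymp_cov n p \<theta> (idx r) (idx s))"

lemma idx_inj: "idx r = idx s \<longleftrightarrow> r = s"
  using idx by (auto simp: bij_betw_def inj_def)

lemma idx_in: "idx r \<in> {1..n}" and idx_neq: "idx r \<noteq> n"
proof -
  have "idx r \<in> {1..CARD('k)}" using idx unfolding bij_betw_def by blast
  then show "idx r \<in> {1..n}" "idx r \<noteq> n" using n_large by auto
qed

lemma cov_entry: "asymp_cov n p \<theta> (idx r) (idx s) = last_scale + (if r = s then out_scale (idx r) else 0)"
  using idx_in[of r] idx_in[of s] by (simp add: asymp_cov_def last_scale_def out_scale_def idx_inj)

text \<open>
  As \<open>CARD('k) < n\<close>, the selected coordinates all belong to out-parameters, and the covariance matrix is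
  a diagonal matrix plus a multiple of the all-ones matrix.
\<close>

lemma cov_quadratic: "y \<bullet> (cov *v y) = last_scale * (\<Sum>r\<in>UNIV. y $ r)\<^sup>2 + (\<Sum>r\<in>UNIV. out_scale (idx r) * (y $ r)\<^sup>2)"
proof -
  have "(cov *v y) $ r = last_scale * (\<Sum>s\<in>UNIV. y $ s) + out_scale (idx r) * y $ r" for r
    by (simp add: cov_def matrix_vector_mult_def cov_entry distrib_right sum.distrib sum_distrib_left if_distrib[of "\<lambda>x. x * _"] cong: if_cong)
  then show ?thesis
    by (simp add: inner_vec_def algebra_simps sum.distrib power2_eq_square sum_distrib_left sum_distrib_right)
qed

lemma cov_spd: "sym_pos_def cov"
  unfolding sym_pos_def_def
proof (intro conjI allI impI)
  show "transpose cov = cov" by (simp add: transpose_def cov_def cov_entry vec_eq_iff)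
  fix y :: "real^'k" assume "y \<noteq> 0"
  then obtain r where r: "y $ r \<noteq> 0" by (auto simp: vec_eq_iff)
  have "0 < (\<Sum>r\<in>UNIV. out_scale (idx r) * (y $ r)\<^sup>2)"
    using r out_scale_pos[OF idx_in] by (intro sum_pos2[of UNIV r]) (auto simp: less_imp_le)
  then show "0 < y \<bullet> (cov *v y)"
    unfolding cov_quadratic using last_scale_nonneg by (intro add_nonneg_pos mult_nonneg_nonneg) auto
qed

definition coord_bound :: "real^'k \<Rightarrow> real" where
  "coord_bound t = norm t * q * sqrt n / (4 * sqrt (p * (1 - p)))"

text \<open>
  The vector \<open>y = M\<^sup>-\<^sup>1\<^sup>/\<^sup>2 t\<close> satisfies \<open>y \<bullet> M y = \<parallel>t\<parallel>\<^sup>2\<close>, and the diagonal part of \<open>M\<close> bounds each coordinate.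
\<close>

lemma coord_bound:
  fixes t :: "real^'k"
  shows "\<bar>(matrix_inv_sqrt cov *v t) $ r\<bar> \<le> coord_bound t"
proof -
  define y where "y = matrix_inv_sqrt cov *v t"
  let ?d = "16 * (p * (1 - p)) / (q\<^sup>2 * n)"
  have d: "0 < ?d" using n3 q_pos edge_var_bounds(4) by simp
  have "?d * (y $ r)\<^sup>2 \<le> out_scale (idx r) * (y $ r)\<^sup>2"
    using out_scale_ge[OF idx_in] by (intro mult_right_mono) auto
  also have "\<dots> \<le> (\<Sum>r\<in>UNIV. out_scale (idx r) * (y $ r)\<^sup>2)"
    using out_scale_pos[OF idx_in] by (intro member_le_sum) (auto simp: less_imp_le)
  also have "\<dots> \<le> y \<bullet> (cov *v y)" unfolding cov_quadratic using last_scale_nonneg by simp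
  also have "\<dots> = (norm t)\<^sup>2" unfolding y_def matrix_inv_sqrt(2)[OF cov_spd] by (simp add: dot_square_norm)
  finally have "(y $ r)\<^sup>2 \<le> (norm t)\<^sup>2 / ?d" unfolding pos_le_divide_eq[OF d] by (simp only: mult.commute)
  also have "\<dots> = (coord_bound t)\<^sup>2"
    using edge_var_bounds(4) by (simp add: coord_bound_def power_divide power_mult_distrib real_sqrt_pow2)
  finally have "(y $ r)\<^sup>2 \<le> (coord_bound t)\<^sup>2" .
  moreover have "0 \<le> coord_bound t" using q_pos edge_var_bounds(4) by (simp add: coord_bound_def)
  ultimately show ?thesis unfolding y_def by (metis abs_le_square_iff abs_of_nonneg)
qed

end

section \<open>Characteristic function of the normalised error\<close>

context flipped_graph_coords
begin

text \<open>
  The coordinate of \<open>y\<close> that belongs to node \<open>i\<close>, and \<open>0\<close> if no coordinate does.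
\<close>

definition out_load :: "real^'k \<Rightarrow> nat \<Rightarrow> real" where
  "out_load y i = (\<Sum>r\<in>UNIV. if idx r = i then y $ r else 0)"

definition total_load :: "real^'k \<Rightarrow> real" where
  "total_load y = (\<Sum>r\<in>UNIV. y $ r)"

definition lead_coeff :: "real^'k \<Rightarrow> nat \<Rightarrow> nat \<Rightarrow> real" where
  "lead_coeff y i j = out_load y i / v_diag n p \<theta> i + (if j = n then total_load y / v_diag n p \<theta> (2 * n) else 0)"

lemma out_load_idx: "out_load y (idx r) = y $ r"
  by (simp add: out_load_def idx_inj)

lemma out_load_outside: "i \<notin> range idx \<Longrightarrow> out_load y i = 0"
  unfolding out_load_def by (intro sum.neutral) auto

lemma sum_range_idx: 
  assumes "\<And>i. i \<notin> range idx \<Longrightarrow> f i = (0::real)"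
  shows "(\<Sum>i\<in>{1..n}. f i) = (\<Sum>r\<in>UNIV. f (idx r))"
proof -
  have "(\<Sum>i\<in>{1..n}. f i) = (\<Sum>i\<in>range idx. f i)"
    using assms idx_in by (intro sum.mono_neutral_right) auto
  also have "\<dots> = (\<Sum>r\<in>UNIV. f (idx r))"
    by (subst sum.reindex) (auto simp: inj_def idx_inj)
  finally show ?thesis .
qed

lemma lead_form: "noise_form (lead_coeff y) \<omega> = (\<Sum>r\<in>UNIV. y $ r * lead (idx r) \<omega>)"
proof -
  have "noise_form (lead_coeff y) \<omega> = (\<Sum>(i, j)\<in>node_pairs n. out_load y i / v_diag n p \<theta> i * noise i j \<omega>)
      + (\<Sum>(i, j)\<in>node_pairs n. (if j = n then total_load y / v_diag n p \<theta> (2 * n) else 0) * noise i j \<omega>)"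
    unfolding noise_form_def lead_coeff_def by (simp add: case_prod_beta distrib_right sum.distrib)
  also have "(\<Sum>(i, j)\<in>node_pairs n. out_load y i / v_diag n p \<theta> i * noise i j \<omega>)
      = (\<Sum>i\<in>{1..n}. out_load y i / v_diag n p \<theta> i * out_noise i \<omega>)"
    unfolding sum_node_pairs out_noise_def by (simp only: sum_distrib_left)
  also have "\<dots> = (\<Sum>r\<in>UNIV. y $ r / v_diag n p \<theta> (idx r) * out_noise (idx r) \<omega>)"
    by (subst sum_range_idx) (simp_all add: out_load_outside out_load_idx)
  also have "(\<Sum>(i, j)\<in>node_pairs n. (if j = n then total_load y / v_diag n p \<theta> (2 * n) else 0) * noise i j \<omega>)
      = (\<Sum>j\<in>{1..n}. if j = n then total_load y / v_diag n p \<theta> (2 * n) * in_noise j \<omega> else 0)"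
    unfolding sum_node_pairs' in_noise_def by (intro sum.cong) (auto simp: sum_distrib_left)
  also have "\<dots> = total_load y / v_diag n p \<theta> (2 * n) * in_noise n \<omega>" using n3 by simp
  also have "\<dots> = (\<Sum>r\<in>UNIV. y $ r * (in_noise n \<omega> / v_diag n p \<theta> (2 * n)))"
    by (simp add: total_load_def sum_distrib_right sum_divide_distrib)
  finally show ?thesis by (simp add: lead_def distrib_left sum.distrib)
qed

lemma out_load_le: assumes "\<And>r. \<bar>y $ r\<bar> \<le> Y" shows "\<bar>out_load y i\<bar> \<le> Y"
proof (cases "i \<in> range idx")
  case True
  then show ?thesis using assms by (auto simp: out_load_idx)
next
  case False
  then show ?thesis using assms[of undefined] by (simp add: out_load_outside)
qed

lemma total_load_le:
  fixes Y :: real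
  assumes "\<And>r. \<bar>y $ r\<bar> \<le> Y" shows "\<bar>total_load y\<bar> \<le> real CARD('k) * Y"
proof -
  have "\<bar>total_load y\<bar> \<le> (\<Sum>r\<in>UNIV. \<bar>y $ r\<bar>)" unfolding total_load_def by (rule sum_abs)
  also have "\<dots> \<le> real CARD('k) * Y" using assms by (intro sum_bounded_above) auto
  finally show ?thesis .
qed

text \<open>
  A common bound, up to the number of coordinates, for the coefficients of all entries in the leading
  linear form.
\<close>

definition coeff_bound :: "real \<Rightarrow> real" where
  "coeff_bound Y = Y / (q * min_sum)"

lemma lead_coeff_le:
  assumes Y: "\<And>r. \<bar>y $ r\<bar> \<le> Y" and i: "i \<in> {1..n}"
  shows "\<bar>out_load y i / v_diag n p \<theta> i\<bar> \<le> coeff_bound Y"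
    "\<bar>total_load y / v_diag n p \<theta> (2 * n)\<bar> \<le> real CARD('k) * coeff_bound Y"
    "\<bar>lead_coeff y i j\<bar> \<le> (real CARD('k) + 1) * coeff_bound Y"
proof -
  have qs: "0 < q * min_sum" using q_pos min_sum_pos by simp
  have Y0: "0 \<le> Y" using Y[of undefined] by linarith
  have va: "\<bar>v_diag n p \<theta> i\<bar> = v_diag n p \<theta> i" "\<bar>v_diag n p \<theta> (2 * n)\<bar> = v_diag n p \<theta> (2 * n)"
    using v_out_ge[OF i] v_last_ge qs by linarith+
  show 1: "\<bar>out_load y i / v_diag n p \<theta> i\<bar> \<le> coeff_bound Y"
    unfolding abs_divide va coeff_bound_def
    using out_load_le[OF Y, where i=i] v_out_ge[OF i] qs Y0 by (intro frac_le) auto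
  have "\<bar>total_load y / v_diag n p \<theta> (2 * n)\<bar> \<le> (real CARD('k) * Y) / (q * min_sum)"
    unfolding abs_divide va using total_load_le[OF Y] v_last_ge qs Y0 by (intro frac_le) auto
  then show 2: "\<bar>total_load y / v_diag n p \<theta> (2 * n)\<bar> \<le> real CARD('k) * coeff_bound Y"
    by (simp add: coeff_bound_def)
  have 3: "0 \<le> real CARD('k) * coeff_bound Y" using Y0 qs by (simp add: coeff_bound_def)
  have "\<bar>lead_coeff y i j\<bar> \<le> coeff_bound Y + real CARD('k) * coeff_bound Y"
    unfolding lead_coeff_def using 1 2 3 by (smt (verit))
  then show "\<bar>lead_coeff y i j\<bar> \<le> (real CARD('k) + 1) * coeff_bound Y" by (simp add: algebra_simps)
qed

text \<open>
  The linear form is the sum of an out-degree part and an in-degree part of node \<open>n\<close>, whose variances add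
  up to the quadratic form exactly.  The cross term sees only the entries \<open>(i, n)\<close> with \<open>i\<close> among the
  selected nodes.
\<close>

lemma lead_variance:
  assumes Y: "\<And>r. \<bar>y $ r\<bar> \<le> Y"
  shows "\<bar>(\<Sum>(i, j)\<in>node_pairs n. (lead_coeff y i j)\<^sup>2 * edge_var i j) - y \<bullet> (cov *v y)\<bar>
    \<le> (real CARD('k) * coeff_bound Y)\<^sup>2"
proof -
  let ?a = "\<lambda>i. out_load y i / v_diag n p \<theta> i" and ?b = "total_load y / v_diag n p \<theta> (2 * n)"
  have "(lead_coeff y i j)\<^sup>2 * edge_var i j = (?a i)\<^sup>2 * edge_var i j
      + (if j = n then ?b\<^sup>2 * edge_var i j else 0) + (if j = n then 2 * ?b * ?a i * edge_var i j else 0)" for i j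
    by (simp add: lead_coeff_def power2_sum algebra_simps)
  then have "(\<Sum>(i, j)\<in>node_pairs n. (lead_coeff y i j)\<^sup>2 * edge_var i j)
      = (\<Sum>(i, j)\<in>node_pairs n. (?a i)\<^sup>2 * edge_var i j)
        + (\<Sum>(i, j)\<in>node_pairs n. if j = n then ?b\<^sup>2 * edge_var i j else 0)
        + (\<Sum>(i, j)\<in>node_pairs n. if j = n then 2 * ?b * ?a i * edge_var i j else 0)"
    by (simp add: case_prod_beta sum.distrib)
  also have "(\<Sum>(i, j)\<in>node_pairs n. (?a i)\<^sup>2 * edge_var i j) = (\<Sum>i\<in>{1..n}. (?a i)\<^sup>2 * sigma_sq n p \<theta> i)"
    unfolding sum_node_pairs by (intro sum.cong) (simp_all only: sigma_out sum_distrib_left)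
  also have "\<dots> = (\<Sum>r\<in>UNIV. (y $ r / v_diag n p \<theta> (idx r))\<^sup>2 * sigma_sq n p \<theta> (idx r))"
    by (subst sum_range_idx) (simp_all add: out_load_outside out_load_idx)
  also have "\<dots> = (\<Sum>r\<in>UNIV. out_scale (idx r) * (y $ r)\<^sup>2)"
    by (simp add: out_scale_def power_divide mult_ac)
  also have "(\<Sum>(i, j)\<in>node_pairs n. if j = n then ?b\<^sup>2 * edge_var i j else 0) = (\<Sum>j\<in>{1..n}. if j = n then ?b\<^sup>2 * sigma_sq n p \<theta> (2 * n) else 0)"
    unfolding sum_node_pairs' sigma_last by (intro sum.cong) (auto simp: sum_distrib_left)
  also have "\<dots> = last_scale * (\<Sum>r\<in>UNIV. y $ r)\<^sup>2"
    using n3 by (simp add: last_scale_def total_load_def power_divide)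
  also have "(\<Sum>(i, j)\<in>node_pairs n. if j = n then 2 * ?b * ?a i * edge_var i j else 0)
      = (\<Sum>j\<in>{1..n}. if j = n then (\<Sum>i\<in>{1..n} - {n}. 2 * ?b * ?a i * edge_var i n) else 0)"
    unfolding sum_node_pairs' by (intro sum.cong) auto
  also have "\<dots> = (\<Sum>i\<in>{1..n} - {n}. 2 * ?b * ?a i * edge_var i n)" using n3 by simp
  finally have eq: "(\<Sum>(i, j)\<in>node_pairs n. (lead_coeff y i j)\<^sup>2 * edge_var i j) - y \<bullet> (cov *v y)
      = (\<Sum>i\<in>{1..n} - {n}. 2 * ?b * ?a i * edge_var i n)"
    unfolding cov_quadratic by simp
  have "\<bar>\<Sum>i\<in>{1..n} - {n}. 2 * ?b * ?a i * edge_var i n\<bar> \<le> (\<Sum>i\<in>{1..n} - {n}. \<bar>2 * ?b * ?a i * edge_var i n\<bar>)" by (rule sum_abs)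
  also have "\<dots> \<le> (\<Sum>i\<in>{1..n}. \<bar>2 * ?b * ?a i * edge_var i n\<bar>)"
    by (rule sum_mono2[OF _ _ abs_ge_zero]) auto
  also have "\<dots> = (\<Sum>r\<in>UNIV. \<bar>2 * ?b * ?a (idx r) * edge_var (idx r) n\<bar>)"
    by (rule sum_range_idx[where f="\<lambda>i. \<bar>2 * ?b * ?a i * edge_var i n\<bar>"]) (simp add: out_load_outside)
  also have "\<dots> \<le> real (card (UNIV :: 'k set)) * (real CARD('k) * coeff_bound Y * coeff_bound Y)"
  proof (rule sum_bounded_above)
    fix r :: 'k
    have cb: "0 \<le> coeff_bound Y" using lead_coeff_le(1)[OF Y idx_in[of undefined]] by linarith
    have "\<bar>2 * ?b * ?a (idx r) * edge_var (idx r) n\<bar> = 2 * (\<bar>?b\<bar> * \<bar>?a (idx r)\<bar>) * edge_var (idx r) n"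
      using edge_var_bounds(3)[of "idx r" n] by (simp add: abs_mult)
    also have "\<dots> \<le> 2 * ((real CARD('k) * coeff_bound Y) * coeff_bound Y) * (1 / 4)"
      using lead_coeff_le(1,2)[OF Y idx_in[of r]] edge_var_bounds(2,3)[of "idx r" n] cb
      by (intro mult_mono mult_left_mono) (auto simp: less_imp_le)
    also have "\<dots> \<le> real CARD('k) * coeff_bound Y * coeff_bound Y" using cb by simp
    finally show "\<bar>2 * ?b * ?a (idx r) * edge_var (idx r) n\<bar> \<le> real CARD('k) * coeff_bound Y * coeff_bound Y" .
  qed
  also have "\<dots> = (real CARD('k) * coeff_bound Y)\<^sup>2" by (simp add: power2_eq_square)
  finally show ?thesis unfolding eq .
qed

text \<open>
  Since \<open>p (1 - p)\<close> bounds all entry variances from below, the sum of the cubes of the coefficients is at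
  most their maximum times the total variance, divided by \<open>p (1 - p)\<close>.
\<close>

lemma lead_char:
  fixes t :: "real^'k"
  defines "y \<equiv> matrix_inv_sqrt cov *v t" and "K \<equiv> real CARD('k)" and "b \<equiv> coeff_bound (coord_bound t)"
  assumes small: "(K + 1) * b \<le> 1"
  shows "cmod ((CLINT \<omega>|M. iexp (\<Sum>r\<in>UNIV. y $ r * lead (idx r) \<omega>)) - exp (- (norm t)\<^sup>2 / 2))
    \<le> (K + 1) * b * ((norm t)\<^sup>2 + (K * b)\<^sup>2) / (p * (1 - p)) + (K * b)\<^sup>2 / 2"
proof -
  let ?V = "\<Sum>(i, j)\<in>node_pairs n. (lead_coeff y i j)\<^sup>2 * edge_var i j"
  have Y: "\<bar>y $ r\<bar> \<le> coord_bound t" for r unfolding y_def by (rule coord_bound)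
  have b0: "0 \<le> b" using lead_coeff_le(1)[OF Y idx_in[of undefined]] unfolding b_def by linarith
  have quad: "y \<bullet> (cov *v y) = (norm t)\<^sup>2"
    unfolding y_def matrix_inv_sqrt(2)[OF cov_spd] by (simp add: dot_square_norm)
  have V: "\<bar>?V - (norm t)\<^sup>2\<bar> \<le> (K * b)\<^sup>2"
    using lead_variance[OF Y] unfolding quad K_def b_def .
  have c: "\<bar>lead_coeff y i j\<bar> \<le> (K + 1) * b" if "(i, j) \<in> node_pairs n" for i j
    using lead_coeff_le(3)[OF Y, of i j] that unfolding K_def b_def by (auto simp: node_pairs_def)
  have c1: "\<bar>lead_coeff y i j\<bar> \<le> 1" if "(i, j) \<in> node_pairs n" for i j using c[OF that] small by linarith
  have "cmod ((CLINT \<omega>|M. iexp (noise_form (lead_coeff y) \<omega>)) - exp (- ?V / 2))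
      \<le> (\<Sum>(i, j)\<in>node_pairs n. \<bar>lead_coeff y i j\<bar> ^ 3)"
    unfolding edge_var_def by (rule noise_form_char[OF c1])
  also have "\<dots> \<le> (\<Sum>(i, j)\<in>node_pairs n. ((K + 1) * b / (p * (1 - p))) * ((lead_coeff y i j)\<^sup>2 * edge_var i j))"
  proof (rule sum_mono, clarify)
    fix i j assume ij: "(i, j) \<in> node_pairs n"
    have "\<bar>lead_coeff y i j\<bar> ^ 3 = \<bar>lead_coeff y i j\<bar> * (lead_coeff y i j)\<^sup>2"
      by (simp add: power3_eq_cube power2_eq_square abs_mult_self_eq mult.assoc)
    also have "\<dots> \<le> ((K + 1) * b) * ((lead_coeff y i j)\<^sup>2 * (edge_var i j / (p * (1 - p))))"
    proof (rule mult_mono)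
      have "1 \<le> edge_var i j / (p * (1 - p))" using edge_var_bounds(1)[of i j] edge_var_bounds(4) by simp
      then show "(lead_coeff y i j)\<^sup>2 \<le> (lead_coeff y i j)\<^sup>2 * (edge_var i j / (p * (1 - p)))"
        using mult_left_mono[of 1 "edge_var i j / (p * (1 - p))" "(lead_coeff y i j)\<^sup>2"] by simp
    qed (use c[OF ij] b0 in \<open>auto simp: K_def\<close>)
    finally show "\<bar>lead_coeff y i j\<bar> ^ 3 \<le> ((K + 1) * b / (p * (1 - p))) * ((lead_coeff y i j)\<^sup>2 * edge_var i j)"
      by (simp add: mult_ac)
  qed
  also have "\<dots> = ((K + 1) * b / (p * (1 - p))) * ?V" by (simp add: sum_distrib_left case_prod_beta)
  also have "\<dots> \<le> ((K + 1) * b / (p * (1 - p))) * ((norm t)\<^sup>2 + (K * b)\<^sup>2)"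
    using V b0 edge_var_bounds(4) by (intro mult_left_mono) (auto simp: K_def)
  finally have 1: "cmod ((CLINT \<omega>|M. iexp (noise_form (lead_coeff y) \<omega>)) - exp (- ?V / 2))
      \<le> (K + 1) * b * ((norm t)\<^sup>2 + (K * b)\<^sup>2) / (p * (1 - p))" by simp
  have V0: "0 \<le> ?V" using edge_var_bounds(3) by (intro sum_nonneg) (auto simp: less_imp_le)
  have ml: "\<bar>exp (- u) - exp (- v)\<bar> \<le> \<bar>u - v\<bar>" if "0 \<le> u" "0 \<le> v" for u v :: real
  proof -
    have *: "exp (- u) - exp (- v) \<le> v - u" if "0 \<le> u" "u \<le> v" for u v :: real
    proof -
      have "exp (- u) - exp (- v) = exp (- u) * (1 - exp (- (v - u)))"
        by (simp add: right_diff_distrib flip: exp_add)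
      also have "\<dots> \<le> 1 * (v - u)"
      proof (rule mult_mono)
        have "1 + - (v - u) \<le> exp (- (v - u))" by (rule exp_ge_add_one_self)
        then show "1 - exp (- (v - u)) \<le> v - u" by linarith
      qed (use that in auto)
      finally show ?thesis by simp
    qed
    show ?thesis using *[of u v] *[of v u] that by (cases "u \<le> v") auto
  qed
  have "cmod (complex_of_real (exp (- ?V / 2)) - exp (- (norm t)\<^sup>2 / 2)) = \<bar>exp (- (?V / 2)) - exp (- ((norm t)\<^sup>2 / 2))\<bar>"
    unfolding of_real_diff[symmetric] norm_of_real by simp
  also have "\<dots> \<le> \<bar>?V / 2 - (norm t)\<^sup>2 / 2\<bar>" using V0 by (intro ml) auto
  also have "\<dots> \<le> (K * b)\<^sup>2 / 2" using V by linarith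
  finally have 2: "cmod (complex_of_real (exp (- ?V / 2)) - exp (- (norm t)\<^sup>2 / 2)) \<le> (K * b)\<^sup>2 / 2" .
  show ?thesis
    unfolding lead_form[symmetric]
    using norm_triangle_mono[OF 1 2] by simp
qed

text \<open>
  On the good event the error is the leading term up to the remainder; off it, two numbers of modulus \<open>1\<close>
  differ by at most \<open>2\<close>, which accounts for \<open>16 / n\<close>.
\<close>

lemma estimator_char:
  fixes t :: "real^'k"
  defines "K \<equiv> real CARD('k)" and "b \<equiv> coeff_bound (coord_bound t)"
  assumes est: "moment_estimator M n p a' est" and rn: "rel_noise \<le> min_wt / 4" and small: "(K + 1) * b \<le> 1"
  shows "cmod ((CLINT \<omega>|M. iexp (t \<bullet> (matrix_inv_sqrt cov *v (\<chi> r. est \<omega> (idx r) - \<theta> (idx r))))) - exp (- (norm t)\<^sup>2 / 2))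
    \<le> K * coord_bound t * remainder_bound + 16 / n
      + (K + 1) * b * ((norm t)\<^sup>2 + (K * b)\<^sup>2) / (p * (1 - p)) + (K * b)\<^sup>2 / 2"
proof -
  define y where "y = matrix_inv_sqrt cov *v t"
  define Z where "Z = (\<lambda>\<omega>. \<Sum>r\<in>UNIV. y $ r * (est \<omega> (idx r) - \<theta> (idx r)))"
  define L where "L = (\<lambda>\<omega>. \<Sum>r\<in>UNIV. y $ r * lead (idx r) \<omega>)"
  have Y: "\<bar>y $ r\<bar> \<le> coord_bound t" for r unfolding y_def by (rule coord_bound)
  have Y0: "0 \<le> coord_bound t" using Y[of undefined] by linarith
  have tZ: "t \<bullet> (matrix_inv_sqrt cov *v (\<chi> r. est \<omega> (idx r) - \<theta> (idx r))) = Z \<omega>" for \<omega>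
    using matrix_inv_sqrt(1)[OF cov_spd] unfolding symmetric_matrix_iff Z_def y_def
    by (simp add: inner_vec_def)
  have estm: "(\<lambda>\<omega>. est \<omega> (idx r)) \<in> borel_measurable M" for r
    using est idx_in[of r] unfolding moment_estimator_def by auto
  have Zm [measurable]: "Z \<in> borel_measurable M"
    unfolding Z_def using estm by (intro borel_measurable_sum borel_measurable_times borel_measurable_diff) auto
  have Lm [measurable]: "L \<in> borel_measurable M"
    unfolding L_def lead_form[symmetric] by measurable
  have iZ: "integrable M (\<lambda>\<omega>. iexp (Z \<omega>))" and iL: "integrable M (\<lambda>\<omega>. iexp (L \<omega>))"
    by (rule integrable_const_bound[where B=1]; simp)+
  have "cmod ((CLINT \<omega>|M. iexp (Z \<omega>)) - (CLINT \<omega>|M. iexp (L \<omega>))) = cmod (CLINT \<omega>|M. iexp (Z \<omega>) - iexp (L \<omega>))"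
    using iZ iL by simp
  also have "\<dots> \<le> (LINT \<omega>|M. cmod (iexp (Z \<omega>) - iexp (L \<omega>)))" by (rule integral_norm_bound)
  also have "\<dots> \<le> (LINT \<omega>|M. K * coord_bound t * remainder_bound + 2 * indicator (space M - good) \<omega>)"
  proof (rule integral_mono)
    show "integrable M (\<lambda>\<omega>. cmod (iexp (Z \<omega>) - iexp (L \<omega>)))" using iZ iL by simp
    show "integrable M (\<lambda>\<omega>. K * coord_bound t * remainder_bound + 2 * indicator (space M - good) \<omega> :: real)"
      using good_prob(1) by (auto simp: emeasure_eq_measure)
    fix \<omega> assume w: "\<omega> \<in> space M"
    show "cmod (iexp (Z \<omega>) - iexp (L \<omega>)) \<le> K * coord_bound t * remainder_bound + 2 * indicator (space M - good) \<omega>"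
    proof (cases "\<omega> \<in> good")
      case True
      have "cmod (iexp (Z \<omega>) - iexp (L \<omega>)) \<le> \<bar>Z \<omega> - L \<omega>\<bar>" by (rule iexp_lipschitz)
      also have "Z \<omega> - L \<omega> = (\<Sum>r\<in>UNIV. y $ r * (est \<omega> (idx r) - \<theta> (idx r) - lead (idx r) \<omega>))"
        by (simp add: Z_def L_def right_diff_distrib sum_subtractf)
      also have "\<bar>\<dots>\<bar> \<le> (\<Sum>r\<in>UNIV. \<bar>y $ r * (est \<omega> (idx r) - \<theta> (idx r) - lead (idx r) \<omega>)\<bar>)" by (rule sum_abs)
      also have "\<dots> \<le> real (card (UNIV :: 'k set)) * (coord_bound t * remainder_bound)"
        using Y estimator_close_to_lead[OF est rn True idx_in] Y0
        by (intro sum_bounded_above) (auto simp: abs_mult intro!: mult_mono)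
      finally show ?thesis using True by (simp add: K_def)
    next
      case False
      have "cmod (iexp (Z \<omega>) - iexp (L \<omega>)) \<le> cmod (iexp (Z \<omega>)) + cmod (iexp (L \<omega>))" by (rule norm_triangle_ineq4)
      also have "\<dots> = 2" by simp
      finally show ?thesis using False w Y0 remainder_bound_nonneg by (simp add: K_def add_increasing)
    qed
  qed
  also have "\<dots> = K * coord_bound t * remainder_bound + 2 * prob (space M - good)"
    using good_prob(1) by (subst Bochner_Integration.integral_add) (auto simp: prob_space emeasure_eq_measure)
  also have "\<dots> \<le> K * coord_bound t * remainder_bound + 16 / n" using good_prob(2) by simp
  finally have 1: "cmod ((CLINT \<omega>|M. iexp (Z \<omega>)) - (CLINT \<omega>|M. iexp (L \<omega>))) \<le> K * coord_bound t * remainder_bound + 16 / n" .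
  have 2: "cmod ((CLINT \<omega>|M. iexp (L \<omega>)) - exp (- (norm t)\<^sup>2 / 2))
    \<le> (K + 1) * b * ((norm t)\<^sup>2 + (K * b)\<^sup>2) / (p * (1 - p)) + (K * b)\<^sup>2 / 2"
    unfolding L_def y_def K_def b_def using small unfolding K_def b_def by (rule lead_char)
  show ?thesis unfolding tZ using norm_triangle_mono[OF 1 2] by simp
qed

end

section \<open>Rates\<close>

context flipped_graph
begin

text \<open>
  At most a constant, depending on the upper bound for the privacy parameters, times the quantity that
  the growth condition on \<open>\<theta>\<close> sends to \<open>0\<close>.
\<close>

definition rate_bound :: real where
  "rate_bound = exp (18 * par_norm n \<theta>) * ln n / (q * sqrt n)"

lemma rate_facts:
  defines "E \<equiv> exp (2 * par_norm n \<theta>)"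
  shows "1 \<le> E" "1 \<le> ln (real n)" "min_wt = 1 / (12 * E)" "n / (24 * E) \<le> min_sum"
    "\<And>k. k \<le> 9 \<Longrightarrow> E ^ k * ln n / (q * sqrt n) \<le> rate_bound"
    "\<And>k. k \<le> 9 \<Longrightarrow> E ^ k * ln n / sqrt n \<le> rate_bound"
proof -
  have "\<bar>\<theta> 1\<bar> \<le> par_norm n \<theta>" using n3 by (intro abs_par_le_norm) auto
  then show E: "1 \<le> E" by (simp add: E_def)
  have "exp 1 \<le> real n" using exp_le n3 by linarith
  then show l: "1 \<le> ln (real n)" using n3 by (simp add: ln_ge_iff)
  show m: "min_wt = 1 / (12 * E)" by (simp add: min_wt_def E_def exp_minus inverse_eq_divide)
  have "n / (24 * E) = (real n / 2) * min_wt" by (simp add: m)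
  also have "\<dots> \<le> min_sum" unfolding min_sum_def using n3 min_wt_pos by (intro mult_right_mono) auto
  finally show "n / (24 * E) \<le> min_sum" .
  have E9: "E ^ 9 = exp (18 * par_norm n \<theta>)" by (simp add: E_def flip: exp_of_nat_mult)
  show a: "E ^ k * ln n / (q * sqrt n) \<le> rate_bound" if "k \<le> 9" for k
    unfolding rate_bound_def E9[symmetric] using l q_pos E that
    by (intro divide_right_mono mult_right_mono power_increasing) auto
  show "E ^ k * ln n / sqrt n \<le> rate_bound" if "k \<le> 9" for k
  proof -
    have "q * sqrt n \<le> 1 * sqrt n" using p by (intro mult_right_mono) auto
    then have "E ^ k * ln n / sqrt n \<le> E ^ k * ln n / (q * sqrt n)"
      using l q_pos E n3 by (intro divide_left_mono) auto
    then show ?thesis using a[OF that] by linarith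
  qed
qed

lemma rel_noise_sq_le: "rel_noise\<^sup>2 \<le> 576 * (exp (2 * par_norm n \<theta>))\<^sup>2 * ln n / (q\<^sup>2 * n)"
proof -
  define E where "E = exp (2 * par_norm n \<theta>)"
  note r = rate_facts[folded E_def]
  have "rel_noise\<^sup>2 = (n * ln n) / (q\<^sup>2 * min_sum\<^sup>2)"
    using r(2) by (simp add: rel_noise_def noise_bound_def power_divide power_mult_distrib)
  also have "\<dots> \<le> (n * ln n) / (q\<^sup>2 * (n / (24 * E))\<^sup>2)"
    using r(1,2,4) q_pos n3 min_sum_pos
    by (intro divide_left_mono mult_left_mono power_mono mult_pos_pos) auto
  also have "\<dots> = 576 * E\<^sup>2 * ln n / (q\<^sup>2 * n)"
    using n3 r(1) by (simp add: power2_eq_square divide_simps)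
  finally show ?thesis by (simp add: E_def)
qed

lemma rel_noise_small: assumes "1152 * rate_bound \<le> 1" shows "rel_noise \<le> min_wt / 4"
proof -
  define E where "E = exp (2 * par_norm n \<theta>)"
  note r = rate_facts[folded E_def]
  have "rel_noise\<^sup>2 \<le> 576 * E\<^sup>2 * ln n / (q\<^sup>2 * n)" using rel_noise_sq_le by (simp add: E_def)
  also have "\<dots> \<le> 576 * E\<^sup>2 * (ln n)\<^sup>2 / (q\<^sup>2 * n)"
    using r(1,2) by (intro divide_right_mono mult_left_mono) (auto simp: power2_eq_square)
  also have "\<dots> = (24 * (E * ln n / (q * sqrt n)))\<^sup>2"
    by (simp add: power_mult_distrib power_divide)
  finally have "rel_noise \<le> 24 * (E * ln n / (q * sqrt n))"
    by (rule power2_le_imp_le) (use r(1,2) q_pos in auto)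
  moreover have "1152 * (E ^ 2 * ln n / (q * sqrt n)) \<le> 1" using r(5)[of 2] assms by simp
  then have "24 * (E * ln n / (q * sqrt n)) * (48 * E) \<le> 1" by (simp add: power2_eq_square mult_ac)
  then have "24 * (E * ln n / (q * sqrt n)) \<le> 1 / (48 * E)" using r(1) by (subst pos_le_divide_eq) auto
  ultimately show ?thesis using r(3) by simp
qed

text \<open>
  With \<open>E = exp (2 \<parallel>\<theta>\<parallel>)\<close> and \<open>min_wt = 1 / (12 E)\<close>, the Taylor part is \<open>41472 E\<^sup>4 rel_noise\<^sup>2\<close> and the averaged
  part \<open>24 E\<close> times the averaged noise; then \<open>23887872 = 41472 \<sqdot> 576\<close> and \<open>3456 = 24 \<sqdot> 144\<close>.
\<close>

lemma remainder_bound_le: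
  "remainder_bound \<le> 23887872 * ((exp (2 * par_norm n \<theta>)) ^ 6 * ln n / (q\<^sup>2 * n)) + 3456 * ((exp (2 * par_norm n \<theta>)) ^ 3 * ln n / (q * n))"
proof -
  define E where "E = exp (2 * par_norm n \<theta>)"
  note r = rate_facts[folded E_def]
  have E0: "E \<noteq> 0" "0 < E" using r(1) by auto
  have "averaged_noise_bound = n / (4 * min_sum\<^sup>2) * sqrt (ln n)"
  proof -
    have "(real n)\<^sup>2 / (16 * min_sum ^ 4) = (n / (4 * min_sum\<^sup>2))\<^sup>2"
      by (simp add: power_divide power_mult_distrib flip: power_mult)
    then show ?thesis using min_sum_pos by (simp add: averaged_noise_bound_def real_sqrt_mult)
  qed
  also have "\<dots> \<le> n / (4 * (n / (24 * E))\<^sup>2) * ln n"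
  proof (rule mult_mono)
    show "n / (4 * min_sum\<^sup>2) \<le> n / (4 * (n / (24 * E))\<^sup>2)"
      using r(1,4) min_sum_pos n3 by (intro divide_left_mono mult_left_mono power_mono mult_pos_pos) auto
    show "sqrt (ln n) \<le> ln n" using r(2) by (intro real_le_lsqrt) (auto simp: power2_eq_square)
  qed (use r(2) in auto)
  also have "\<dots> = 144 * E\<^sup>2 * ln n / n" using n3 E0 by (simp add: power2_eq_square divide_simps)
  finally have avg: "averaged_noise_bound \<le> 144 * E\<^sup>2 * ln n / n" .
  have "remainder_bound = 41472 * E ^ 4 * rel_noise\<^sup>2 + 24 * E * (averaged_noise_bound / q)"
    unfolding remainder_bound_def r(3) using E0 q_pos
    by (simp add: power2_eq_square power4_eq_xxxx divide_simps) (simp add: algebra_simps)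
  also have "\<dots> \<le> 41472 * E ^ 4 * (576 * E\<^sup>2 * ln n / (q\<^sup>2 * n)) + 24 * E * (144 * E\<^sup>2 * ln n / n / q)"
    using rel_noise_sq_le avg E0 q_pos unfolding E_def[symmetric]
    by (intro add_mono mult_left_mono divide_right_mono) auto
  also have "\<dots> = 23887872 * (E ^ 6 * ln n / (q\<^sup>2 * n)) + 3456 * (E ^ 3 * ln n / (q * n))"
    by (simp add: power2_eq_square eval_nat_numeral mult_ac)
  finally show ?thesis by (simp add: E_def)
qed

end

context flipped_graph_coords
begin

text \<open>
  Here \<open>5972832 = (23887872 + 3456) / 4\<close>.  The factor \<open>q\<close> in the coordinate bound cancels one of the two
  factors \<open>1 / q\<close> of the remainder, so that only one power of \<open>1 / \<epsilon>\<close> enters the rate.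
\<close>

lemma coord_remainder_le:
  "coord_bound t * remainder_bound \<le> 5972832 * norm t * rate_bound / sqrt (p * (1 - p))"
proof -
  define E where "E = exp (2 * par_norm n \<theta>)"
  note r = rate_facts[folded E_def]
  define S where "S = norm t / (4 * sqrt (p * (1 - p)))"
  have S0: "0 \<le> S" using edge_var_bounds(4) by (simp add: S_def)
  have Y: "coord_bound t = S * (q * sqrt n)" by (simp add: coord_bound_def S_def)
  have sn: "real n = sqrt n * sqrt n" "0 < sqrt n" using n3 by auto
  have "coord_bound t * remainder_bound
      \<le> S * (q * sqrt n) * (23887872 * (E ^ 6 * ln n / (q\<^sup>2 * n)) + 3456 * (E ^ 3 * ln n / (q * n)))"
    unfolding Y using remainder_bound_le S0 q_pos by (intro mult_left_mono) (auto simp: E_def)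
  also have "\<dots> = S * (23887872 * (q * sqrt n * (E ^ 6 * ln n / (q\<^sup>2 * n))) + 3456 * (q * sqrt n * (E ^ 3 * ln n / (q * n))))"
    by (simp add: algebra_simps)
  also have "q * sqrt n * (E ^ 6 * ln n / (q\<^sup>2 * n)) = E ^ 6 * ln n / (q * sqrt n)"
    using sn q_pos by (simp add: power2_eq_square divide_simps)
  also have "q * sqrt n * (E ^ 3 * ln n / (q * n)) = E ^ 3 * ln n / sqrt n"
    using sn q_pos by (simp add: divide_simps)
  also have "S * (23887872 * (E ^ 6 * ln n / (q * sqrt n)) + 3456 * (E ^ 3 * ln n / sqrt n))
      \<le> S * (23887872 * rate_bound + 3456 * rate_bound)"
    using r(5)[of 6] r(6)[of 3] S0 by (intro mult_left_mono add_mono) auto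
  also have "\<dots> = 5972832 * norm t * rate_bound / sqrt (p * (1 - p))"
    by (simp add: S_def)
  finally show ?thesis .
qed

lemma coeff_bound_le: "coeff_bound (coord_bound t) \<le> 6 * norm t * rate_bound / sqrt (p * (1 - p))"
proof -
  define E where "E = exp (2 * par_norm n \<theta>)"
  note r = rate_facts[folded E_def]
  define S where "S = norm t / (4 * sqrt (p * (1 - p)))"
  have S0: "0 \<le> S" using edge_var_bounds(4) by (simp add: S_def)
  have sn: "real n = sqrt n * sqrt n" "0 < sqrt n" using n3 by auto
  have "coeff_bound (coord_bound t) = S * sqrt n / min_sum"
    using q_pos by (simp add: coeff_bound_def coord_bound_def S_def)
  also have "\<dots> \<le> S * sqrt n / (n / (24 * E))"
    using S0 r(1,4) n3 min_sum_pos by (intro divide_left_mono mult_pos_pos) auto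
  also have "\<dots> = S * (24 * (E / sqrt n))" using sn r(1) by (simp add: divide_simps)
  also have "\<dots> \<le> S * (24 * (E ^ 1 * ln n / sqrt n))"
    using S0 r(1,2) sn by (intro mult_left_mono divide_right_mono) auto
  also have "\<dots> \<le> S * (24 * rate_bound)" using r(6)[of 1] S0 by (intro mult_left_mono) auto
  also have "\<dots> = 6 * norm t * rate_bound / sqrt (p * (1 - p))" by (simp add: S_def)
  finally show ?thesis .
qed

lemma estimator_char_rate:
  fixes t :: "real^'k" and \<kappa> :: real
  defines "K \<equiv> real CARD('k)" and "B \<equiv> 6 * norm t * rate_bound / sqrt \<kappa>"
  assumes est: "moment_estimator M n p a' est" and \<kappa>: "0 < \<kappa>" "\<kappa> \<le> p * (1 - p)"
    and small: "1152 * rate_bound \<le> 1" "(K + 1) * B \<le> 1"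
  shows "cmod ((CLINT \<omega>|M. iexp (t \<bullet> (matrix_inv_sqrt cov *v (\<chi> r. est \<omega> (idx r) - \<theta> (idx r))))) - exp (- (norm t)\<^sup>2 / 2))
    \<le> K * (5972832 * norm t * rate_bound / sqrt \<kappa>) + 16 / n
      + (K + 1) * B * ((norm t)\<^sup>2 + (K * B)\<^sup>2) / \<kappa> + (K * B)\<^sup>2 / 2"
proof -
  define b where "b = coeff_bound (coord_bound t)"
  have r0: "0 \<le> rate_bound" using n3 q_pos by (simp add: rate_bound_def)
  have sq: "sqrt \<kappa> \<le> sqrt (p * (1 - p))" "0 < sqrt \<kappa>" using \<kappa> by auto
  have "b \<le> 6 * norm t * rate_bound / sqrt (p * (1 - p))" unfolding b_def by (rule coeff_bound_le)
  also have "\<dots> \<le> B" unfolding B_def using sq r0 by (intro divide_left_mono mult_pos_pos) auto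
  finally have bB: "b \<le> B" .
  have b0: "0 \<le> b"
    using q_pos min_sum_pos edge_var_bounds(4) by (simp add: b_def coeff_bound_def coord_bound_def)
  have K0: "0 \<le> K" by (simp add: K_def)
  have "(K + 1) * b \<le> (K + 1) * B" using bB K0 by (intro mult_left_mono) auto
  then have kb: "(K + 1) * b \<le> 1" using small(2) by linarith
  have "coord_bound t * remainder_bound \<le> 5972832 * norm t * rate_bound / sqrt (p * (1 - p))"
    by (rule coord_remainder_le)
  also have "\<dots> \<le> 5972832 * norm t * rate_bound / sqrt \<kappa>"
    using sq r0 by (intro divide_left_mono mult_pos_pos) auto
  finally have 1: "K * coord_bound t * remainder_bound \<le> K * (5972832 * norm t * rate_bound / sqrt \<kappa>)"
    using K0 by (simp only: mult.assoc mult_left_mono)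
  have 2: "(K + 1) * b * ((norm t)\<^sup>2 + (K * b)\<^sup>2) / (p * (1 - p)) \<le> (K + 1) * B * ((norm t)\<^sup>2 + (K * B)\<^sup>2) / \<kappa>"
    using bB b0 K0 \<kappa> by (intro frac_le mult_mono add_mono power_mono mult_left_mono mult_nonneg_nonneg add_nonneg_nonneg) auto
  have 3: "(K * b)\<^sup>2 / 2 \<le> (K * B)\<^sup>2 / 2"
    using bB b0 K0 by (intro divide_right_mono power_mono mult_left_mono) auto
  show ?thesis
    using estimator_char[OF est rel_noise_small[OF small(1)], of t] kb 1 2 3 unfolding K_def b_def by linarith
qed

end

section \<open>The limit theorem\<close>

text \<open>
  An upper bound on \<open>\<epsilon>\<close> keeps \<open>p\<close> away from \<open>1\<close> and makes \<open>q = tanh (\<epsilon> / 2)\<close> comparable with \<open>\<epsilon>\<close>.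
\<close>

lemma keep_prob_bounds:
  assumes "0 < e" "e \<le> C"
  shows "1 / 2 < keep_prob e" "keep_prob e < 1" "exp (- C) / 4 \<le> keep_prob e * (1 - keep_prob e)"
    "e * exp (- C) / 2 \<le> 2 * keep_prob e - 1"
proof -
  define x where "x = exp (- e)"
  have x: "0 < x" "x < 1" "exp (- C) \<le> x" using assms by (auto simp: x_def)
  have k: "keep_prob e = 1 / (1 + x)" by (simp add: keep_prob_def x_def)
  have k1: "1 - keep_prob e = x / (1 + x)" using x by (simp add: k field_simps)
  have k2: "2 * keep_prob e - 1 = (1 - x) / (1 + x)" using x by (simp add: k field_simps)
  show "1 / 2 < keep_prob e" "keep_prob e < 1" using x by (auto simp: k field_simps)
  have "exp (- C) / 4 \<le> x / 4" using x by simp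
  also have "\<dots> \<le> x / ((1 + x) * (1 + x))"
    using x mult_mono[of "1 + x" 2 "1 + x" 2] by (intro divide_left_mono) auto
  also have "\<dots> = keep_prob e * (1 - keep_prob e)" by (simp only: k1) (simp add: k)
  finally show "exp (- C) / 4 \<le> keep_prob e * (1 - keep_prob e)" .
  have "e * exp (- C) \<le> e * x" using assms x by (intro mult_left_mono) auto
  also have "\<dots> \<le> (exp e - 1) * x"
  proof (rule mult_right_mono)
    have "1 + e \<le> exp e" by (rule exp_ge_add_one_self)
    then show "e \<le> exp e - 1" by linarith
  qed (use x in simp)
  also have "\<dots> = 1 - x" by (simp add: x_def left_diff_distrib flip: exp_add)
  finally have "e * exp (- C) \<le> 1 - x" .
  then have "e * exp (- C) / 2 \<le> (1 - x) / 2" by simp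
  also have "\<dots> \<le> (1 - x) / (1 + x)" using x by (intro divide_left_mono) auto
  finally show "e * exp (- C) / 2 \<le> 2 * keep_prob e - 1" unfolding k2 .
qed

lemma weak_conv_vec_offset:
  fixes \<mu> :: "nat \<Rightarrow> (real^'k) measure"
  shows "weak_conv_vec (\<lambda>n. \<mu> (n + N)) \<nu> \<Longrightarrow> weak_conv_vec \<mu> \<nu>"
  unfolding weak_conv_vec_def
proof (intro allI impI)
  fix f :: "real^'k \<Rightarrow> real"
  assume conv: "\<forall>f :: real^'k \<Rightarrow> real. continuous_on UNIV f \<and> bounded (range f) \<longrightarrow> (\<lambda>n. integral\<^sup>L (\<mu> (n + N)) f) \<longlonglongrightarrow> integral\<^sup>L \<nu> f"
    and f: "continuous_on UNIV f \<and> bounded (range f)"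
  have "(\<lambda>n. integral\<^sup>L (\<mu> (n + N)) f) \<longlonglongrightarrow> integral\<^sup>L \<nu> f"
    by (rule mp[OF spec[OF conv] f])
  then show "(\<lambda>n. integral\<^sup>L (\<mu> n) f) \<longlonglongrightarrow> integral\<^sup>L \<nu> f" by (rule LIMSEQ_offset)
qed

theorem theorem2:
  fixes M :: "nat \<Rightarrow> 'w measure"
    and \<theta> :: "nat \<Rightarrow> nat \<Rightarrow> real"
    and \<epsilon> :: "nat \<Rightarrow> real"
    and C :: real
    and a a' :: "nat \<Rightarrow> nat \<Rightarrow> nat \<Rightarrow> 'w \<Rightarrow> bool"
    and est :: "nat \<Rightarrow> 'w \<Rightarrow> nat \<Rightarrow> real"
    and idx :: "'k::finite \<Rightarrow> nat"
  assumes prob: "\<And>n. n \<ge> 2 \<Longrightarrow> prob_space (M n)"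
    and eps_pos: "\<And>n. n \<ge> 2 \<Longrightarrow> \<epsilon> n > 0"
    and eps_bounded: "\<And>n. n \<ge> 2 \<Longrightarrow> \<epsilon> n \<le> C"
    and model: "\<And>n. n \<ge> 2 \<Longrightarrow> p0_model (M n) n (\<theta> n) (a n)"
    and flip: "\<And>n. n \<ge> 2 \<Longrightarrow> edge_flip (M n) n (keep_prob (\<epsilon> n)) (a n) (a' n)"
    and estimator: "\<And>n. n \<ge> 2 \<Longrightarrow> moment_estimator (M n) n (keep_prob (\<epsilon> n)) (a' n) (est n)"
    and rate: "(\<lambda>n. inverse (\<epsilon> n) * exp (18 * par_norm n (\<theta> n))) \<in> o(\<lambda>n. sqrt (real n) / ln (real n))"
    and idx: "bij_betw idx UNIV {1..CARD('k)}"
  shows "weak_conv_vec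
           (\<lambda>n. distr (M n) borel
              (\<lambda>\<omega>. matrix_inv_sqrt (\<chi> r s. asymp_cov n (keep_prob (\<epsilon> n)) (\<theta> n) (idx r) (idx s))
                     *v (\<chi> r. est n \<omega> (idx r) - \<theta> n (idx r))))
           std_normal_vec"
proof -
  \<comment> \<open>For \<open>n \<ge> N\<close> all selected coordinates are parameters \<open>\<alpha>\<^sub>i\<close> with \<open>i < n\<close>.\<close>
  define N where "N = CARD('k) + 3"
  define \<kappa> where "\<kappa> = exp (- C) / 4"
  define K where "K = real CARD('k)"
  define rb where "rb = (\<lambda>n. exp (18 * par_norm n (\<theta> n)) * ln n / ((2 * keep_prob (\<epsilon> n) - 1) * sqrt n))"
  define X where "X = (\<lambda>n \<omega>. matrix_inv_sqrt (\<chi> r s. asymp_cov n (keep_prob (\<epsilon> n)) (\<theta> n) (idx r) (idx s))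
                     *v (\<chi> r. est n \<omega> (idx r) - \<theta> n (idx r)) :: real^'k)"
  have \<kappa>: "0 < \<kappa>" by (simp add: \<kappa>_def)
  have graph: "flipped_graph_coords (M n) n (keep_prob (\<epsilon> n)) (\<theta> n) (a n) (a' n) idx" if "n \<ge> N" for n
  proof -
    have n2: "n \<ge> 2" "n \<ge> 3" "CARD('k) < n" using that by (auto simp: N_def)
    interpret prob_space "M n" by (rule prob[OF n2(1)])
    show ?thesis
      using model[OF n2(1)] flip[OF n2(1)] keep_prob_bounds[OF eps_pos[OF n2(1)] eps_bounded[OF n2(1)]] n2 idx
      by unfold_locales auto
  qed
  have rb0: "rb \<longlonglongrightarrow> 0"
  proof -
    have "(\<lambda>n. inverse (\<epsilon> n) * exp (18 * par_norm n (\<theta> n)) / (sqrt (real n) / ln (real n))) \<longlonglongrightarrow> 0"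
      using rate by (rule smalloD_tendsto)
    then have lim: "(\<lambda>n. 2 * exp C * (inverse (\<epsilon> n) * exp (18 * par_norm n (\<theta> n)) / (sqrt (real n) / ln (real n)))) \<longlonglongrightarrow> 2 * exp C * 0"
      by (intro tendsto_mult tendsto_const)
    show ?thesis
    proof (rule Lim_null_comparison)
      show "(\<lambda>n. 2 * exp C * (inverse (\<epsilon> n) * exp (18 * par_norm n (\<theta> n)) / (sqrt (real n) / ln (real n)))) \<longlonglongrightarrow> 0"
        using lim by simp
      show "\<forall>\<^sub>F n in sequentially. norm (rb n) \<le> 2 * exp C * (inverse (\<epsilon> n) * exp (18 * par_norm n (\<theta> n)) / (sqrt (real n) / ln (real n)))"
        using eventually_ge_at_top[of 3]
      proof eventually_elim
        case (elim n)
        then have n2: "n \<ge> 2" by simp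
        define q where "q = 2 * keep_prob (\<epsilon> n) - 1"
        define P where "P = exp (18 * par_norm n (\<theta> n)) * ln n / sqrt n"
        have P: "0 \<le> P" using elim by (simp add: P_def)
        have e: "0 < \<epsilon> n" by (rule eps_pos[OF n2])
        have q: "\<epsilon> n * exp (- C) / 2 \<le> q" unfolding q_def by (rule keep_prob_bounds(4)[OF e eps_bounded[OF n2]])
        have e2: "0 < \<epsilon> n * exp (- C) / 2" using e by simp
        have "rb n = P / q" by (simp add: rb_def P_def q_def mult.commute)
        moreover have "0 \<le> P / q" using P q e2 by (intro divide_nonneg_nonneg) auto
        ultimately have "norm (rb n) = P / q" by (simp only: real_norm_def abs_of_nonneg)
        also have "\<dots> \<le> P / (\<epsilon> n * exp (- C) / 2)" using P q e2 by (intro divide_left_mono mult_pos_pos) auto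
        also have "P / (\<epsilon> n * exp (- C) / 2) = 2 * exp C * (inverse (\<epsilon> n) * exp (18 * par_norm n (\<theta> n)) / (sqrt (real n) / ln (real n)))"
        proof -
          have gen: "F * l / s / (e * c / 2) = 2 * D * (inverse e * F / (s / l))" if "D * c = 1" for F l s e c D :: real
          proof -
            have "c = inverse D" using that inverse_unique[of D c] by simp
            then show ?thesis by (simp only: divide_inverse inverse_mult_distrib inverse_inverse_eq mult_ac)
          qed
          have "exp C * exp (- C) = 1" by (simp flip: exp_add)
          from gen[OF this] show ?thesis unfolding P_def .
        qed
        finally show ?case .
      qed
    qed
  qed
  have char: "(\<lambda>n. CLINT \<omega>|M n. iexp (t \<bullet> X n \<omega>)) \<longlonglongrightarrow> exp (- (norm t)\<^sup>2 / 2)" for t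
  proof -
    define B where "B = (\<lambda>n. 6 * norm t * rb n / sqrt \<kappa>)"
    have B0: "B \<longlonglongrightarrow> 6 * norm t * 0 / sqrt \<kappa>" unfolding B_def
      by (intro tendsto_mult tendsto_divide tendsto_const rb0) (use \<kappa> in auto)
    define err where "err = (\<lambda>n. K * (5972832 * norm t * rb n / sqrt \<kappa>) + 16 / real n
      + (K + 1) * B n * ((norm t)\<^sup>2 + (K * B n)\<^sup>2) / \<kappa> + (K * B n)\<^sup>2 / 2)"
    have "err \<longlonglongrightarrow> K * (5972832 * norm t * 0 / sqrt \<kappa>) + 0
      + (K + 1) * (6 * norm t * 0 / sqrt \<kappa>) * ((norm t)\<^sup>2 + (K * (6 * norm t * 0 / sqrt \<kappa>))\<^sup>2) / \<kappa> + (K * (6 * norm t * 0 / sqrt \<kappa>))\<^sup>2 / 2"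
      unfolding err_def
      by (intro tendsto_add tendsto_mult tendsto_divide tendsto_power tendsto_const rb0 B0 lim_const_over_n)
         (use \<kappa> in auto)
    then have err0: "err \<longlonglongrightarrow> 0" by simp
    have lim1: "(\<lambda>n. 1152 * rb n) \<longlonglongrightarrow> 1152 * 0"
      and lim2: "(\<lambda>n. (K + 1) * B n) \<longlonglongrightarrow> (K + 1) * (6 * norm t * 0 / sqrt \<kappa>)"
      by (intro tendsto_mult tendsto_const rb0 B0)+
    have "\<forall>\<^sub>F n in sequentially. 1152 * rb n < 1" using lim1 by (rule order_tendstoD(2)) simp
    moreover have "\<forall>\<^sub>F n in sequentially. (K + 1) * B n < 1" using lim2 by (rule order_tendstoD(2)) simp
    ultimately have "\<forall>\<^sub>F n in sequentially. norm ((CLINT \<omega>|M n. iexp (t \<bullet> X n \<omega>)) - exp (- (norm t)\<^sup>2 / 2)) \<le> err n"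
      using eventually_ge_at_top[of N]
    proof eventually_elim
      case (elim n)
      have n2: "n \<ge> 2" using elim(3) by (simp add: N_def)
      interpret flipped_graph_coords "M n" n "keep_prob (\<epsilon> n)" "\<theta> n" "a n" "a' n" idx
        by (rule graph[OF elim(3)])
      have rb: "rate_bound = rb n" by (simp add: rate_bound_def rb_def)
      have k: "\<kappa> \<le> keep_prob (\<epsilon> n) * (1 - keep_prob (\<epsilon> n))"
        unfolding \<kappa>_def by (rule keep_prob_bounds(3)[OF eps_pos[OF n2] eps_bounded[OF n2]])
      show ?case
        using estimator_char_rate[OF estimator[OF n2] \<kappa> k, of t] elim(1,2)
        unfolding rb cov_def X_def err_def B_def K_def by simp
    qed
    then have "(\<lambda>n. (CLINT \<omega>|M n. iexp (t \<bullet> X n \<omega>)) - exp (- (norm t)\<^sup>2 / 2)) \<longlonglongrightarrow> 0"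
      using err0 by (rule Lim_null_comparison)
    then show ?thesis by (rule LIM_zero_cancel)
  qed
  have Xm: "X n \<in> borel_measurable (M n)" if "n \<ge> N" for n
  proof -
    have n2: "n \<ge> 2" using that by (simp add: N_def)
    interpret flipped_graph_coords "M n" n "keep_prob (\<epsilon> n)" "\<theta> n" "a n" "a' n" idx
      by (rule graph[OF that])
    have m: "(\<lambda>\<omega>. est n \<omega> (idx r)) \<in> borel_measurable (M n)" for r
      using estimator[OF n2] idx_in[of r] unfolding moment_estimator_def by auto
    have "(\<lambda>\<omega>. \<chi> r. est n \<omega> (idx r) - \<theta> n (idx r)) \<in> borel_measurable (M n)"
      unfolding borel_measurable_euclidean_space[where 'c="real^'k"] Basis_real_cart
      using m by (auto simp: inner_axis)
    then show ?thesis
      unfolding X_def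
      by (rule measurable_compose) (intro borel_measurable_continuous_onI linear_continuous_on matrix_vector_mul_bounded_linear)
  qed
  have "weak_conv_vec (\<lambda>n. distr (M (n + N)) borel (X (n + N))) std_normal_vec"
  proof (rule weak_conv_std_normal_vecI)
    fix n
    have n2: "n + N \<ge> 2" by (simp add: N_def)
    interpret prob_space "M (n + N)" by (rule prob[OF n2])
    show "prob_space (distr (M (n + N)) borel (X (n + N)))"
      by (rule prob_space_distr) (rule Xm, simp)
  next
    fix t :: "real^'k"
    have "(CLINT x|distr (M (n + N)) borel (X (n + N)). iexp (t \<bullet> x)) = (CLINT \<omega>|M (n + N). iexp (t \<bullet> X (n + N) \<omega>))" for n
      using Xm[of "n + N"] by (subst integral_distr) auto
    then show "(\<lambda>n. CLINT x|distr (M (n + N)) borel (X (n + N)). iexp (t \<bullet> x)) \<longlonglongrightarrow> exp (- (norm t)\<^sup>2 / 2)"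
      using LIMSEQ_ignore_initial_segment[OF char[of t], of N] by simp
  qed simp
  then show ?thesis
    unfolding X_def[abs_def] by (rule weak_conv_vec_offset)
qed

end
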